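(* Let $k>1$ be an integer and let $M\subset\mathbb{C}^{3k-1}$ be a $2k$-dimensional smooth compact connected submanifold that is totally real except on a finite set $S$ of generic CR-singularities. Then: (1) There are a neighbourhood $U$ of $M$ and a smooth nonnegative function $\rho:U\to\mathbb{R}$ such that $M=\rho^{-1}(0)$ and $\rho$ is strictly plurisubharmonic on $U\setminus S$. (2) If $M$ is rationally convex, then there is a smooth plurisubharmonic function $\varphi$ on $\mathbb{C}^{3k-1}$ that is strictly plurisubharmonic on $\mathbb{C}^{3k-1}\setminus S$ and such that $M$ is isotropic with respect to $dd^c\varphi$, i.e. $\iota^*(dd^c\varphi)=0$, where $\iota:M\hookrightarrow\mathbb{C}^{3k-1}$ is the inclusion map. (3) If $M$ is polynomially convex, then there is a smooth nonnegative function $\rho$ on $\mathbb{C}^{3k-1}$ such that $M=\rho^{-1}(0)$ and $\rho$ is strictly plurisubharmonic on $\mathbb{C}^{3k-1}\setminus S$.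
   Context: Convexity: the polynomially convex hull of a compact set $X\subset\mathbb{C}^n$ is $\widehat X=\{x\in\mathbb{C}^n: |P(x)|\le \sup_{X}|P| \text{ for all holomorphic polynomials } P\}$; $X$ is polynomially convex if $X=\widehat X$. The rationally convex hull and rational convexity are defined in the same way, with polynomials replaced by rational functions on $\mathbb{C}^n$ with no poles on $X$. CR-singularities: for a smooth real submanifold $M\subset\mathbb{C}^n$ and $p\in M$, let $H_pM=T_pM\cap iT_pM$ be the maximal complex-linear subspace of the real tangent space $T_pM$. $M$ is totally real at $p$ if $H_pM=\{0\}$; $p$ is a CR-singularity of $M$ if $\dim_{\mathbb{C}}H_pM\ge 1$. Beloshapka-Coffman normal form: let $Z=(z,w_1,\dots,w_{2k-2},\zeta_1,\dots,\zeta_k)$ be the complex coordinates on $\mathbb{C}^{3k-1}$, with $w_\tau=u_\tau+iv_\tau$, and let $O$ be the origin. Set $$\mathcal{M}_k=\left\{Z\in\mathbb{C}^{3k-1}:\ v_\tau=0\ (1\le\tau\le 2k-2),\ \ \zeta_1=|z|^2+\overline z(u_1+iu_2),\ \ \zeta_\sigma=\overline z(u_{2\sigma-1}+iu_{2\sigma})\ (2\le\sigma\le k-1),\ \ \zeta_k=\overline z^2\right\}.$$ Generic CR-singularity: a CR-singularity $p$ of a $2k$-dimensional submanifold $M\subset\mathbb{C}^{3k-1}$ is called generic if $M$ is real analytic near $p$ and $p$ is nondegenerate in the sense of Beloshapka and Coffman (certain full-rank conditions on the second-order derivatives of graphing functions of $M$ at $p$). For the present purposes this means: there are a neighbourhood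 $W$ of $p$ in $\mathbb{C}^{3k-1}$, a neighbourhood $W'$ of $O$, and a biholomorphism $\Phi:W\to W'$ with $\Phi(p)=O$ and $\Phi(M\cap W)=\mathcal{M}_k\cap W'$. Here $d^c=i(\overline\partial-\partial)$ (any positive normalization gives the same statement). *)

theory Defs
  imports "HOL-Analysis.Analysis"
begin

section \<open>Smooth maps, submanifolds and tangent spaces\<close>

text \<open>
  Throughout, \<open>\<complex>\<^sup>n\<close> is \<open>complex ^ 'n\<close>; its complex scalar multiplication is \<open>*s\<close>
  (while \<open>*\<^sub>R\<close>, \<open>dim\<close>, derivatives and so on refer to the underlying real Euclidean space,
  of real dimension \<open>2n\<close>).
\<close>

text \<open>Iterated directional derivatives; only meant for open \<open>U\<close>.\<close>

primrec Ck_on :: "nat \<Rightarrow> 'a::real_normed_vector set \<Rightarrow> ('a \<Rightarrow> 'b::real_normed_vector) \<Rightarrow> bool" where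
  "Ck_on 0 U f \<longleftrightarrow> continuous_on U f"
| "Ck_on (Suc m) U f \<longleftrightarrow>
     (\<forall>x\<in>U. f differentiable at x) \<and> (\<forall>v. Ck_on m U (\<lambda>x. frechet_derivative f (at x) v))"

definition smooth_on :: "'a::real_normed_vector set \<Rightarrow> ('a \<Rightarrow> 'b::real_normed_vector) \<Rightarrow> bool" where
  "smooth_on U f \<longleftrightarrow> (\<forall>m. Ck_on m U f)"

text \<open>Embedded submanifolds without boundary, given by slice charts.\<close>

definition smooth_submanifold :: "nat \<Rightarrow> 'a::euclidean_space set \<Rightarrow> bool" where
  "smooth_submanifold d M \<longleftrightarrow>
     (\<forall>p\<in>M. \<exists>U V L f g. open U \<and> open V \<and> p \<in> U \<and> subspace (L :: 'a set) \<and> dim L = d \<and>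
        homeomorphism U V f g \<and> smooth_on U f \<and> smooth_on V g \<and> f ` (M \<inter> U) = L \<inter> V)"

text \<open>Velocities at \<open>p\<close> of smooth curves in \<open>M\<close>.\<close>

definition tangent_space :: "'a::real_normed_vector set \<Rightarrow> 'a \<Rightarrow> 'a set" where
  "tangent_space M p =
     {v. \<exists>(\<gamma> :: real \<Rightarrow> 'a) e. e > 0 \<and> smooth_on {-e<..<e} \<gamma> \<and> \<gamma> ` {-e<..<e} \<subseteq> M \<and>
           \<gamma> 0 = p \<and> (\<gamma> has_vector_derivative v) (at 0)}"


section \<open>CR-singularities\<close>

definition complex_tangent_space :: "(complex ^ 'n) set \<Rightarrow> complex ^ 'n \<Rightarrow> (complex ^ 'n) set" where
  "complex_tangent_space M p = tangent_space M p \<inter> (\<lambda>v. \<i> *s v) ` tangent_space M p"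

definition totally_real_at :: "(complex ^ 'n) set \<Rightarrow> complex ^ 'n \<Rightarrow> bool" where
  "totally_real_at M p \<longleftrightarrow> complex_tangent_space M p = {0}"

text \<open>Here \<open>vec.dim\<close> is the dimension over \<open>\<complex>\<close>.\<close>

definition CR_singularity :: "(complex ^ 'n) set \<Rightarrow> complex ^ 'n \<Rightarrow> bool" where
  "CR_singularity M p \<longleftrightarrow> p \<in> M \<and> vec.dim (complex_tangent_space M p) \<ge> 1"

definition holomorphic_map_on ::
    "(complex ^ 'n) set \<Rightarrow> (complex ^ 'n \<Rightarrow> complex ^ 'm) \<Rightarrow> bool" where
  "holomorphic_map_on W F \<longleftrightarrow>
     (\<forall>x\<in>W. \<exists>F'. (F has_derivative F') (at x) \<and> (\<forall>c v. F' (c *s v) = c *s F' v))"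

definition biholomorphic_map ::
    "(complex ^ 'n) set \<Rightarrow> (complex ^ 'n) set \<Rightarrow> (complex ^ 'n \<Rightarrow> complex ^ 'n) \<Rightarrow> bool" where
  "biholomorphic_map W W' F \<longleftrightarrow>
     bij_betw F W W' \<and> holomorphic_map_on W F \<and> holomorphic_map_on W' (inv_into W F)"

text \<open>
  The normal form of Beloshapka and Coffman in \<open>\<complex>\<^bsup>3k-1\<^esup>\<close>. The map \<open>c\<close> enumerates the coordinates
  in the order \<open>z, w\<^sub>1, \<dots>, w\<^bsub>2k-2\<^esub>, \<zeta>\<^sub>1, \<dots>, \<zeta>\<^sub>k\<close>, starting from index \<open>0\<close>.
\<close>

definition BC_model :: "nat \<Rightarrow> (nat \<Rightarrow> 'n) \<Rightarrow> (complex ^ 'n::finite) set" where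
  "BC_model k c =
     {Z. let z = Z $ c 0;
             w = (\<lambda>\<tau>. Z $ c \<tau>);
             \<zeta> = (\<lambda>\<sigma>. Z $ c (2 * k - 2 + \<sigma>));
             u = (\<lambda>\<tau>. complex_of_real (Re (w \<tau>)))
         in (\<forall>\<tau>\<in>{1..2 * k - 2}. Im (w \<tau>) = 0) \<and>
            \<zeta> 1 = complex_of_real ((cmod z)\<^sup>2) + cnj z * (u 1 + \<i> * u 2) \<and>
            (\<forall>\<sigma>\<in>{2..k - 1}. \<zeta> \<sigma> = cnj z * (u (2 * \<sigma> - 1) + \<i> * u (2 * \<sigma>))) \<and>
            \<zeta> k = (cnj z)\<^sup>2}"

definition generic_CR_singularity ::
    "nat \<Rightarrow> (nat \<Rightarrow> 'n) \<Rightarrow> (complex ^ 'n::finite) set \<Rightarrow> complex ^ 'n \<Rightarrow> bool" where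
  "generic_CR_singularity k c M p \<longleftrightarrow> CR_singularity M p \<and>
     (\<exists>W W' \<Phi>. open W \<and> p \<in> W \<and> open W' \<and> 0 \<in> W' \<and> biholomorphic_map W W' \<Phi> \<and>
        \<Phi> p = 0 \<and> \<Phi> ` (M \<inter> W) = BC_model k c \<inter> W')"


section \<open>Polynomial and rational convexity\<close>

definition holomorphic_polynomial :: "(complex ^ 'n::finite \<Rightarrow> complex) \<Rightarrow> bool" where
  "holomorphic_polynomial P \<longleftrightarrow>
     (\<exists>(A :: ('n \<Rightarrow> nat) set) a. finite A \<and> P = (\<lambda>z. \<Sum>\<alpha>\<in>A. a \<alpha> * (\<Prod>i\<in>UNIV. (z $ i) ^ \<alpha> i)))"

definition polynomial_hull :: "(complex ^ 'n::finite) set \<Rightarrow> (complex ^ 'n) set" where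
  "polynomial_hull X =
     {x. \<forall>P. holomorphic_polynomial P \<longrightarrow> cmod (P x) \<le> (SUP y\<in>X. cmod (P y))}"

definition polynomially_convex :: "(complex ^ 'n::finite) set \<Rightarrow> bool" where
  "polynomially_convex X \<longleftrightarrow> X = polynomial_hull X"

text \<open>
  A rational function \<open>P / Q\<close> is tested at \<open>x\<close> only where it is defined. Letting a pole at \<open>x\<close>
  count as \<open>\<bar>P x / Q x\<bar> = \<infinity>\<close> gives the same hull for compact \<open>X\<close>: replace \<open>P / Q\<close> by
  \<open>1 / (Q - \<epsilon>)\<close> for small \<open>\<epsilon>\<close>.
\<close>

definition rational_hull :: "(complex ^ 'n::finite) set \<Rightarrow> (complex ^ 'n) set" where
  "rational_hull X =
     {x. \<forall>P Q. holomorphic_polynomial P \<and> holomorphic_polynomial Q \<and>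
           (\<forall>y\<in>X. Q y \<noteq> 0) \<and> Q x \<noteq> 0 \<longrightarrow>
           cmod (P x / Q x) \<le> (SUP y\<in>X. cmod (P y / Q y))}"

definition rationally_convex :: "(complex ^ 'n::finite) set \<Rightarrow> bool" where
  "rationally_convex X \<longleftrightarrow> X = rational_hull X"


section \<open>Differential forms and plurisubharmonic functions\<close>

text \<open>The forms \<open>\<partial>f\<close> and \<open>\<partial>\<close>-bar \<open>f\<close> at \<open>x\<close>, as functions of a real tangent vector \<open>v\<close>.\<close>

definition del :: "(complex ^ 'n \<Rightarrow> complex) \<Rightarrow> complex ^ 'n \<Rightarrow> complex ^ 'n \<Rightarrow> complex" where
  "del f x v =
     (frechet_derivative f (at x) v - \<i> * frechet_derivative f (at x) (\<i> *s v)) / 2"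

definition delbar :: "(complex ^ 'n \<Rightarrow> complex) \<Rightarrow> complex ^ 'n \<Rightarrow> complex ^ 'n \<Rightarrow> complex" where
  "delbar f x v =
     (frechet_derivative f (at x) v + \<i> * frechet_derivative f (at x) (\<i> *s v)) / 2"

definition dc :: "(complex ^ 'n \<Rightarrow> real) \<Rightarrow> complex ^ 'n \<Rightarrow> complex ^ 'n \<Rightarrow> complex" where
  "dc \<phi> x v = \<i> * (delbar (\<lambda>y. complex_of_real (\<phi> y)) x v - del (\<lambda>y. complex_of_real (\<phi> y)) x v)"

text \<open>Exterior derivative of a 1-form \<open>\<alpha>\<close>, where \<open>\<alpha> x\<close> is the covector at \<open>x\<close>.\<close>

definition ext_deriv ::
    "('a::real_normed_vector \<Rightarrow> 'a \<Rightarrow> 'b::real_normed_vector) \<Rightarrow> 'a \<Rightarrow> 'a \<Rightarrow> 'a \<Rightarrow> 'b" where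
  "ext_deriv \<alpha> x v w =
     frechet_derivative (\<lambda>y. \<alpha> y w) (at x) v - frechet_derivative (\<lambda>y. \<alpha> y v) (at x) w"

definition ddc ::
    "(complex ^ 'n \<Rightarrow> real) \<Rightarrow> complex ^ 'n \<Rightarrow> complex ^ 'n \<Rightarrow> complex ^ 'n \<Rightarrow> complex" where
  "ddc \<phi> = ext_deriv (dc \<phi>)"

definition isotropic ::
    "('a::real_normed_vector \<Rightarrow> 'a \<Rightarrow> 'a \<Rightarrow> 'b::zero) \<Rightarrow> 'a set \<Rightarrow> bool" where
  "isotropic \<omega> M \<longleftrightarrow> (\<forall>x\<in>M. \<forall>v\<in>tangent_space M x. \<forall>w\<in>tangent_space M x. \<omega> x v w = 0)"

text \<open>
  \<open>\<Sum> \<partial>\<^sup>2\<phi>/\<partial>z\<^sub>i\<partial>z\<^sub>j\<close>-bar \<open>v\<^sub>i v\<^sub>j\<close>-bar; for \<open>\<phi>\<close> of class \<open>C\<^sup>2\<close> the sum is already real.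
\<close>

definition levi_form :: "(complex ^ 'n::finite \<Rightarrow> real) \<Rightarrow> complex ^ 'n \<Rightarrow> complex ^ 'n \<Rightarrow> real" where
  "levi_form \<phi> x v =
     Re (\<Sum>i\<in>UNIV. \<Sum>j\<in>UNIV.
           del (\<lambda>y. delbar (\<lambda>t. complex_of_real (\<phi> t)) y (axis j 1)) x (axis i 1)
             * v $ i * cnj (v $ j))"

text \<open>
  Sub-mean value property on every closed complex affine disc in \<open>U\<close>. Only continuous functions
  with finite values occur here.
\<close>

definition plurisubharmonic_on :: "(complex ^ 'n::finite) set \<Rightarrow> (complex ^ 'n \<Rightarrow> real) \<Rightarrow> bool" where
  "plurisubharmonic_on U \<phi> \<longleftrightarrow> continuous_on U \<phi> \<and>
     (\<forall>a v. (\<forall>\<xi>\<in>cball 0 1. a + \<xi> *s v \<in> U) \<longrightarrow>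
        \<phi> a \<le> (1 / (2 * pi)) * integral {0..2 * pi} (\<lambda>t. \<phi> (a + cis t *s v)))"

text \<open>Only meant for smooth (or \<open>C\<^sup>2\<close>) functions on open sets.\<close>

definition strictly_plurisubharmonic_on ::
    "(complex ^ 'n::finite) set \<Rightarrow> (complex ^ 'n \<Rightarrow> real) \<Rightarrow> bool" where
  "strictly_plurisubharmonic_on U \<phi> \<longleftrightarrow> (\<forall>x\<in>U. \<forall>v. v \<noteq> 0 \<longrightarrow> levi_form \<phi> x v > 0)"

end

theory Submission
  imports Defs "HOL-Complex_Analysis.Cauchy_Integral_Formula"
begin

text \<open>
  If \<open>\<rho> \<ge> 0\<close> vanishes on \<open>M\<close>, then on \<open>M\<close> the Levi form of \<open>\<rho>\<close> is a sum of squares. At a totally real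
  point the squared distance in a slice chart therefore has a positive definite Levi form. At a
  CR-singularity an explicit potential of degree at most eight in the Beloshapka-Coffman coordinates, built
  from weighted squares of the defining functions, is strictly plurisubharmonic on a punctured
  neighbourhood. Both kinds are glued by bump functions: at points of \<open>M\<close> the cutoffs multiply the Levi
  forms and create no cross terms. This gives \<open>\<rho>\<close> in (1).

  If \<open>M\<close> is polynomially convex, a finite sum of functions \<open>h (\<bar>P\<bar>\<^sup>2 + \<epsilon> \<bar>z\<bar>\<^sup>2 - c)\<close>, with \<open>h\<close> a smooth convex
  ramp, is a plurisubharmonic \<open>\<psi> \<ge> 0\<close> that vanishes on \<open>M\<close> and is positive and strictly plurisubharmonic away
  from \<open>M\<close>. If \<open>M\<close> is rationally convex, each point outside \<open>M\<close> lies on a hypersurface \<open>P = 0\<close> that misses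
  \<open>M\<close>; smoothing \<open>ln \<bar>P\<bar>\<close> near \<open>P = 0\<close>, also for small linear perturbations of \<open>P\<close>, gives a plurisubharmonic \<open>\<psi>\<close>
  with \<open>dd\<^sup>c \<psi> = 0\<close> on \<open>M\<close>. In both cases the answer is \<open>\<theta> \<rho> + C \<psi>\<close> with a cutoff \<open>\<theta>\<close> and large \<open>C\<close>. It is
  isotropic on \<open>M\<close> in case (2) because \<open>d\<rho>\<close> vanishes on \<open>M\<close>.
\<close>

section \<open>Calculus of smooth maps\<close>

text \<open>The obstacle is the punctured neighbourhood of a CR-singularity. At a point of
  \<open>M - S\<close> positivity of the Levi form spreads to a neighbourhood by openness, but these
  neighbourhoods may pinch at \<open>S\<close>, so near \<open>S\<close> positivity has to be proved
  by hand also off \<open>M\<close>. There \<open>lap\<close> of a square \<open>h^2\<close> is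
  \<open>2 |dh|^2 + 2 h lap h\<close>, and the last term has no sign; moreover at the origin of the
  model all the gradients \<open>dh\<close> vanish in the direction of the coordinate
  \<open>z\<close>. Every estimate is therefore a balance in powers of \<open>|dz|\<close>: the
  weights pay for \<open>h lap h\<close>, and a deficit \<open>3 |z|^2 |dz|^2\<close> from the
  equation of \<open>\<zeta>\<^sub>1\<close> is covered by the gain \<open>4 |z|^2 |dz|^2\<close>
  from the equation of \<open>\<zeta>\<^sub>k\<close>. The finiteness of \<open>S\<close> is used
  twice more: bumps centred elsewhere avoid the points of \<open>S\<close>, and nonnegativity of the
  Levi form at these points follows by continuity.\<close>

abbreviation dder :: "('a::real_normed_vector \<Rightarrow> 'b::real_normed_vector) \<Rightarrow> 'a \<Rightarrow> 'a \<Rightarrow> 'b" where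
  "dder f x v \<equiv> frechet_derivative f (at x) v"

lemma dder_eq: "(f has_derivative f') (at x) \<Longrightarrow> dder f x v = f' v"
  by (metis frechet_derivative_at)

lemma dder_works: "f differentiable at x \<Longrightarrow> (f has_derivative dder f x) (at x)"
  by (simp add: frechet_derivative_works)

lemma dder_cong_open:
  assumes "open U" "x \<in> U" "\<And>y. y \<in> U \<Longrightarrow> f y = g y"
  shows "frechet_derivative f (at x) = frechet_derivative g (at x)"
proof -
  have "(f has_derivative F) (at x) = (g has_derivative F) (at x)" for F
    using assms by (metis has_derivative_transform_within_open)
  then show ?thesis by (simp add: frechet_derivative_def)
qed

lemma differentiable_cong_open:
  assumes "open U" "x \<in> U" "\<And>y. y \<in> U \<Longrightarrow> f y = g y" "f differentiable at x"
  shows "g differentiable at x"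
  using assms by (metis differentiable_def has_derivative_transform_within_open)

lemma Ck_on_cong:
  assumes "open U" "\<And>x. x \<in> U \<Longrightarrow> f x = g x" "Ck_on m U f"
  shows "Ck_on m U g"
  using assms(2,3)
proof (induction m arbitrary: f g)
  case 0
  then show ?case by (simp cong: continuous_on_cong)
next
  case (Suc m)
  have "g differentiable at x" if "x \<in> U" for x
    using differentiable_cong_open[OF assms(1) that] Suc.prems that by auto
  moreover have "Ck_on m U (\<lambda>x. dder g x v)" for v
    using Suc.IH[of "\<lambda>x. dder f x v" "\<lambda>x. dder g x v"] Suc.prems dder_cong_open[OF assms(1), of _ f g]
    by simp
  ultimately show ?case by simp
qed

lemma Ck_on_subset: "Ck_on m U f \<Longrightarrow> V \<subseteq> U \<Longrightarrow> Ck_on m V f"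
  by (induction m arbitrary: f) (auto intro: continuous_on_subset)

lemma Ck_on_SucD: "Ck_on (Suc m) U f \<Longrightarrow> Ck_on m U f"
proof (induction m arbitrary: f)
  case 0
  then show ?case
    by (auto intro!: continuous_at_imp_continuous_on differentiable_imp_continuous_within)
next
  case (Suc m)
  then show ?case by (simp del: Ck_on.simps(2) add: Ck_on.simps(2)[of "Suc m"] Ck_on.simps(2)[of m])
qed

lemma Ck_on_local:
  assumes "\<And>x. x \<in> U \<Longrightarrow> \<exists>V. open V \<and> x \<in> V \<and> Ck_on m V f"
  shows "Ck_on m U f"
  using assms
proof (induction m arbitrary: f)
  case 0
  then show ?case
    by (metis Ck_on.simps(1) continuous_at_imp_continuous_on continuous_on_eq_continuous_at)
next
  case (Suc m)
  then show ?case by (fastforce)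
qed

text \<open>\<open>Ck_on\<close> speaks of \<open>frechet_derivative\<close>; this rule lets an
  induction on the order work with an explicit formula for the derivative instead.\<close>

lemma Ck_on_SucI:
  assumes "open U" "\<And>x. x \<in> U \<Longrightarrow> (f has_derivative f' x) (at x)"
    and "\<And>v. Ck_on m U (\<lambda>x. f' x v)"
  shows "Ck_on (Suc m) U f"
proof -
  have "Ck_on m U (\<lambda>x. dder f x v)" for v
    by (rule Ck_on_cong[OF assms(1) _ assms(3)[of v]]) (simp add: dder_eq[OF assms(2)])
  then show ?thesis using assms(2) by (auto simp: differentiable_def)
qed

lemma Ck_on_const: "Ck_on m U (\<lambda>x. c)"
proof -
  have "Ck_on m U (\<lambda>x. 0) \<and> Ck_on m U (\<lambda>x. c)"
    by (induction m arbitrary: c) auto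
  then show ?thesis ..
qed

lemma Ck_on_add:
  assumes "Ck_on m U f" "Ck_on m U g" "open U"
  shows "Ck_on m U (\<lambda>x. f x + g x)"
  using assms(1,2)
proof (induction m arbitrary: f g)
  case 0
  then show ?case by (simp add: continuous_on_add)
next
  case (Suc m)
  have "Ck_on m U (\<lambda>x. dder f x v + dder g x v)" for v
    using Suc by simp
  then show ?case
    using Suc.prems by (intro Ck_on_SucI[OF assms(3)]) (auto intro!: derivative_eq_intros dder_works)
qed

lemma Ck_on_bilinear:
  assumes h: "bounded_bilinear h" and "Ck_on m U f" "Ck_on m U g" "open U"
  shows "Ck_on m U (\<lambda>x. h (f x) (g x))"
  using assms(2,3)
proof (induction m arbitrary: f g)
  case 0
  then show ?case by (simp add: bounded_bilinear.continuous_on[OF h])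
next
  case (Suc m)
  have 1: "((\<lambda>x. h (f x) (g x)) has_derivative (\<lambda>v. h (f x) (dder g x v) + h (dder f x v) (g x))) (at x)"
    if "x \<in> U" for x
    using Suc.prems that by (auto intro!: bounded_bilinear.FDERIV[OF h] dder_works)
  moreover have "Ck_on m U (\<lambda>x. h (f x) (dder g x v) + h (dder f x v) (g x))" for v
    using Suc Ck_on_SucD[OF Suc.prems(1)] Ck_on_SucD[OF Suc.prems(2)] assms(4)
    by (intro Ck_on_add) (auto intro: Suc.IH)
  ultimately show ?case
    by (intro Ck_on_SucI[OF assms(4)])
qed

lemma Ck_on_sum:
  assumes "\<And>i. i \<in> I \<Longrightarrow> Ck_on m U (f i)" "open U"
  shows "Ck_on m U (\<lambda>x. \<Sum>i\<in>I. f i x)"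
  using assms
  by (induction I rule: infinite_finite_induct) (auto intro: Ck_on_const Ck_on_add)

lemma Ck_on_bounded_linear:
  assumes "bounded_linear l"
  shows "Ck_on m U l"
proof (cases m)
  case 0
  then show ?thesis by (simp add: assms linear_continuous_on)
next
  case (Suc k)
  have "dder l x v = l v" for x v
    using dder_eq[OF bounded_linear_imp_has_derivative[OF assms]] by simp
  then show ?thesis
    using Suc assms by (simp add: Ck_on_const bounded_linear_imp_differentiable)
qed

lemma dder_compose:
  assumes "g differentiable at x" "f differentiable at (g x)"
  shows "dder (\<lambda>x. f (g x)) x v = dder f (g x) (dder g x v)"
    and "(\<lambda>x. f (g x)) differentiable at x"
proof -
  have "((\<lambda>x. f (g x)) has_derivative (\<lambda>v. dder f (g x) (dder g x v))) (at x)"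
    using has_derivative_compose[OF dder_works[OF assms(1)] dder_works[OF assms(2)]] by simp
  then show "dder (\<lambda>x. f (g x)) x v = dder f (g x) (dder g x v)"
    and "(\<lambda>x. f (g x)) differentiable at x"
    by (auto simp: dder_eq differentiable_def)
qed

lemma linear_dder: "f differentiable at x \<Longrightarrow> linear (dder f x)"
  by (rule linear_frechet_derivative)

lemma dder_expand:
  fixes f :: "'a::euclidean_space \<Rightarrow> 'b::real_normed_vector"
  assumes "f differentiable at x"
  shows "dder f x v = (\<Sum>e\<in>Basis. (v \<bullet> e) *\<^sub>R dder f x e)"
proof -
  interpret linear "dder f x" by (rule linear_dder[OF assms])
  have "dder f x v = dder f x (\<Sum>e\<in>Basis. (v \<bullet> e) *\<^sub>R e)"
    by (simp add: euclidean_representation)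
  then show ?thesis by (simp add: sum scaleR)
qed

text \<open>\<open>Ck_on\<close> controls derivatives in fixed directions only, while the chain rule
  produces \<open>dder f\<close> in the moving direction \<open>dder g x v\<close>. Expanding that
  direction in \<open>Basis\<close> leaves fixed directions with coefficients that depend on
  \<open>x\<close>; hence the Euclidean domain of \<open>f\<close>.\<close>

lemma Ck_on_compose:
  fixes f :: "'b::euclidean_space \<Rightarrow> 'c::real_normed_vector"
  assumes "Ck_on m V f" "Ck_on m U g" "open U" "g ` U \<subseteq> V"
  shows "Ck_on m U (\<lambda>x. f (g x))"
  using assms(1,2)
proof (induction m arbitrary: f)
  case 0
  then show ?case using assms(4) by (auto intro: continuous_on_compose2)
next
  case (Suc m)
  have d: "g differentiable at x" "f differentiable at (g x)" if "x \<in> U" for x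
    using Suc.prems that assms(4) by auto
  have "((\<lambda>x. f (g x)) has_derivative (\<lambda>v. \<Sum>e\<in>Basis. (dder g x v \<bullet> e) *\<^sub>R dder f (g x) e)) (at x)"
    if "x \<in> U" for x
    using has_derivative_compose[OF dder_works[OF d(1)[OF that]] dder_works[OF d(2)[OF that]]]
    by (simp add: dder_expand[OF d(2)[OF that], symmetric])
  moreover have "Ck_on m U (\<lambda>x. \<Sum>e\<in>Basis. (dder g x v \<bullet> e) *\<^sub>R dder f (g x) e)" for v
    using Suc.prems Ck_on_SucD[OF Suc.prems(2)] assms(3)
    by (intro Ck_on_sum Ck_on_bilinear[OF bounded_bilinear_scaleR]
        Ck_on_bilinear[OF bounded_bilinear_inner] Ck_on_const Suc.IH) auto
  ultimately show ?case
    by (intro Ck_on_SucI[OF assms(3)])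
qed

section \<open>Smoothness at a point and its closure rules\<close>

definition smooth_at :: "('a::real_normed_vector \<Rightarrow> 'b::real_normed_vector) \<Rightarrow> 'a \<Rightarrow> bool" where
  "smooth_at f x \<longleftrightarrow> (\<exists>U. open U \<and> x \<in> U \<and> smooth_on U f)"

lemma smooth_on_iff_smooth_at:
  assumes "open U"
  shows "smooth_on U f \<longleftrightarrow> (\<forall>x\<in>U. smooth_at f x)"
proof
  show "smooth_on U f \<Longrightarrow> \<forall>x\<in>U. smooth_at f x"
    using assms by (auto simp: smooth_at_def)
  assume "\<forall>x\<in>U. smooth_at f x"
  then show "smooth_on U f"
    unfolding smooth_at_def smooth_on_def by (meson Ck_on_local)
qed

lemma smooth_at_differentiable: "smooth_at f x \<Longrightarrow> f differentiable at x"
  unfolding smooth_at_def smooth_on_def by (metis Ck_on.simps(2))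

lemma smooth_at_dder: "smooth_at f x \<Longrightarrow> smooth_at (\<lambda>y. dder f y v) x"
  unfolding smooth_at_def smooth_on_def by (metis Ck_on.simps(2))

lemma smooth_at_continuous: "smooth_at f x \<Longrightarrow> isCont f x"
  by (simp add: smooth_at_differentiable differentiable_imp_continuous_within)

lemma smooth_at_nbhd: "smooth_at f x \<Longrightarrow> \<exists>U. open U \<and> x \<in> U \<and> (\<forall>y\<in>U. smooth_at f y)"
  unfolding smooth_at_def by blast

lemma eventually_smooth_at: "smooth_at f x \<Longrightarrow> eventually (smooth_at f) (nhds x)"
  using smooth_at_nbhd[of f x] by (auto simp: eventually_nhds)

lemma smooth_at_cong:
  assumes "smooth_at f x" "eventually (\<lambda>y. f y = g y) (nhds x)"
  shows "smooth_at g x"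
proof -
  obtain U V where U: "open U" "x \<in> U" "smooth_on U f" and V: "open V" "x \<in> V" "\<And>y. y \<in> V \<Longrightarrow> f y = g y"
    using assms by (auto simp: smooth_at_def eventually_nhds)
  have "Ck_on m (U \<inter> V) g" for m
    using U V by (intro Ck_on_cong[of "U \<inter> V" f g]) (auto simp: smooth_on_def intro: Ck_on_subset)
  then show ?thesis
    using U V unfolding smooth_at_def smooth_on_def by (intro exI[of _ "U \<inter> V"]) auto
qed

lemma smooth_at_const [intro, simp]: "smooth_at (\<lambda>x. c) a"
  unfolding smooth_at_def smooth_on_def by (intro exI[of _ UNIV]) (auto intro: Ck_on_const)

lemma smooth_at_linear: "bounded_linear l \<Longrightarrow> smooth_at l a"
  unfolding smooth_at_def smooth_on_def by (intro exI[of _ UNIV]) (auto intro: Ck_on_bounded_linear)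

lemma smooth_at_binop:
  assumes "smooth_at f a" "smooth_at g a"
    and "\<And>U m. open U \<Longrightarrow> Ck_on m U f \<Longrightarrow> Ck_on m U g \<Longrightarrow> Ck_on m U h"
  shows "smooth_at h a"
proof -
  obtain U V where "open U" "a \<in> U" "smooth_on U f" "open V" "a \<in> V" "smooth_on V g"
    using assms by (auto simp: smooth_at_def)
  then have "open (U \<inter> V)" "a \<in> U \<inter> V" "smooth_on (U \<inter> V) h"
    using assms(3)[of "U \<inter> V"] unfolding smooth_on_def
    by (blast, blast, meson Ck_on_subset inf_le1 inf_le2 open_Int)
  then show ?thesis unfolding smooth_at_def by blast
qed

lemma smooth_at_add [intro]: "smooth_at f a \<Longrightarrow> smooth_at g a \<Longrightarrow> smooth_at (\<lambda>x. f x + g x) a"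
  by (erule (1) smooth_at_binop) (rule Ck_on_add)

lemma smooth_at_bilinear:
  "bounded_bilinear h \<Longrightarrow> smooth_at f a \<Longrightarrow> smooth_at g a \<Longrightarrow> smooth_at (\<lambda>x. h (f x) (g x)) a"
  by (erule (1) smooth_at_binop) (rule Ck_on_bilinear)

lemmas smooth_at_mult [intro] = smooth_at_bilinear[OF bounded_bilinear_mult]
lemmas smooth_at_scaleR [intro] = smooth_at_bilinear[OF bounded_bilinear_scaleR]

lemma smooth_at_sum [intro]:
  "(\<And>i. i \<in> I \<Longrightarrow> smooth_at (f i) a) \<Longrightarrow> smooth_at (\<lambda>x. \<Sum>i\<in>I. f i x) a"
  by (induction I rule: infinite_finite_induct) auto

lemma smooth_at_power [intro]:
  fixes f :: "'a::real_normed_vector \<Rightarrow> 'b::real_normed_algebra_1"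
  shows "smooth_at f a \<Longrightarrow> smooth_at (\<lambda>x. f x ^ n) a"
  by (induction n) auto

lemma smooth_at_prod [intro]:
  fixes f :: "'i \<Rightarrow> 'a::real_normed_vector \<Rightarrow> 'b::{real_normed_algebra_1,comm_monoid_mult}"
  shows "(\<And>i. i \<in> I \<Longrightarrow> smooth_at (f i) a) \<Longrightarrow> smooth_at (\<lambda>x. \<Prod>i\<in>I. f i x) a"
  by (induction I rule: infinite_finite_induct) auto

lemma smooth_at_compose:
  fixes f :: "'b::euclidean_space \<Rightarrow> 'c::real_normed_vector"
  assumes "smooth_at g a" "smooth_at f (g a)"
  shows "smooth_at (\<lambda>x. f (g x)) a"
proof -
  obtain U V where U: "open U" "a \<in> U" "smooth_on U g" and V: "open V" "g a \<in> V" "smooth_on V f"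
    using assms by (auto simp: smooth_at_def)
  have "continuous_on U g" using U(3) by (metis Ck_on.simps(1) smooth_on_def)
  then have o: "open (U \<inter> g -` V)"
    using U V by (metis continuous_on_open_vimage inf_commute)
  have "Ck_on m (U \<inter> g -` V) (\<lambda>x. f (g x))" for m
  proof (rule Ck_on_compose[of m V f "U \<inter> g -` V" g])
    show "Ck_on m V f" using V(3) by (simp add: smooth_on_def)
    show "Ck_on m (U \<inter> g -` V) g" using U(3) Ck_on_subset[of m U g] by (simp add: smooth_on_def)
  qed (use o in auto)
  then show ?thesis
    using U V o unfolding smooth_at_def smooth_on_def by blast
qed

lemma smooth_at_linear_compose:
  "bounded_linear l \<Longrightarrow> smooth_at g a \<Longrightarrow> smooth_at (\<lambda>x. l (g x)) a"
  for l :: "'b::euclidean_space \<Rightarrow> 'c::real_normed_vector"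
  by (rule smooth_at_compose) (auto intro: smooth_at_linear)

lemma smooth_at_uminus [intro]: "smooth_at f a \<Longrightarrow> smooth_at (\<lambda>x. - f x) a"
  using smooth_at_bilinear[OF bounded_bilinear_scaleR smooth_at_const[of "-1::real"], of f a] by simp

lemma smooth_at_diff [intro]: "smooth_at f a \<Longrightarrow> smooth_at g a \<Longrightarrow> smooth_at (\<lambda>x. f x - g x) a"
  using smooth_at_add[OF _ smooth_at_uminus, of f a g] by simp

section \<open>Second derivatives\<close>

definition dder2 :: "('a::real_normed_vector \<Rightarrow> 'b::real_normed_vector) \<Rightarrow> 'a \<Rightarrow> 'a \<Rightarrow> 'a \<Rightarrow> 'b" where
  "dder2 f x v w = dder (\<lambda>y. dder f y w) x v"

lemma smooth_at_dder2: "smooth_at f x \<Longrightarrow> smooth_at (\<lambda>y. dder2 f y v w) x"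
  unfolding dder2_def by (intro smooth_at_dder)

lemma linear_dder_at: "smooth_at f x \<Longrightarrow> linear (dder f x)"
  by (intro linear_dder smooth_at_differentiable)

lemma linear_dder2_1: "smooth_at f x \<Longrightarrow> linear (\<lambda>v. dder2 f x v w)"
  unfolding dder2_def by (intro linear_dder smooth_at_differentiable smooth_at_dder)

lemma dder_cong_ev:
  "eventually (\<lambda>y. f y = g y) (nhds x) \<Longrightarrow> dder f x v = dder g x v"
  unfolding eventually_nhds using dder_cong_open by metis

lemma dder2_cong_ev:
  assumes "eventually (\<lambda>y. f y = g y) (nhds x)"
  shows "dder2 f x v w = dder2 g x v w"
  unfolding dder2_def
proof (rule dder_cong_ev)
  have "eventually (\<lambda>z. eventually (\<lambda>y. f y = g y) (nhds z)) (nhds x)"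
    using assms by (simp add: eventually_eventually)
  then show "\<forall>\<^sub>F y in nhds x. dder f y w = dder g y w"
    by eventually_elim (rule dder_cong_ev)
qed

lemma smooth_at_has_derivative: "smooth_at f x \<Longrightarrow> (f has_derivative dder f x) (at x)"
  by (intro dder_works smooth_at_differentiable)

lemma dder_add: "smooth_at f x \<Longrightarrow> smooth_at g x \<Longrightarrow> dder (\<lambda>x. f x + g x) x v = dder f x v + dder g x v"
  by (rule dder_eq) (auto intro!: derivative_eq_intros smooth_at_has_derivative)

lemma dder_bilinear:
  "bounded_bilinear h \<Longrightarrow> smooth_at f x \<Longrightarrow> smooth_at g x \<Longrightarrow>
    dder (\<lambda>x. h (f x) (g x)) x v = h (f x) (dder g x v) + h (dder f x v) (g x)"
  by (rule dder_eq) (auto intro!: bounded_bilinear.FDERIV smooth_at_has_derivative)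

lemma dder_sum: "(\<And>i. i \<in> I \<Longrightarrow> smooth_at (f i) x) \<Longrightarrow> dder (\<lambda>x. \<Sum>i\<in>I. f i x) x v = (\<Sum>i\<in>I. dder (f i) x v)"
  by (rule dder_eq) (auto intro!: derivative_eq_intros smooth_at_has_derivative)

lemma dder_linear: "bounded_linear l \<Longrightarrow> dder l x v = l v"
  by (rule dder_eq) (rule bounded_linear_imp_has_derivative)

lemma dder2_linear: "bounded_linear l \<Longrightarrow> dder2 l x v w = 0"
  by (simp add: dder2_def dder_linear)

lemma dder2_const [simp]: "dder2 (\<lambda>x. c) x v w = 0"
  by (simp add: dder2_def)

lemma dder_smooth_compose:
  "smooth_at g x \<Longrightarrow> smooth_at f (g x) \<Longrightarrow> dder (\<lambda>x. f (g x)) x v = dder f (g x) (dder g x v)"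
  by (simp add: dder_compose(1) smooth_at_differentiable)

lemma linear_dder2_2:
  assumes "smooth_at f x"
  shows "linear (dder2 f x v)"
proof (rule linearI)
  note ev = eventually_smooth_at[OF assms]
  have "dder2 f x v (a + b) = dder (\<lambda>y. dder f y a + dder f y b) x v" for a b
    unfolding dder2_def
    by (rule dder_cong_ev, rule eventually_mono[OF ev]) (auto dest!: linear_dder_at simp: linear_add)
  then show "dder2 f x v (a + b) = dder2 f x v a + dder2 f x v b" for a b
    by (simp add: dder_add smooth_at_dder assms dder2_def)
  have "dder2 f x v (r *\<^sub>R b) = dder (\<lambda>y. r *\<^sub>R dder f y b) x v" for r b
    unfolding dder2_def
    by (rule dder_cong_ev, rule eventually_mono[OF ev]) (auto dest!: linear_dder_at simp: linear_cmul)
  then show "dder2 f x v (r *\<^sub>R b) = r *\<^sub>R dder2 f x v b" for r b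
    by (simp add: dder_bilinear[OF bounded_bilinear_scaleR] smooth_at_dder assms dder2_def)
qed

lemma dder2_add:
  assumes "smooth_at f x" "smooth_at g x"
  shows "dder2 (\<lambda>x. f x + g x) x v w = dder2 f x v w + dder2 g x v w"
proof -
  have "eventually (\<lambda>y. dder (\<lambda>x. f x + g x) y w = dder f y w + dder g y w) (nhds x)"
    using eventually_smooth_at[OF assms(1)] eventually_smooth_at[OF assms(2)]
    by eventually_elim (rule dder_add)
  from dder_cong_ev[OF this] show ?thesis
    by (simp add: dder2_def dder_add smooth_at_dder assms)
qed

lemma dder2_bilinear:
  assumes h: "bounded_bilinear h" and "smooth_at f x" "smooth_at g x"
  shows "dder2 (\<lambda>x. h (f x) (g x)) x v w =
    h (f x) (dder2 g x v w) + h (dder f x v) (dder g x w) + h (dder f x w) (dder g x v) + h (dder2 f x v w) (g x)"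
proof -
  have "eventually (\<lambda>y. dder (\<lambda>x. h (f x) (g x)) y w = h (f y) (dder g y w) + h (dder f y w) (g y)) (nhds x)"
    using eventually_smooth_at[OF assms(2)] eventually_smooth_at[OF assms(3)]
    by eventually_elim (rule dder_bilinear[OF h])
  from dder_cong_ev[OF this] show ?thesis
    by (simp add: dder2_def dder_add dder_bilinear[OF h] smooth_at_bilinear[OF h] smooth_at_dder assms)
qed

lemma dder2_sum:
  assumes "\<And>i. i \<in> I \<Longrightarrow> smooth_at (f i) x"
  shows "dder2 (\<lambda>x. \<Sum>i\<in>I. f i x) x v w = (\<Sum>i\<in>I. dder2 (f i) x v w)"
  using assms by (induction I rule: infinite_finite_induct) (auto simp: dder2_add smooth_at_sum)

lemma dder2_expand:
  fixes f :: "'a::euclidean_space \<Rightarrow> 'b::real_normed_vector"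
  assumes "smooth_at f x"
  shows "dder2 f x v w = (\<Sum>d\<in>Basis. \<Sum>e\<in>Basis. ((v \<bullet> d) * (w \<bullet> e)) *\<^sub>R dder2 f x d e)"
proof -
  have "dder2 f x v w = (\<Sum>d\<in>Basis. (v \<bullet> d) *\<^sub>R dder2 f x d w)"
    unfolding dder2_def by (rule dder_expand) (intro smooth_at_differentiable smooth_at_dder assms)
  moreover have "dder2 f x d w = (\<Sum>e\<in>Basis. (w \<bullet> e) *\<^sub>R dder2 f x d e)" for d
  proof -
    interpret linear "dder2 f x d" by (rule linear_dder2_2[OF assms])
    have "dder2 f x d w = dder2 f x d (\<Sum>e\<in>Basis. (w \<bullet> e) *\<^sub>R e)"
      by (simp add: euclidean_representation)
    then show ?thesis by (simp add: sum scaleR)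
  qed
  ultimately show ?thesis by (simp add: scaleR_sum_right)
qed

lemma dder2_compose:
  fixes f :: "'b::euclidean_space \<Rightarrow> 'c::real_normed_vector"
  assumes "smooth_at g x" "smooth_at f (g x)"
  shows "dder2 (\<lambda>x. f (g x)) x v w = dder2 f (g x) (dder g x v) (dder g x w) + dder f (g x) (dder2 g x v w)"
proof -
  have "filterlim g (nhds (g x)) (nhds x)"
    using smooth_at_continuous[OF assms(1)] by (simp add: continuous_at tendsto_at_iff_tendsto_nhds)
  then have "eventually (\<lambda>y. smooth_at f (g y)) (nhds x)"
    using eventually_smooth_at[OF assms(2)] by (rule eventually_compose_filterlim[rotated])
  \<comment> \<open>The first derivative of the composition is taken in the moving direction
    \<open>dder g y w\<close>, which is expanded in \<open>Basis\<close> before it is differentiated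
    again.\<close>
  with eventually_smooth_at[OF assms(1)]
  have "eventually (\<lambda>y. dder (\<lambda>x. f (g x)) y w = (\<Sum>e\<in>Basis. (dder g y w \<bullet> e) *\<^sub>R dder f (g y) e)) (nhds x)"
    by eventually_elim (metis dder_smooth_compose dder_expand smooth_at_differentiable)
  note eq = dder_cong_ev[OF this]
  have A: "smooth_at (\<lambda>y. dder g y w \<bullet> e) x" "dder (\<lambda>y. dder g y w \<bullet> e) x v = dder2 g x v w \<bullet> e" for e
    using dder_bilinear[OF bounded_bilinear_inner smooth_at_dder[OF assms(1)] smooth_at_const]
    by (auto simp: dder2_def intro!: smooth_at_bilinear[OF bounded_bilinear_inner] smooth_at_dder assms)
  have B: "smooth_at (\<lambda>y. dder f (g y) e) x"
    "dder (\<lambda>y. dder f (g y) e) x v = dder2 f (g x) (dder g x v) e" for e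
    using smooth_at_compose[OF assms(1) smooth_at_dder[OF assms(2)]]
      dder_smooth_compose[OF assms(1) smooth_at_dder[OF assms(2)]]
    by (auto simp: dder2_def)
  have "dder2 (\<lambda>x. f (g x)) x v w = dder (\<lambda>y. \<Sum>e\<in>Basis. (dder g y w \<bullet> e) *\<^sub>R dder f (g y) e) x v"
    using eq by (simp add: dder2_def)
  also have "\<dots> = (\<Sum>e\<in>Basis. (dder g x w \<bullet> e) *\<^sub>R dder2 f (g x) (dder g x v) e
      + (dder2 g x v w \<bullet> e) *\<^sub>R dder f (g x) e)"
    by (simp add: dder2_def dder_sum smooth_at_scaleR A B
        dder_bilinear[OF bounded_bilinear_scaleR A(1) B(1)])
  also have "\<dots> = dder2 f (g x) (dder g x v) (dder g x w) + dder f (g x) (dder2 g x v w)"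
  proof -
    interpret linear "dder2 f (g x) (dder g x v)" by (rule linear_dder2_2[OF assms(2)])
    have "dder2 f (g x) (dder g x v) (dder g x w) = dder2 f (g x) (dder g x v) (\<Sum>e\<in>Basis. (dder g x w \<bullet> e) *\<^sub>R e)"
      by (simp add: euclidean_representation)
    then have "dder2 f (g x) (dder g x v) (dder g x w) = (\<Sum>e\<in>Basis. (dder g x w \<bullet> e) *\<^sub>R dder2 f (g x) (dder g x v) e)"
      by (simp add: sum scaleR)
    then show ?thesis
      by (simp add: sum.distrib dder_expand[OF smooth_at_differentiable[OF assms(2)], symmetric])
  qed
  finally show ?thesis .
qed

section \<open>Symmetry of second derivatives\<close>

lemma dder2_double_difference:
  fixes f :: "'a::real_normed_vector \<Rightarrow> real"
  assumes "open U" "\<And>y. y \<in> U \<Longrightarrow> smooth_at f y" "s > 0"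
    and U: "\<And>a b. 0 \<le> a \<Longrightarrow> a \<le> s \<Longrightarrow> 0 \<le> b \<Longrightarrow> b \<le> s \<Longrightarrow> x + a *\<^sub>R v + b *\<^sub>R w \<in> U"
  shows "\<exists>a b. 0 \<le> a \<and> a \<le> s \<and> 0 \<le> b \<and> b \<le> s \<and>
    f (x + s *\<^sub>R v + s *\<^sub>R w) - f (x + s *\<^sub>R v) - f (x + s *\<^sub>R w) + f x
      = s * s * dder2 f (x + a *\<^sub>R v + b *\<^sub>R w) w v"
proof -
  have line: "((\<lambda>t. h (y + t *\<^sub>R u)) has_field_derivative dder h (y + t *\<^sub>R u) u) (at t)"
    if "smooth_at h (y + t *\<^sub>R u)" for h :: "'a \<Rightarrow> real" and y u t
  proof -
    have "((\<lambda>t. h (y + t *\<^sub>R u)) has_derivative (\<lambda>r. dder h (y + t *\<^sub>R u) (r *\<^sub>R u))) (at t)"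
      by (rule has_derivative_compose[where g = h and f = "\<lambda>t. y + t *\<^sub>R u" and x = t and s = UNIV, OF _ smooth_at_has_derivative[OF that]])
        (auto intro!: derivative_eq_intros)
    moreover have "dder h (y + t *\<^sub>R u) (r *\<^sub>R u) = r * dder h (y + t *\<^sub>R u) u" for r
      using linear_dder_at[OF that] by (simp add: linear_cmul)
    ultimately show ?thesis
      by (simp add: has_field_derivative_def mult_commute_abs)
  qed
  define q where "q t = f (x + s *\<^sub>R w + t *\<^sub>R v) - f (x + t *\<^sub>R v)" for t
  have "(q has_field_derivative dder f (x + s *\<^sub>R w + t *\<^sub>R v) v - dder f (x + t *\<^sub>R v) v) (at t)"
    if "0 \<le> t" "t \<le> s" for t
    unfolding q_def using U[of t s] U[of t 0] that \<open>s > 0\<close> assms(2)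
    by (intro DERIV_diff line) (auto simp: algebra_simps)
  from MVT2[OF \<open>s > 0\<close> this] obtain a where a: "0 < a" "a < s"
    "q s - q 0 = (s - 0) * (dder f (x + s *\<^sub>R w + a *\<^sub>R v) v - dder f (x + a *\<^sub>R v) v)"
    by blast
  have "((\<lambda>t. dder f (x + a *\<^sub>R v + t *\<^sub>R w) v) has_field_derivative
      dder2 f (x + a *\<^sub>R v + t *\<^sub>R w) w v) (at t)"
    if "0 \<le> t" "t \<le> s" for t
    unfolding dder2_def using U[of a t] a that assms(2)
    by (intro line smooth_at_dder) auto
  from MVT2[OF \<open>s > 0\<close> this] obtain b where b: "0 < b" "b < s"
    "dder f (x + a *\<^sub>R v + s *\<^sub>R w) v - dder f (x + a *\<^sub>R v) v = s * dder2 f (x + a *\<^sub>R v + b *\<^sub>R w) w v"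
    by auto
  have "x + s *\<^sub>R w + a *\<^sub>R v = x + a *\<^sub>R v + s *\<^sub>R w" by simp
  with a b have "q s - q 0 = s * (s * dder2 f (x + a *\<^sub>R v + b *\<^sub>R w) w v)" by simp
  then show ?thesis
    using a b unfolding q_def
    by (intro exI[of _ a] exI[of _ b]) (auto simp: algebra_simps)
qed

text \<open>The second difference over the parallelogram with sides \<open>s v\<close> and
  \<open>s w\<close> is symmetric in the two directions. Two mean value theorems read it as either
  mixed derivative at a nearby point, so by continuity the two cannot differ by
  \<open>2 * e\<close>.\<close>

lemma dder2_sym:
  fixes f :: "'a::real_normed_vector \<Rightarrow> real"
  assumes "smooth_at f x"
  shows "dder2 f x v w = dder2 f x w v"
proof (rule ccontr)
  define e where "e = \<bar>dder2 f x v w - dder2 f x w v\<bar> / 2"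
  assume "dder2 f x v w \<noteq> dder2 f x w v"
  then have "e > 0" by (simp add: e_def)
  obtain U where U: "open U" "x \<in> U" "\<And>y. y \<in> U \<Longrightarrow> smooth_at f y"
    using smooth_at_nbhd[OF assms] by blast
  have c: "isCont (\<lambda>y. dder2 f y a b) x" for a b
    by (intro smooth_at_continuous smooth_at_dder2 assms)
  obtain d1 where d1: "d1 > 0" "\<And>y. dist y x < d1 \<Longrightarrow> dist (dder2 f y v w) (dder2 f x v w) < e"
    using c[of v w] \<open>e > 0\<close> unfolding continuous_at_eps_delta by blast
  obtain d2 where d2: "d2 > 0" "\<And>y. dist y x < d2 \<Longrightarrow> dist (dder2 f y w v) (dder2 f x w v) < e"
    using c[of w v] \<open>e > 0\<close> unfolding continuous_at_eps_delta by blast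
  obtain d3 where d3: "d3 > 0" "ball x d3 \<subseteq> U" using U by (meson open_contains_ball)
  define d where "d = min d1 (min d2 d3)"
  have "d > 0" using d1 d2 d3 by (simp add: d_def)
  \<comment> \<open>Every point of the parallelogram is then within \<open>d / 2\<close> of
    \<open>x\<close>; the summand 1 keeps the denominator positive.\<close>
  define s where "s = d / (2 * (norm v + norm w + 1))"
  have pos: "norm v + norm w + 1 > 0" by (smt (verit) norm_ge_zero)
  have "s > 0" using \<open>d > 0\<close> pos by (simp add: s_def)
  have near: "dist (x + a *\<^sub>R v + b *\<^sub>R w) x < d" if "0 \<le> a" "a \<le> s" "0 \<le> b" "b \<le> s" for a b
  proof -
    have "dist (x + a *\<^sub>R v + b *\<^sub>R w) x \<le> norm (a *\<^sub>R v) + norm (b *\<^sub>R w)"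
      by (simp add: dist_norm add.assoc norm_triangle_ineq del: norm_scaleR)
    also have "\<dots> \<le> s * norm v + s * norm w"
      using that by (auto intro!: add_mono mult_right_mono)
    also have "\<dots> \<le> s * (norm v + norm w + 1)" using \<open>s > 0\<close> by (simp add: algebra_simps)
    also have "\<dots> = d / 2" using pos by (simp add: s_def field_simps)
    finally show ?thesis using \<open>d > 0\<close> by simp
  qed
  have inU: "y \<in> U" if "dist y x < d" for y
    using that d3(2) by (auto simp: d_def dist_commute)
  obtain a b where ab: "0 \<le> a" "a \<le> s" "0 \<le> b" "b \<le> s"
    "f (x + s *\<^sub>R v + s *\<^sub>R w) - f (x + s *\<^sub>R v) - f (x + s *\<^sub>R w) + f x
      = s * s * dder2 f (x + a *\<^sub>R v + b *\<^sub>R w) w v"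
    using dder2_double_difference[OF U(1,3) \<open>s > 0\<close>, of x v w] near inU by blast
  have near': "dist (x + a *\<^sub>R w + b *\<^sub>R v) x < d" if "0 \<le> a" "a \<le> s" "0 \<le> b" "b \<le> s" for a b
    using near[of b a] that by (simp add: add_ac)
  obtain a' b' where ab': "0 \<le> a'" "a' \<le> s" "0 \<le> b'" "b' \<le> s"
    "f (x + s *\<^sub>R w + s *\<^sub>R v) - f (x + s *\<^sub>R w) - f (x + s *\<^sub>R v) + f x
      = s * s * dder2 f (x + a' *\<^sub>R w + b' *\<^sub>R v) v w"
    using dder2_double_difference[OF U(1,3) \<open>s > 0\<close>, of x w v] near' inU by blast
  have "s * s * dder2 f (x + a *\<^sub>R v + b *\<^sub>R w) w v = s * s * dder2 f (x + a' *\<^sub>R w + b' *\<^sub>R v) v w"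
    using ab(5) ab'(5) by (simp add: algebra_simps)
  then have "dder2 f (x + a *\<^sub>R v + b *\<^sub>R w) w v = dder2 f (x + a' *\<^sub>R w + b' *\<^sub>R v) v w"
    using \<open>s > 0\<close> by simp
  moreover have "dist (dder2 f (x + a *\<^sub>R v + b *\<^sub>R w) w v) (dder2 f x w v) < e"
    using d2(2) near[OF ab(1-4)] by (simp add: d_def)
  moreover have "dist (dder2 f (x + a' *\<^sub>R w + b' *\<^sub>R v) v w) (dder2 f x v w) < e"
    using d1(2) near'[OF ab'(1-4)] by (simp add: d_def)
  ultimately have "\<bar>dder2 f x v w - dder2 f x w v\<bar> < 2 * e"
    by (simp add: dist_real_def abs_if split: if_splits)
  then show False by (simp add: e_def)
qed

section \<open>Cutoff functions\<close>

text \<open>Letting \<open>p\<close> range over all polynomials closes the family under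
  differentiation; \<open>flat_exp 1\<close> is the classical flat function
  \<open>exp (- 1 / t)\<close>.\<close>

definition flat_exp :: "real poly \<Rightarrow> real \<Rightarrow> real" where
  "flat_exp p t = (if t > 0 then poly p (1 / t) * exp (- (1 / t)) else 0)"

lemma poly_times_exp_tendsto_0:
  fixes p :: "real poly"
  shows "((\<lambda>s. poly p s * exp (- s)) \<longlongrightarrow> 0) at_top"
proof -
  have "((\<lambda>s. \<Sum>i\<le>degree p. coeff p i * (s ^ i / exp s)) \<longlongrightarrow> (\<Sum>i\<le>degree p. coeff p i * 0)) at_top"
    by (intro tendsto_intros tendsto_power_div_exp_0)
  then show ?thesis
    by (simp add: poly_altdef exp_minus field_simps sum_distrib_left sum_distrib_right)
qed

lemma flat_exp_tendsto_0: "(flat_exp p \<longlongrightarrow> 0) (at 0)"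
proof -
  have "((\<lambda>t::real. poly p (1 / t) * exp (- (1 / t))) \<longlongrightarrow> 0) (at_right 0)"
    using filterlim_compose[OF poly_times_exp_tendsto_0 filterlim_inverse_at_top_right]
    by (simp add: inverse_eq_divide)
  then have "(flat_exp p \<longlongrightarrow> 0) (at_right 0)"
    by (rule Lim_transform_eventually)
      (auto simp: flat_exp_def eventually_at_right_less intro!: eventually_at_rightI[of 0 1])
  moreover have "(flat_exp p \<longlongrightarrow> 0) (at_left 0)"
    by (rule Lim_transform_eventually[OF tendsto_const])
      (auto simp: flat_exp_def intro!: eventually_at_leftI[of "-1"])
  ultimately show ?thesis by (simp add: filterlim_at_split)
qed

lemma flat_exp_has_derivative:
  "(flat_exp p has_field_derivative flat_exp ([:0, 0, 1:] * (p - pderiv p)) t) (at t)"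
proof (cases t "0::real" rule: linorder_cases)
  case less
  have "((\<lambda>t. 0) has_field_derivative 0) (at t)" by simp
  then have "(flat_exp p has_field_derivative 0) (at t)"
    by (rule has_field_derivative_transform_within_open[where S = "{..<0}"]) (use less in \<open>auto simp: flat_exp_def\<close>)
  then show ?thesis using less by (simp add: flat_exp_def)
next
  case equal
  \<comment> \<open>At 0 the difference quotient of \<open>flat_exp p\<close> is itself the member
    of the family with polynomial \<open>[:0, 1:] * p\<close>.\<close>
  have "((\<lambda>h. (flat_exp p (0 + h) - flat_exp p 0) / h) \<longlongrightarrow> 0) (at 0)"
    by (rule Lim_transform_eventually[OF flat_exp_tendsto_0[of "[:0,1:] * p"]])
      (auto simp: flat_exp_def eventually_at_filter)
  then show ?thesis using equal by (simp add: DERIV_def flat_exp_def)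
next
  case greater
  have "((\<lambda>t. poly p (1 / t) * exp (- (1 / t))) has_field_derivative
      (poly (pderiv p) (1 / t) * (- 1 / t\<^sup>2) * exp (- (1 / t)) + poly p (1 / t) * (exp (- (1 / t)) * (1 / t\<^sup>2)))) (at t)"
    using greater
    by (auto intro!: derivative_eq_intros DERIV_chain2[OF poly_DERIV] simp: power2_eq_square)
  then have "(flat_exp p has_field_derivative
      (poly (pderiv p) (1 / t) * (- 1 / t\<^sup>2) * exp (- (1 / t)) + poly p (1 / t) * (exp (- (1 / t)) * (1 / t\<^sup>2)))) (at t)"
    by (rule has_field_derivative_transform_within_open[where S = "{0<..}"]) (use greater in \<open>auto simp: flat_exp_def\<close>)
  moreover have "(poly (pderiv p) (1 / t) * (- 1 / t\<^sup>2) * exp (- (1 / t)) + poly p (1 / t) * (exp (- (1 / t)) * (1 / t\<^sup>2)))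
      = flat_exp ([:0, 0, 1:] * (p - pderiv p)) t"
    using greater by (simp add: flat_exp_def power2_eq_square field_simps)
  ultimately show ?thesis by simp
qed

text \<open>The induction on the order runs over all members at once, because differentiating one
  member gives another.\<close>

lemma smooth_at_real_derivative_closed:
  fixes f :: "'i \<Rightarrow> real \<Rightarrow> real"
  assumes "\<And>i t. (f i has_field_derivative f (d i) t) (at t)"
  shows "smooth_at (f i) t"
proof -
  have "Ck_on m UNIV (f i)" for m i
  proof (induction m arbitrary: i)
    case 0
    have "continuous_on UNIV (f i)"
      by (rule DERIV_continuous_on) (rule assms[THEN DERIV_subset], simp)
    then show ?case by simp
  next
    case (Suc m)
    show ?case
    proof (rule Ck_on_SucI[where f' = "\<lambda>t v. f (d i) t * v"])
      show "(f i has_derivative (*) (f (d i) t)) (at t)" for t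
        using assms by (simp add: has_field_derivative_def)
      show "Ck_on m UNIV (\<lambda>t. f (d i) t * v)" for v
        by (intro Ck_on_bilinear[OF bounded_bilinear_mult] Suc.IH Ck_on_const) simp
    qed simp
  qed
  then show ?thesis unfolding smooth_at_def smooth_on_def by (intro exI[of _ UNIV]) simp
qed

lemma smooth_at_flat_exp: "smooth_at (flat_exp p) t"
  by (rule smooth_at_real_derivative_closed[of flat_exp, OF flat_exp_has_derivative])

lemma dder_field: "(f has_field_derivative D) (at x) \<Longrightarrow> dder f x v = D * v"
  by (rule dder_eq) (simp add: has_field_derivative_def)

lemma smooth_at_inverse:
  fixes t :: real
  assumes "t \<noteq> 0"
  shows "smooth_at inverse t"
proof -
  have "Ck_on m (- {0::real}) inverse" for m
  proof (induction m)
    case 0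
    show ?case by (simp add: continuous_on_inverse)
  next
    case (Suc m)
    show ?case
    proof (rule Ck_on_SucI[where f' = "\<lambda>x h. - (inverse x * h * inverse x)"])
      show "Ck_on m (- {0}) (\<lambda>x. - (inverse x * v * inverse x))" for v :: real
        using Ck_on_bilinear[OF bounded_bilinear_mult Ck_on_const[of m "- {0}" "- v"]
            Ck_on_bilinear[OF bounded_bilinear_mult Suc.IH Suc.IH]]
        by (simp add: mult_ac open_Compl)
    qed (auto intro: has_derivative_inverse')
  qed
  then show ?thesis
    using assms unfolding smooth_at_def smooth_on_def by (intro exI[of _ "- {0}"]) auto
qed

lemma smooth_at_divide:
  fixes f g :: "'a::real_normed_vector \<Rightarrow> real"
  assumes "smooth_at f a" "smooth_at g a" "g a \<noteq> 0"
  shows "smooth_at (\<lambda>x. f x / g x) a"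
  unfolding divide_inverse
  by (rule smooth_at_mult[OF assms(1) smooth_at_compose[OF assms(2) smooth_at_inverse[OF assms(3)]]])

lemma flat_exp_1_nonneg: "flat_exp 1 t \<ge> 0" and flat_exp_1_pos: "t > 0 \<Longrightarrow> flat_exp 1 t > 0"
  and flat_exp_nonpos [simp]: "t \<le> 0 \<Longrightarrow> flat_exp p t = 0"
  by (auto simp: flat_exp_def)

section \<open>Bump functions and cutoffs\<close>

lemma exists_bump:
  fixes a :: "'a::euclidean_space"
  assumes "r > 0"
  obtains \<theta> :: "'a \<Rightarrow> real" where "\<And>x. smooth_at \<theta> x" "\<And>x. 0 \<le> \<theta> x" "\<And>x. \<theta> x \<le> 1"
    "\<And>x. dist x a < r \<Longrightarrow> \<theta> x = 1" "\<And>x. dist x a \<ge> 2 * r \<Longrightarrow> \<theta> x = 0"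
proof
  define s where "s x = (x - a) \<bullet> (x - a)" for x :: 'a
  define \<theta> where "\<theta> x = flat_exp 1 (4 * r\<^sup>2 - s x) / (flat_exp 1 (4 * r\<^sup>2 - s x) + flat_exp 1 (s x - r\<^sup>2))" for x
  have s: "s x = (dist x a)\<^sup>2" for x by (simp add: s_def dist_norm power2_norm_eq_inner)
  have "r\<^sup>2 > 0" using assms by simp
  \<comment> \<open>The two arguments add up to \<open>3 * r^2 > 0\<close>, so at least one of them
    is positive.\<close>
  have den: "flat_exp 1 (4 * r\<^sup>2 - s x) + flat_exp 1 (s x - r\<^sup>2) > 0" for x
  proof (cases "s x < 4 * r\<^sup>2")
    case True
    then show ?thesis using flat_exp_1_pos[of "4 * r\<^sup>2 - s x"] flat_exp_1_nonneg[of "s x - r\<^sup>2"] by simp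
  next
    case False
    then have "s x - r\<^sup>2 > 0" using \<open>r\<^sup>2 > 0\<close> by linarith
    then show ?thesis using flat_exp_1_pos flat_exp_1_nonneg[of "4 * r\<^sup>2 - s x"] by (simp add: add_nonneg_pos)
  qed
  have "smooth_at s x" for x
    unfolding s_def
    by (intro smooth_at_bilinear[OF bounded_bilinear_inner] smooth_at_diff smooth_at_const smooth_at_linear bounded_linear_ident)
  then show "smooth_at \<theta> x" for x
    unfolding \<theta>_def using den[of x]
    by (intro smooth_at_divide smooth_at_add smooth_at_compose[OF _ smooth_at_flat_exp] smooth_at_diff) auto
  show "0 \<le> \<theta> x" "\<theta> x \<le> 1" for x
    using den[of x] flat_exp_1_nonneg[of "4 * r\<^sup>2 - s x"] flat_exp_1_nonneg[of "s x - r\<^sup>2"]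
    by (auto simp: \<theta>_def)
  show "\<theta> x = 1" if "dist x a < r" for x
  proof -
    have "s x \<le> r\<^sup>2" using that by (simp add: s power_mono less_imp_le)
    then show ?thesis using den[of x] by (simp add: \<theta>_def)
  qed
  show "\<theta> x = 0" if "dist x a \<ge> 2 * r" for x
  proof -
    have "(2 * r)\<^sup>2 \<le> s x" unfolding s by (rule power_mono) (use that assms in auto)
    then show ?thesis by (simp add: \<theta>_def power_mult_distrib)
  qed
qed

text \<open>Finitely many bumps are combined as \<open>1 - \<Prod> (1 - X)\<close>: this is 1 as
  soon as one bump is 1, is 0 where all of them vanish, and unlike a sum never exceeds 1.\<close>

lemma exists_cutoff:
  fixes K U :: "'a::euclidean_space set"
  assumes "compact K" "open U" "K \<subseteq> U"
  obtains \<theta> :: "'a \<Rightarrow> real" and W T where "\<And>x. smooth_at \<theta> x" "\<And>x. 0 \<le> \<theta> x" "\<And>x. \<theta> x \<le> 1"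
    "open W" "K \<subseteq> W" "W \<subseteq> T" "\<And>x. x \<in> W \<Longrightarrow> \<theta> x = 1" "compact T" "T \<subseteq> U" "\<And>x. x \<notin> T \<Longrightarrow> \<theta> x = 0"
proof -
  have "\<exists>r>0. cball a (2 * r) \<subseteq> U" if "a \<in> K" for a
  proof -
    have "a \<in> U" using that assms(3) by blast
    then obtain e where "e > 0" "cball a e \<subseteq> U"
      using open_contains_cball[THEN iffD1, OF assms(2)] by meson
    then show ?thesis by (intro exI[of _ "e / 2"]) simp
  qed
  then obtain r where r: "\<And>a. a \<in> K \<Longrightarrow> r a > 0 \<and> cball a (2 * r a) \<subseteq> U" by metis
  have "K \<subseteq> (\<Union>a\<in>K. ball a (r a))" using r by force
  then obtain F where F: "F \<subseteq> K" "finite F" "K \<subseteq> (\<Union>a\<in>F. ball a (r a))"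
    using compactE_image[OF assms(1), of K "\<lambda>a. ball a (r a)"] by auto
  have "\<exists>\<theta>::'a \<Rightarrow> real. (\<forall>x. smooth_at \<theta> x \<and> 0 \<le> \<theta> x \<and> \<theta> x \<le> 1 \<and> (dist x a < r a \<longrightarrow> \<theta> x = 1)
      \<and> (dist x a \<ge> 2 * r a \<longrightarrow> \<theta> x = 0))" if "a \<in> F" for a
  proof -
    have "r a > 0" using r F(1) that by blast
    then show ?thesis by (rule exists_bump[of "r a" a]) blast
  qed
  then obtain X where X: "\<And>a x. a \<in> F \<Longrightarrow> smooth_at (X a) x \<and> 0 \<le> X a x \<and> X a x \<le> (1::real) \<and> (dist x a < r a \<longrightarrow> X a x = 1)
      \<and> (dist x a \<ge> 2 * r a \<longrightarrow> X a x = 0)" by metis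
  show thesis
  proof (rule that[of "\<lambda>x. 1 - (\<Prod>a\<in>F. 1 - X a x)" "\<Union>a\<in>F. ball a (r a)" "\<Union>a\<in>F. cball a (2 * r a)"])
    show "smooth_at (\<lambda>x. 1 - (\<Prod>a\<in>F. 1 - X a x)) x" for x
      using X by (intro smooth_at_diff smooth_at_prod smooth_at_const) auto
    have "0 \<le> (\<Prod>a\<in>F. 1 - X a x)" "(\<Prod>a\<in>F. 1 - X a x) \<le> 1" for x
      using X by (auto intro!: prod_nonneg prod_le_1)
    then show "0 \<le> 1 - (\<Prod>a\<in>F. 1 - X a x)" "1 - (\<Prod>a\<in>F. 1 - X a x) \<le> 1" for x by auto
    show "1 - (\<Prod>a\<in>F. 1 - X a x) = 1" if "x \<in> (\<Union>a\<in>F. ball a (r a))" for x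
      using that X F(2) by (auto simp: dist_commute)
    show "1 - (\<Prod>a\<in>F. 1 - X a x) = 0" if "x \<notin> (\<Union>a\<in>F. cball a (2 * r a))" for x
    proof -
      have "X a x = 0" if "a \<in> F" for a
        using X[OF that, of x] \<open>x \<notin> _\<close> that by (auto simp: dist_commute)
      then show ?thesis by simp
    qed
    have "ball a (r a) \<subseteq> cball a (2 * r a)" if "a \<in> F" for a
      using r[of a] F(1) that by auto
    then show "(\<Union>a\<in>F. ball a (r a)) \<subseteq> (\<Union>a\<in>F. cball a (2 * r a))" by fast
    show "compact (\<Union>a\<in>F. cball a (2 * r a))" using F(2) by (intro compact_UN) auto
  qed (use F r in auto)
qed

text \<open>The factor \<open>t\<close> makes the ramp convex on the whole line; \<open>exp (- 1 / t)\<close> alone is convex only for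
  \<open>t \<le> 1 / 2\<close>.\<close>

definition convex_ramp :: "real \<Rightarrow> real" where
  "convex_ramp t = t * flat_exp 1 t"

lemma convex_ramp_has_derivative: "(convex_ramp has_field_derivative flat_exp [:1, 1:] t) (at t)"
proof -
  have "(convex_ramp has_field_derivative (1 * flat_exp 1 t + flat_exp ([:0, 0, 1:] * (1 - pderiv 1)) t * t)) (at t)"
    unfolding convex_ramp_def by (intro DERIV_mult DERIV_ident flat_exp_has_derivative)
  moreover have "1 * flat_exp 1 t + flat_exp ([:0, 0, 1:] * (1 - pderiv 1)) t * t = flat_exp [:1, 1:] t"
    by (simp add: flat_exp_def field_simps)
  ultimately show ?thesis by simp
qed

text \<open>With \<open>s = 1 / t\<close> the rule gives \<open>s^2 ((1 + s) - 1) = s^3\<close>. So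
  the second derivative of the ramp is \<open>exp (- 1 / t) / t^3\<close>, which is positive for
  every \<open>t > 0\<close>.\<close>

lemma flat_exp_affine_has_derivative: "(flat_exp [:1, 1:] has_field_derivative flat_exp [:0, 0, 0, 1:] t) (at t)"
  using flat_exp_has_derivative[of "[:1, 1:]" t] by (simp add: pderiv_pCons)

lemma smooth_at_convex_ramp: "smooth_at convex_ramp t"
  unfolding convex_ramp_def[abs_def]
  by (intro smooth_at_mult smooth_at_flat_exp smooth_at_linear bounded_linear_ident)

lemma dder_convex_ramp: "dder convex_ramp t v = flat_exp [:1, 1:] t * v"
  by (rule dder_field[OF convex_ramp_has_derivative])

lemma dder2_convex_ramp: "dder2 convex_ramp t v w = flat_exp [:0, 0, 0, 1:] t * v * w"
proof -
  have "((\<lambda>t. flat_exp [:1, 1:] t * w) has_field_derivative flat_exp [:0, 0, 0, 1:] t * w) (at t)"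
    by (rule DERIV_cmult_right[OF flat_exp_affine_has_derivative])
  then show ?thesis unfolding dder2_def by (simp add: dder_convex_ramp dder_field)
qed

lemma flat_exp_coeffs_pos:
  "flat_exp [:1, 1:] t \<ge> 0" "t > 0 \<Longrightarrow> flat_exp [:1, 1:] t > 0"
  "flat_exp [:0, 0, 0, 1:] t \<ge> 0" "t > 0 \<Longrightarrow> flat_exp [:0, 0, 0, 1:] t > 0"
  by (auto simp: flat_exp_def add_pos_pos)

lemma convex_ramp_nonneg: "convex_ramp t \<ge> 0"
  and convex_ramp_pos: "t > 0 \<Longrightarrow> convex_ramp t > 0"
  and convex_ramp_zero: "t \<le> 0 \<Longrightarrow> convex_ramp t = 0"
  by (auto simp: convex_ramp_def flat_exp_def)


section \<open>The Levi form as a Laplacian\<close>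

text \<open>Along the complex line \<open>x + \<complex> v\<close>: the Laplacian of \<open>f\<close> and the covector \<open>2 \<partial>f\<close>.\<close>

definition lap :: "(complex ^ 'n \<Rightarrow> 'b::real_normed_vector) \<Rightarrow> complex ^ 'n \<Rightarrow> complex ^ 'n \<Rightarrow> 'b" where
  "lap f x v = dder2 f x v v + dder2 f x (\<i> *s v) (\<i> *s v)"

definition cgrad :: "(complex ^ 'n \<Rightarrow> real) \<Rightarrow> complex ^ 'n \<Rightarrow> complex ^ 'n \<Rightarrow> complex" where
  "cgrad f x v = Complex (dder f x v) (- dder f x (\<i> *s v))"

lemma lap_cong_ev: "eventually (\<lambda>y. f y = g y) (nhds x) \<Longrightarrow> lap f x v = lap g x v"
  by (simp add: lap_def dder2_cong_ev)

lemma lap_linear: "bounded_linear l \<Longrightarrow> lap l x v = 0"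
  by (simp add: lap_def dder2_linear)

lemma lap_const [simp]: "lap (\<lambda>x. c) x v = 0"
  by (simp add: lap_def)

lemma lap_add: "smooth_at f x \<Longrightarrow> smooth_at g x \<Longrightarrow> lap (\<lambda>x. f x + g x) x v = lap f x v + lap g x v"
  by (simp add: lap_def dder2_add)

lemma lap_sum: "(\<And>i. i \<in> I \<Longrightarrow> smooth_at (f i) x) \<Longrightarrow> lap (\<lambda>x. \<Sum>i\<in>I. f i x) x v = (\<Sum>i\<in>I. lap (f i) x v)"
  by (simp add: lap_def dder2_sum sum.distrib)

lemma lap_mult:
  "smooth_at f x \<Longrightarrow> smooth_at g x \<Longrightarrow>
    lap (\<lambda>x. f x * g x) x v = f x * lap g x v + g x * lap f x v + 2 * Re (cgrad f x v * cnj (cgrad g x v))"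
  by (simp add: lap_def cgrad_def dder2_bilinear[OF bounded_bilinear_mult] algebra_simps)

lemma lap_cmult: "smooth_at f x \<Longrightarrow> lap (\<lambda>x. c * f x) x v = c * lap f x v" for c :: real
  by (simp add: lap_mult cgrad_def zero_complex.code[symmetric])

lemma cgrad_const [simp]: "cgrad (\<lambda>x. c) x v = 0"
  by (simp add: cgrad_def zero_complex.code)

lemma cgrad_linear: "bounded_linear l \<Longrightarrow> cgrad l x v = Complex (l v) (- l (\<i> *s v))"
  by (simp add: cgrad_def dder_linear)

lemma cgrad_add:
  "smooth_at f x \<Longrightarrow> smooth_at g x \<Longrightarrow> cgrad (\<lambda>x. f x + g x) x v = cgrad f x v + cgrad g x v"
  by (simp add: cgrad_def dder_add complex_eq_iff)

lemma cgrad_mult: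
  "smooth_at f x \<Longrightarrow> smooth_at g x \<Longrightarrow> cgrad (\<lambda>x. f x * g x) x v = f x * cgrad g x v + g x * cgrad f x v"
  by (simp add: cgrad_def dder_bilinear[OF bounded_bilinear_mult] complex_eq_iff)

lemma lap_compose_real:
  fixes h :: "real \<Rightarrow> real"
  assumes "smooth_at f x" "smooth_at h (f x)" "\<And>v. dder h (f x) v = h1 * v"
    "\<And>v w. dder2 h (f x) v w = h2 * v * w"
  shows "lap (\<lambda>x. h (f x)) x v = h2 * (cmod (cgrad f x v))\<^sup>2 + h1 * lap f x v"
  by (simp add: lap_def dder2_compose assms cgrad_def cmod_power2 ring_distribs) (simp add: power2_eq_square)

lemma lap_scale:
  assumes "smooth_at f x"
  shows "lap f x (r *\<^sub>R v) = r\<^sup>2 *\<^sub>R lap f x v"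
proof -
  have 2: "dder2 f x (r *\<^sub>R a) (r *\<^sub>R b) = r\<^sup>2 *\<^sub>R dder2 f x a b" for a b
    using linear_dder2_1[OF assms, THEN linear_cmul] linear_dder2_2[OF assms, THEN linear_cmul]
    by (simp add: power2_eq_square)
  have "\<i> *s (r *\<^sub>R v) = r *\<^sub>R (\<i> *s v)" by (simp add: vec_eq_iff)
  then show ?thesis by (simp add: lap_def 2 scaleR_add_right)
qed

lemma dder_of_real: "smooth_at f x \<Longrightarrow> dder (\<lambda>x. complex_of_real (f x)) x v = complex_of_real (dder f x v)"
  by (rule dder_eq) (intro has_derivative_of_real smooth_at_has_derivative)

lemma delbar_eventually:
  assumes "smooth_at \<phi> x"
  shows "\<forall>\<^sub>F y in nhds x. delbar (\<lambda>t. complex_of_real (\<phi> t)) y v =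
    (complex_of_real (dder \<phi> y v) + \<i> * complex_of_real (dder \<phi> y (\<i> *s v))) / 2"
  using eventually_smooth_at[OF assms] by eventually_elim (simp add: delbar_def dder_of_real)

lemma dder_delbar:
  assumes "smooth_at \<phi> x"
  shows "dder (\<lambda>y. delbar (\<lambda>t. complex_of_real (\<phi> t)) y w) x v =
    (complex_of_real (dder2 \<phi> x v w) + \<i> * complex_of_real (dder2 \<phi> x v (\<i> *s w))) / 2"
proof -
  have s: "smooth_at (\<lambda>y. dder \<phi> y u) x" for u by (intro smooth_at_dder assms)
  have d: "((\<lambda>y. dder \<phi> y u) has_derivative (\<lambda>v. dder2 \<phi> x v u)) (at x)" for u
    unfolding dder2_def by (intro smooth_at_has_derivative s)
  have "((\<lambda>y. (complex_of_real (dder \<phi> y w) + \<i> * complex_of_real (dder \<phi> y (\<i> *s w))) / 2)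
     has_derivative (\<lambda>v. (complex_of_real (dder2 \<phi> x v w) + \<i> * complex_of_real (dder2 \<phi> x v (\<i> *s w))) / 2)) (at x)"
    by (auto intro!: derivative_eq_intros d)
  from dder_eq[OF this] show ?thesis
    using dder_cong_ev[OF delbar_eventually[OF assms]] by simp
qed

text \<open>The mixed derivatives are the values on coordinate vectors of a form \<open>K\<close>
  that is complex linear in the first and conjugate linear in the second argument. The double sum
  thus collapses to \<open>K v v\<close>, whose real part is a quarter of the Laplacian.\<close>

lemma levi_form_eq_lap:
  fixes \<phi> :: "complex ^ 'n::finite \<Rightarrow> real"
  assumes "smooth_at \<phi> x"
  shows "levi_form \<phi> x v = lap \<phi> x v / 4"
proof -
  note l1 = linear_dder2_1[OF assms] and l2 = linear_dder2_2[OF assms]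
  define K where "K a b = Complex (dder2 \<phi> x a b + dder2 \<phi> x (\<i> *s a) (\<i> *s b))
      (dder2 \<phi> x a (\<i> *s b) - dder2 \<phi> x (\<i> *s a) b) / 4" for a b
  have K: "del (\<lambda>y. delbar (\<lambda>t. complex_of_real (\<phi> t)) y b) x a = K a b" for a b
    unfolding del_def dder_delbar[OF assms] K_def by (simp add: complex_eq_iff field_simps)
  have ii: "\<i> *s (\<i> *s a) = - a" for a :: "complex ^ 'n" by (simp add: vec_eq_iff)
  have c: "c *s a = Re c *\<^sub>R a + Im c *\<^sub>R (\<i> *s a)" for c and a :: "complex ^ 'n"
    by (simp add: vec_eq_iff complex_eq_iff)
  have ci: "\<i> *s (c *s a) = Re c *\<^sub>R (\<i> *s a) - Im c *\<^sub>R a" for c and a :: "complex ^ 'n"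
    by (simp add: vec_eq_iff complex_eq_iff)
  have s1: "K (z *s a) b = z * K a b" for z a b
    unfolding K_def ci unfolding c[of z a]
    by (simp add: linear_add[OF l1] linear_diff[OF l1] linear_cmul[OF l1] complex_eq_iff field_simps)
  have s2: "K a (z *s b) = cnj z * K a b" for z a b
    unfolding K_def ci unfolding c[of z b]
    by (simp add: linear_add[OF l2] linear_diff[OF l2] linear_cmul[OF l2] complex_eq_iff field_simps)
  have a1: "K (a + a') b = K a b + K a' b" for a a' b
    by (simp add: K_def linear_add[OF l1] vector_add_ldistrib complex_eq_iff field_simps)
  have a2: "K a (b + b') = K a b + K a b'" for a b b'
    by (simp add: K_def linear_add[OF l2] vector_add_ldistrib complex_eq_iff field_simps)
  have z1: "K 0 b = 0" for b using s1[of 0 0 b] by simp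
  have z2: "K b 0 = 0" for b using s2[of b 0 0] by simp
  have sum1: "K (\<Sum>i\<in>I. f i) b = (\<Sum>i\<in>I. K (f i) b)" if "finite I" for f b and I :: "'n set"
    using that by (induction I) (auto simp: a1 z1)
  have sum2: "K b (\<Sum>i\<in>I. f i) = (\<Sum>i\<in>I. K b (f i))" if "finite I" for f b and I :: "'n set"
    using that by (induction I) (auto simp: a2 z2)
  have v: "v = (\<Sum>i\<in>UNIV. v $ i *s axis i 1)"
    by (simp add: basis_expansion)
  have "K v v = K (\<Sum>i\<in>UNIV. v $ i *s axis i 1) (\<Sum>j\<in>UNIV. v $ j *s axis j 1)"
    using v by simp
  also have "\<dots> = (\<Sum>i\<in>UNIV. \<Sum>j\<in>UNIV. K (axis i 1) (axis j 1) * v $ i * cnj (v $ j))"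
    by (subst sum.swap) (simp add: sum1 sum2 s1 s2 sum_distrib_left mult_ac)
  finally have "levi_form \<phi> x v = Re (K v v)"
    by (simp add: levi_form_def K)
  then show ?thesis by (simp add: K_def lap_def)
qed

section \<open>Openness and domination for positive Levi forms\<close>

definition lap_pos :: "(complex ^ 'n \<Rightarrow> real) \<Rightarrow> complex ^ 'n \<Rightarrow> bool" where
  "lap_pos f x \<longleftrightarrow> (\<forall>v. v \<noteq> 0 \<longrightarrow> lap f x v > 0)"

lemma lap_posD: "lap_pos f x \<Longrightarrow> norm v = 1 \<Longrightarrow> lap f x v > 0"
  unfolding lap_pos_def by (metis norm_zero zero_neq_one)

text \<open>The compactness arguments over the unit sphere need continuity jointly in direction and
  point. In a basis, \<open>lap\<close> is quadratic in the direction with coefficients continuous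
  in \<open>x\<close>.\<close>

lemma continuous_on_lap:
  fixes f :: "complex ^ 'n::finite \<Rightarrow> real"
  assumes "\<And>x. x \<in> U \<Longrightarrow> smooth_at f x"
  shows "continuous_on (V \<times> U) (\<lambda>(v, x). lap f x v)"
proof -
  have c: "continuous_on U (\<lambda>x. dder2 f x d e)" for d e
    using assms by (auto intro!: continuous_at_imp_continuous_on smooth_at_continuous smooth_at_dder2)
  have i: "continuous_on A (\<lambda>p. \<i> *s fst p)" for A :: "((complex ^ 'n) \<times> (complex ^ 'n)) set"
    unfolding vector_scalar_mult_def by (intro continuous_intros)
  have "continuous_on (V \<times> U) (\<lambda>p. (\<Sum>d\<in>Basis. \<Sum>e\<in>Basis. ((fst p \<bullet> d) * (fst p \<bullet> e)) *\<^sub>R dder2 f (snd p) d e)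
     + (\<Sum>d\<in>Basis. \<Sum>e\<in>Basis. ((\<i> *s fst p) \<bullet> d * ((\<i> *s fst p) \<bullet> e)) *\<^sub>R dder2 f (snd p) d e))"
    by (intro continuous_intros i continuous_on_compose2[OF c]) auto
  moreover have "(\<Sum>d\<in>Basis. \<Sum>e\<in>Basis. ((v \<bullet> d) * (v \<bullet> e)) *\<^sub>R dder2 f x d e)
     + (\<Sum>d\<in>Basis. \<Sum>e\<in>Basis. ((\<i> *s v) \<bullet> d * ((\<i> *s v) \<bullet> e)) *\<^sub>R dder2 f x d e) = lap f x v"
    if "x \<in> U" for x v
    unfolding lap_def dder2_expand[OF assms[OF that], of v v]
      dder2_expand[OF assms[OF that], of "\<i> *s v" "\<i> *s v"] ..
  ultimately show ?thesis
    by (auto simp: case_prod_beta elim!: continuous_on_eq)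
qed

lemma lap_sphere:
  assumes "smooth_at f x" "v \<noteq> 0"
  shows "lap f x v = (norm v)\<^sup>2 * lap f x ((1 / norm v) *\<^sub>R v)"
  using lap_scale[OF assms(1), of "1 / norm v" v] assms(2) by (simp add: power_divide)

text \<open>By homogeneity only unit vectors matter, and the tube lemma thickens the compact sphere
  over \<open>a\<close> to the sphere times an open set.\<close>

lemma open_lap_pos:
  fixes f :: "complex ^ 'n::finite \<Rightarrow> real"
  assumes "open U" "\<And>x. x \<in> U \<Longrightarrow> smooth_at f x"
  shows "open {x \<in> U. lap_pos f x}"
proof (subst openin_subopen[of euclidean, simplified open_openin[symmetric]], safe)
  fix a assume a: "a \<in> U" "lap_pos f a"
  let ?S = "sphere (0::complex ^ 'n) 1"
  define X where "X = {p \<in> ?S \<times> U. (\<lambda>(v, x). lap f x v) p \<in> {0<..}}"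
  have ope: "openin (top_of_set (?S \<times> U)) X"
    unfolding X_def by (rule continuous_openin_preimage_gen[OF continuous_on_lap, simplified vimage_def Int_def, simplified])
      (use assms in auto)
  have "?S \<noteq> {}" by simp
  moreover have "(\<lambda>v. (v, a)) ` ?S \<subseteq> X" using a by (auto simp: X_def intro: lap_posD)
  ultimately obtain V where V: "openin (top_of_set U) V" "a \<in> V" "?S \<times> V \<subseteq> X"
    using tube_lemma[OF compact_sphere _ _ ope] by blast
  have "open V" "V \<subseteq> U" using V(1) assms(1) by (auto simp: openin_open_eq)
  moreover have "lap_pos f x" if "x \<in> V" for x
    unfolding lap_pos_def
  proof (intro allI impI)
    fix v :: "complex ^ 'n" assume "v \<noteq> 0"
    then have "((1 / norm v) *\<^sub>R v, x) \<in> X" using V(3) that by auto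
    then show "lap f x v > 0"
      using lap_sphere[OF assms(2) \<open>v \<noteq> 0\<close>] \<open>V \<subseteq> U\<close> that \<open>v \<noteq> 0\<close> by (auto simp: X_def)
  qed
  ultimately show "\<exists>T. open T \<and> a \<in> T \<and> T \<subseteq> {x \<in> U. lap_pos f x}"
    using V(2) by (intro exI[of _ V]) auto
qed

lemma lap_pos_dominates:
  fixes f g :: "complex ^ 'n::finite \<Rightarrow> real"
  assumes "compact K" "\<And>x. x \<in> K \<Longrightarrow> smooth_at f x" "\<And>x. x \<in> K \<Longrightarrow> smooth_at g x"
    "\<And>x. x \<in> K \<Longrightarrow> lap_pos g x"
  obtains C where "C > 0" "\<And>x. x \<in> K \<Longrightarrow> lap_pos (\<lambda>y. f y + C * g y) x"
proof (cases "K = {}")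
  case True
  then show ?thesis using that[of 1] by simp
next
  case False
  let ?S = "sphere (0::complex ^ 'n) 1"
  have cp: "compact (?S \<times> K)" "?S \<times> K \<noteq> {}" using assms(1) False by (auto intro: compact_Times)
  obtain p where p: "p \<in> ?S \<times> K" "\<And>q. q \<in> ?S \<times> K \<Longrightarrow> (\<lambda>(v, x). lap g x v) p \<le> (\<lambda>(v, x). lap g x v) q"
    using continuous_attains_inf[OF cp continuous_on_lap[OF assms(3)]] by auto
  obtain q where q: "q \<in> ?S \<times> K" "\<And>p. p \<in> ?S \<times> K \<Longrightarrow> (\<lambda>(v, x). lap f x v) q \<le> (\<lambda>(v, x). lap f x v) p"
    using continuous_attains_inf[OF cp continuous_on_lap[OF assms(2)]] by auto
  define m where "m = lap g (snd p) (fst p)"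
  define b where "b = lap f (snd q) (fst q)"
  have "m > 0" unfolding m_def using p(1) assms(4) by (intro lap_posD) auto
  \<comment> \<open>Over \<open>K\<close> and unit vectors \<open>lap g\<close> is at least
    \<open>m > 0\<close> and \<open>lap f\<close> at least \<open>b\<close>; with this choice
    \<open>C * m + b \<ge> 1\<close>.\<close>
  define C where "C = (\<bar>b\<bar> + 1) / m"
  have "C > 0" using \<open>m > 0\<close> by (simp add: C_def)
  show ?thesis
  proof (rule that[OF \<open>C > 0\<close>])
    fix x assume x: "x \<in> K"
    have u: "lap f x v + C * lap g x v > 0" if "norm v = 1" for v
    proof -
      have "(v, x) \<in> ?S \<times> K" using that x by simp
      then have "m \<le> lap g x v" "b \<le> lap f x v"
        using p(2)[of "(v, x)"] q(2)[of "(v, x)"] by (auto simp: m_def b_def case_prod_beta)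
      moreover have "C * m = \<bar>b\<bar> + 1" using \<open>m > 0\<close> by (simp add: C_def)
      ultimately show ?thesis
        using mult_left_mono[of m "lap g x v" C] \<open>C > 0\<close> by linarith
    qed
    show "lap_pos (\<lambda>y. f y + C * g y) x"
      unfolding lap_pos_def
    proof (intro allI impI)
      fix v :: "complex ^ 'n" assume "v \<noteq> 0"
      let ?u = "(1 / norm v) *\<^sub>R v"
      have "lap (\<lambda>y. f y + C * g y) x v = lap f x v + C * lap g x v"
        using assms x by (simp add: lap_add lap_cmult smooth_at_mult)
      also have "\<dots> = (norm v)\<^sup>2 * (lap f x ?u + C * lap g x ?u)"
        using lap_sphere[OF assms(2)[OF x] \<open>v \<noteq> 0\<close>] lap_sphere[OF assms(3)[OF x] \<open>v \<noteq> 0\<close>]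
        by (simp add: algebra_simps)
      also have "\<dots> > 0" using u[of ?u] \<open>v \<noteq> 0\<close> by simp
      finally show "lap (\<lambda>y. f y + C * g y) x v > 0" .
    qed
  qed
qed

section \<open>Holomorphic maps are smooth\<close>

definition hol_on :: "(complex ^ 'n) set \<Rightarrow> (complex ^ 'n \<Rightarrow> complex) \<Rightarrow> bool" where
  "hol_on W f \<longleftrightarrow> (\<forall>x\<in>W. f differentiable at x \<and> (\<forall>c v. dder f x (c *s v) = c * dder f x v))"

lemma hol_onI:
  assumes "\<And>x. x \<in> W \<Longrightarrow> (f has_derivative F' x) (at x)" "\<And>x c v. x \<in> W \<Longrightarrow> F' x (c *s v) = c * F' x v"
  shows "hol_on W f"
  unfolding hol_on_def using assms(2) dder_eq[OF assms(1)] assms(1)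
  unfolding differentiable_def by (simp, blast)

lemma norm_cvec_scale: "norm (c *s v) = cmod c * norm v" for v :: "complex ^ 'n::finite"
  by (simp add: norm_vec_def norm_mult L2_set_right_distrib)

lemma bounded_linear_cvec_scale: "bounded_linear (\<lambda>c. c *s v)" for v :: "complex ^ 'n::finite"
  by (rule bounded_linear_intro[of _ "norm v"])
    (auto simp: vec_eq_iff norm_cvec_scale algebra_simps)

lemma continuous_on_cvec_scale [continuous_intros]:
  "continuous_on A f \<Longrightarrow> continuous_on A (\<lambda>x. f x *s v)" for v :: "complex ^ 'n::finite"
  by (rule bounded_linear.continuous_on[OF bounded_linear_cvec_scale])

lemma hol_on_continuous: "hol_on W f \<Longrightarrow> continuous_on W f"
  unfolding hol_on_def
  by (meson continuous_at_imp_continuous_on differentiable_imp_continuous_within)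

lemma hol_on_has_derivative: "hol_on W f \<Longrightarrow> x \<in> W \<Longrightarrow> (f has_derivative dder f x) (at x)"
  by (simp add: hol_on_def dder_works)

text \<open>Complex differentiability alone says nothing about how the derivative varies. Cauchy's
  formula on the complex line through \<open>x\<close> in direction \<open>v\<close> expresses it
  through values of \<open>f\<close>, from which it inherits continuity and
  differentiability.\<close>

lemma Cauchy_directional_derivative:
  fixes f :: "complex ^ 'n::finite \<Rightarrow> complex"
  assumes "open W" "hol_on W f" "\<delta> > 0" "\<And>\<xi>. cmod \<xi> \<le> \<delta> \<Longrightarrow> x + \<xi> *s v \<in> W"
  shows "dder f x v = integral {0..1} (\<lambda>t. f (x + (\<delta> * cis (2 * pi * t)) *s v) / (\<delta> * cis (2 * pi * t)))"
proof -
  define g where "g \<xi> = f (x + \<xi> *s v)" for \<xi>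
  have g: "(g has_field_derivative dder f (x + \<xi> *s v) v) (at \<xi>)" if "cmod \<xi> \<le> \<delta>" for \<xi>
  proof -
    have W: "x + \<xi> *s v \<in> W" using assms(4) that by blast
    have "((\<lambda>\<xi>. x + \<xi> *s v) has_derivative (\<lambda>h. h *s v)) (at \<xi>)"
      by (auto intro!: derivative_eq_intros bounded_linear_imp_has_derivative bounded_linear_cvec_scale)
    from has_derivative_compose[OF this hol_on_has_derivative[OF assms(2) W]]
    show ?thesis
      using assms(2) W by (simp add: has_field_derivative_def g_def[abs_def] hol_on_def mult.commute[of _ "dder _ _ _"] mult_commute_abs)
  qed
  have "continuous_on (cball 0 \<delta>) g"
    by (intro DERIV_continuous_on) (use g in \<open>auto intro: DERIV_subset\<close>)
  moreover have "g holomorphic_on ball 0 \<delta>"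
    by (rule holomorphic_onI) (use g in \<open>auto simp: field_differentiable_def intro: DERIV_subset less_imp_le\<close>)
  moreover have "0 \<in> ball (0::complex) \<delta>" using assms(3) by simp
  ultimately have "(g has_field_derivative (1 / (2 * of_real pi * \<i>) * contour_integral (circlepath 0 \<delta>) (\<lambda>u. g u / (u - 0)\<^sup>2))) (at 0)"
    by (rule Cauchy_derivative_integral_circlepath(2))
  then have "dder f x v = 1 / (2 * of_real pi * \<i>) * contour_integral (circlepath 0 \<delta>) (\<lambda>u. g u / u\<^sup>2)"
    using DERIV_unique[OF _ g[of 0]] assms(3) by simp
  also have "contour_integral (circlepath 0 \<delta>) (\<lambda>u. g u / u\<^sup>2) =
      integral {0..1} (\<lambda>t. (2 * of_real pi * \<i>) * (g (\<delta> * cis (2 * pi * t)) / (\<delta> * cis (2 * pi * t))))"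
    unfolding contour_integral_integral
  proof (rule integral_cong)
    fix t :: real
    have "circlepath 0 \<delta> t = \<delta> * cis (2 * pi * t)"
      by (simp add: circlepath cis_conv_exp mult_ac)
    moreover have "vector_derivative (circlepath 0 \<delta>) (at t) = (2 * of_real pi * \<i>) * (\<delta> * cis (2 * pi * t))"
      by (simp add: vector_derivative_circlepath cis_conv_exp mult_ac)
    ultimately show "g (circlepath 0 \<delta> t) / (circlepath 0 \<delta> t)\<^sup>2 * vector_derivative (circlepath 0 \<delta>) (at t)
        = (2 * of_real pi * \<i>) * (g (\<delta> * cis (2 * pi * t)) / (\<delta> * cis (2 * pi * t)))"
      using assms(3) by (simp add: power2_eq_square)
  qed
  also have "\<dots> = (2 * of_real pi * \<i>) * integral {0..1} (\<lambda>t. g (\<delta> * cis (2 * pi * t)) / (\<delta> * cis (2 * pi * t)))"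
    by (rule integral_mult_right)
  finally show ?thesis by (simp add: g_def)
qed

lemma hol_on_small_discs:
  fixes v :: "complex ^ 'n::finite"
  assumes "open W" "x0 \<in> W"
  obtains r \<delta> where "r > 0" "\<delta> > 0" "\<And>x \<xi>. x \<in> ball x0 r \<Longrightarrow> cmod \<xi> \<le> \<delta> \<Longrightarrow> x + \<xi> *s v \<in> W"
proof -
  obtain r where r: "r > 0" "ball x0 r \<subseteq> W" using assms by (meson open_contains_ball)
  \<comment> \<open>A positive bound replaces \<open>norm v\<close>, so that the radius of the disc
    makes sense also for \<open>v = 0\<close>.\<close>
  obtain N where N: "N > 0" "norm v \<le> N" by (metis linordered_field_no_ub less_le_trans less_imp_le norm_ge_zero le_less_trans)
  show thesis
  proof (rule that[of "r / 2" "r / (2 * N)"])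
    fix x \<xi> assume x: "x \<in> ball x0 (r / 2)" and \<xi>: "cmod \<xi> \<le> r / (2 * N)"
    have "dist (x + \<xi> *s v) x = cmod \<xi> * norm v" by (simp add: dist_norm norm_cvec_scale)
    also have "\<dots> \<le> r / (2 * N) * N"
      using \<xi> r N by (intro mult_mono) auto
    also have "\<dots> = r / 2" using N by simp
    finally have "dist x0 (x + \<xi> *s v) < r"
      using x dist_triangle[of x0 "x + \<xi> *s v" x] by (simp add: dist_commute)
    then show "x + \<xi> *s v \<in> W" using r(2) by auto
  qed (use r N in auto)
qed

lemma hol_on_dder_continuous:
  fixes f :: "complex ^ 'n::finite \<Rightarrow> complex"
  assumes "open W" "hol_on W f"
  shows "continuous_on W (\<lambda>x. dder f x v)"
proof (rule continuous_at_imp_continuous_on, rule ballI)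
  fix x0 assume "x0 \<in> W"
  obtain r \<delta> where r: "r > 0" "\<delta> > 0" "\<And>x \<xi>. x \<in> ball x0 r \<Longrightarrow> cmod \<xi> \<le> \<delta> \<Longrightarrow> x + \<xi> *s v \<in> W"
    using hol_on_small_discs[OF assms(1) \<open>x0 \<in> W\<close>, of v] by metis
  have "continuous_on (ball x0 r \<times> cbox 0 1) (\<lambda>(x, t::real). f (x + (\<delta> * cis (2 * pi * t)) *s v) / (\<delta> * cis (2 * pi * t)))"
    unfolding case_prod_beta using r(2)
    by (intro continuous_intros continuous_on_compose2[OF hol_on_continuous[OF assms(2)]])
      (auto intro!: r(3) simp: norm_mult)
  then have "continuous_on (ball x0 r) (\<lambda>x. integral (cbox 0 1) (\<lambda>t::real. f (x + (\<delta> * cis (2 * pi * t)) *s v) / (\<delta> * cis (2 * pi * t))))"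
    by (rule integral_continuous_on_param)
  then have "continuous_on (ball x0 r) (\<lambda>x. dder f x v)"
    by (rule continuous_on_eq)
      (use Cauchy_directional_derivative[OF assms r(2) r(3)] in simp)
  then show "isCont (\<lambda>x. dder f x v) x0"
    using r(1) by (simp add: continuous_on_eq_continuous_at)
qed

text \<open>The Cauchy integral is differentiated under the integral sign. The Leibniz rule wants a
  jointly continuous derivative with values in bounded linear maps, hence \<open>Blinfun\<close>;
  its components are continuous by \<open>hol_on_dder_continuous\<close>. Complex linearity passes
  through the integral.\<close>

lemma hol_on_dder:
  fixes f :: "complex ^ 'n::finite \<Rightarrow> complex"
  assumes "open W" "hol_on W f"
  shows "hol_on W (\<lambda>x. dder f x v)"
proof -
  have "\<exists>F'. ((\<lambda>x. dder f x v) has_derivative F') (at x0) \<and> (\<forall>c h. F' (c *s h) = c * F' h)" if "x0 \<in> W" for x0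
  proof -
    obtain r \<delta> where r: "r > 0" "\<delta> > 0" "\<And>x \<xi>. x \<in> ball x0 r \<Longrightarrow> cmod \<xi> \<le> \<delta> \<Longrightarrow> x + \<xi> *s v \<in> W"
      using hol_on_small_discs[OF assms(1) \<open>x0 \<in> W\<close>, of v] by metis
    define e where "e t = \<delta> * cis (2 * pi * t)" for t
    have e0: "e t \<noteq> 0" and W: "x \<in> ball x0 r \<Longrightarrow> x + e t *s v \<in> W" for x t
      using r(2) by (auto simp: e_def norm_mult intro!: r(3))
    have ce: "continuous_on A (\<lambda>p. e (snd p))" for A :: "((complex ^ 'n) \<times> real) set"
      unfolding e_def by (intro continuous_intros)
    define F where "F x t = f (x + e t *s v) / e t" for x t
    define L where "L x t = Blinfun (\<lambda>h. dder f (x + e t *s v) h / e t)" for x t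
    have lin: "bounded_linear (\<lambda>h. dder f (x + e t *s v) h / e t)" if "x \<in> ball x0 r" for x t
      using hol_on_has_derivative[OF assms(2) W[OF that]]
      by (intro bounded_linear_divide[THEN bounded_linear_compose] has_derivative_bounded_linear)
    have L: "blinfun_apply (L x t) h = dder f (x + e t *s v) h / e t" if "x \<in> ball x0 r" for x t h
      unfolding L_def using bounded_linear_Blinfun_apply[OF lin[OF that]] by simp
    have contL: "continuous_on (ball x0 r \<times> cbox 0 1) (\<lambda>(x, t). L x t)"
    proof (rule continuous_on_blinfun_componentwise)
      fix h :: "complex ^ 'n" assume "h \<in> Basis"
      have "continuous_on (ball x0 r \<times> cbox 0 1) (\<lambda>p. dder f (fst p + e (snd p) *s v) h / e (snd p))"
        by (intro continuous_intros ce continuous_on_compose2[OF hol_on_dder_continuous[OF assms, of h]])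
          (auto simp: e0 intro!: W)
      then show "continuous_on (ball x0 r \<times> cbox 0 1) (\<lambda>x. blinfun_apply (case x of (x, t) \<Rightarrow> L x t) h)"
        by (rule continuous_on_eq) (auto simp: L)
    qed
    have contx: "continuous_on (cbox 0 1) (\<lambda>t. f (x + e t *s v) / e t)" if "x \<in> ball x0 r" for x
      unfolding e_def using r(2) that
      by (intro continuous_intros continuous_on_compose2[OF hol_on_continuous[OF assms(2)]])
        (auto intro!: r(3) simp: norm_mult)
    have deriv: "((\<lambda>x. integral (cbox 0 1) (F x)) has_derivative blinfun_apply (integral (cbox 0 1) (L x0))) (at x0 within ball x0 r)"
    proof (rule leibniz_rule[OF _ _ contL])
      fix x t assume x: "x \<in> ball x0 r" "t \<in> cbox 0 (1::real)"
      have "((\<lambda>x. x + e t *s v) has_derivative (\<lambda>h. h)) (at x)"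
        by (auto intro!: derivative_eq_intros)
      from has_derivative_compose[OF this hol_on_has_derivative[OF assms(2) W[OF x(1)]]]
      have "((\<lambda>x. F x t) has_derivative (\<lambda>h. dder f (x + e t *s v) h / e t)) (at x)"
        unfolding F_def by (rule bounded_linear.has_derivative[OF bounded_linear_divide])
      then have "((\<lambda>x. F x t) has_derivative blinfun_apply (L x t)) (at x)"
        by (rule has_derivative_eq_rhs) (simp add: fun_eq_iff L[OF x(1)])
      then show "((\<lambda>x. F x t) has_derivative blinfun_apply (L x t)) (at x within ball x0 r)"
        by (rule has_derivative_at_withinI)
    next
      fix x assume "x \<in> ball x0 r"
      then show "F x integrable_on cbox 0 1"
        unfolding F_def[abs_def] by (intro integrable_continuous contx)
    qed (use r in auto)
    have "x0 \<in> ball x0 r" using r(1) by simp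
    have int: "blinfun_apply (integral (cbox 0 1) (L x0)) h = integral (cbox 0 1) (\<lambda>t. dder f (x0 + e t *s v) h / e t)" for h
    proof -
      have "L x0 integrable_on cbox 0 1"
        using contL \<open>x0 \<in> ball x0 r\<close>
        by (intro integrable_continuous continuous_on_compose2[OF contL, of _ "\<lambda>t. (x0, t)", simplified] continuous_intros) auto
      then have "blinfun_apply (integral (cbox 0 1) (L x0)) h = integral (cbox 0 1) (\<lambda>t. blinfun_apply (L x0 t) h)"
        using integral_linear[OF _ bounded_linear_apply_blinfun, of "L x0" "cbox 0 1" h] by (simp add: o_def)
      then show ?thesis by (simp add: L[OF \<open>x0 \<in> ball x0 r\<close>])
    qed
    have "((\<lambda>x. integral (cbox 0 1) (F x)) has_derivative blinfun_apply (integral (cbox 0 1) (L x0))) (at x0)"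
      using deriv unfolding at_within_open[OF \<open>x0 \<in> ball x0 r\<close> open_ball] .
    then have "((\<lambda>x. dder f x v) has_derivative blinfun_apply (integral (cbox 0 1) (L x0))) (at x0)"
      by (rule has_derivative_transform_within_open[OF _ open_ball[of x0 r]])
        (use \<open>x0 \<in> ball x0 r\<close> Cauchy_directional_derivative[OF assms r(2) r(3)] in \<open>simp_all add: F_def[abs_def] e_def\<close>)
    moreover have "blinfun_apply (integral (cbox 0 1) (L x0)) (c *s h) = c * blinfun_apply (integral (cbox 0 1) (L x0)) h" for c h
    proof -
      have "dder f (x0 + e t *s v) (c *s h) / e t = c * (dder f (x0 + e t *s v) h / e t)" for t
        using assms(2) W[OF \<open>x0 \<in> ball x0 r\<close>, of t] by (simp add: hol_on_def)
      then show ?thesis by (simp only: int integral_mult_right)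
    qed
    ultimately show ?thesis by blast
  qed
  then obtain F' where "\<And>x. x \<in> W \<Longrightarrow> ((\<lambda>x. dder f x v) has_derivative F' x) (at x)"
    "\<And>x c h. x \<in> W \<Longrightarrow> F' x (c *s h) = c * F' x h"
    by metis
  then show ?thesis by (rule hol_onI)
qed

lemma hol_on_smooth:
  fixes f :: "complex ^ 'n::finite \<Rightarrow> complex"
  assumes "open W" "hol_on W f"
  shows "smooth_on W f"
proof -
  have "Ck_on m W f" for m
    using assms(2)
  proof (induction m arbitrary: f)
    case 0
    then show ?case by (simp add: hol_on_continuous)
  next
    case (Suc m)
    then show ?case using hol_on_dder[OF assms(1) Suc.prems] by (simp add: hol_on_def)
  qed
  then show ?thesis by (simp add: smooth_on_def)
qed

lemma hol_on_smooth_at: "open W \<Longrightarrow> hol_on W f \<Longrightarrow> x \<in> W \<Longrightarrow> smooth_at f x"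
  for f :: "complex ^ 'n::finite \<Rightarrow> complex"
  using hol_on_smooth smooth_on_iff_smooth_at by blast

lemma hol_on_lap:
  fixes f :: "complex ^ 'n::finite \<Rightarrow> complex"
  assumes "open W" "hol_on W f" "x \<in> W"
  shows "lap f x v = 0"
proof -
  have "eventually (\<lambda>y. y \<in> W) (nhds x)" using assms by (simp add: eventually_nhds_in_open)
  then have "eventually (\<lambda>y. dder f y (\<i> *s v) = \<i> * dder f y v) (nhds x)"
    by eventually_elim (use assms(2) in \<open>simp add: hol_on_def\<close>)
  then have "dder2 f x (\<i> *s v) (\<i> *s v) = dder (\<lambda>y. \<i> * dder f y v) x (\<i> *s v)"
    unfolding dder2_def by (rule dder_cong_ev)
  also have "\<dots> = \<i> * dder2 f x (\<i> *s v) v"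
    using hol_on_smooth_at[OF assms]
    by (simp add: dder_bilinear[OF bounded_bilinear_mult] smooth_at_dder dder2_def)
  also have "dder2 f x (\<i> *s v) v = \<i> * dder2 f x v v"
    using hol_on_dder[OF assms(1,2), of v] assms(3) by (simp add: hol_on_def dder2_def)
  finally show ?thesis by (simp add: lap_def)
qed

lemma bounded_linear_axis: "bounded_linear (axis j :: 'b::euclidean_space \<Rightarrow> 'b ^ 'n::finite)"
  by (intro linear_conv_bounded_linear[THEN iffD1] linearI) (auto simp: vec_eq_iff axis_def)

lemma holomorphic_map_on_hol_on_nth:
  fixes \<Phi> :: "complex ^ 'n \<Rightarrow> complex ^ 'm::finite"
  assumes "holomorphic_map_on W \<Phi>"
  shows "hol_on W (\<lambda>x. \<Phi> x $ j)"
  unfolding hol_on_def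
proof
  fix x assume "x \<in> W"
  then obtain F' where F': "(\<Phi> has_derivative F') (at x)" "\<And>c v. F' (c *s v) = c *s F' v"
    using assms by (auto simp: holomorphic_map_on_def)
  have "((\<lambda>x. \<Phi> x $ j) has_derivative (\<lambda>v. F' v $ j)) (at x)"
    by (rule bounded_linear.has_derivative[OF bounded_linear_vec_nth F'(1)])
  then show "(\<lambda>x. \<Phi> x $ j) differentiable at x \<and>
      (\<forall>c v. dder (\<lambda>x. \<Phi> x $ j) x (c *s v) = c * dder (\<lambda>x. \<Phi> x $ j) x v)"
    by (auto simp: dder_eq differentiable_def F'(2))
qed

lemma holomorphic_map_smooth_at:
  fixes \<Phi> :: "complex ^ 'n::finite \<Rightarrow> complex ^ 'm::finite"
  assumes "open W" "holomorphic_map_on W \<Phi>" "x \<in> W"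
  shows "smooth_at \<Phi> x"
proof -
  have "smooth_at (\<lambda>x. \<Sum>j\<in>UNIV. axis j (\<Phi> x $ j)) x"
    using hol_on_smooth_at[OF assms(1) holomorphic_map_on_hol_on_nth[OF assms(2)] assms(3)]
    by (intro smooth_at_sum smooth_at_linear_compose[OF bounded_linear_axis])
  moreover have "(\<lambda>x. \<Sum>j\<in>UNIV. axis j (\<Phi> x $ j)) = \<Phi>"
    by (simp add: fun_eq_iff vec_eq_iff axis_def)
  ultimately show ?thesis by simp
qed

lemma dder_vec_nth: "smooth_at \<Phi> x \<Longrightarrow> dder (\<lambda>x. \<Phi> x $ j) x v = dder \<Phi> x v $ j"
  by (rule dder_eq) (rule bounded_linear.has_derivative[OF bounded_linear_vec_nth smooth_at_has_derivative])

lemma dder2_vec_nth: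
  assumes "smooth_at \<Phi> x"
  shows "dder2 (\<lambda>x. \<Phi> x $ j) x v w = dder2 \<Phi> x v w $ j"
proof -
  have "eventually (\<lambda>y. dder (\<lambda>x. \<Phi> x $ j) y w = dder \<Phi> y w $ j) (nhds x)"
    using eventually_smooth_at[OF assms] by eventually_elim (rule dder_vec_nth)
  from dder_cong_ev[OF this] show ?thesis
    by (simp add: dder2_def dder_vec_nth smooth_at_dder assms)
qed

text \<open>The extra term of the second order chain rule is \<open>dder \<rho>\<close> applied to
  the Laplacian of \<open>\<Phi>\<close> along the line, and the components of a holomorphic map are
  harmonic there.\<close>

lemma lap_holomorphic_compose:
  fixes \<Phi> :: "complex ^ 'n::finite \<Rightarrow> complex ^ 'm::finite" and \<rho> :: "complex ^ 'm \<Rightarrow> real"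
  assumes "open W" "holomorphic_map_on W \<Phi>" "x \<in> W" "smooth_at \<rho> (\<Phi> x)"
  shows "lap (\<lambda>x. \<rho> (\<Phi> x)) x v = lap \<rho> (\<Phi> x) (dder \<Phi> x v)"
proof -
  note s = holomorphic_map_smooth_at[OF assms(1-3)]
  have "dder \<Phi> x (\<i> *s v) = \<i> *s dder \<Phi> x v"
    using assms(2,3) by (metis holomorphic_map_on_def dder_eq)
  moreover have "dder2 \<Phi> x v v + dder2 \<Phi> x (\<i> *s v) (\<i> *s v) = 0"
    using hol_on_lap[OF assms(1) holomorphic_map_on_hol_on_nth[OF assms(2)] assms(3)]
    by (simp add: lap_def dder2_vec_nth[OF s] vec_eq_iff)
  then have "dder \<rho> (\<Phi> x) (dder2 \<Phi> x v v) + dder \<rho> (\<Phi> x) (dder2 \<Phi> x (\<i> *s v) (\<i> *s v)) = 0"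
    using linear_dder_at[OF assms(4)] by (metis linear_0 linear_add)
  ultimately show ?thesis
    by (simp add: lap_def dder2_compose[OF s assms(4)])
qed

section \<open>The normal form\<close>

text \<open>Value, \<open>cgrad\<close> and \<open>lap\<close> in one direction are bundled because
  these three data together are closed under sums and products, so that jets of polynomials can be
  computed by applying rules.\<close>

definition jet ::
  "complex ^ 'n \<Rightarrow> complex ^ 'n \<Rightarrow> (complex ^ 'n \<Rightarrow> real) \<Rightarrow> real \<Rightarrow> complex \<Rightarrow> real \<Rightarrow> bool" where
  "jet Z V f a d l \<longleftrightarrow> smooth_at f Z \<and> f Z = a \<and> cgrad f Z V = d \<and> lap f Z V = l"

lemma jet_eq: "jet Z V f a d l \<Longrightarrow> a = a' \<Longrightarrow> d = d' \<Longrightarrow> l = l' \<Longrightarrow> jet Z V f a' d' l'"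
  by simp

lemma jet_const: "jet Z V (\<lambda>x. r) r 0 0"
  by (simp add: jet_def)

lemma jet_add: "jet Z V f a d l \<Longrightarrow> jet Z V g b e m \<Longrightarrow> jet Z V (\<lambda>x. f x + g x) (a + b) (d + e) (l + m)"
  by (auto simp: jet_def cgrad_add lap_add)

lemma jet_mult:
  "jet Z V f a d l \<Longrightarrow> jet Z V g b e m \<Longrightarrow>
    jet Z V (\<lambda>x. f x * g x) (a * b) (a * e + b * d) (a * m + b * l + 2 * Re (d * cnj e))"
  by (auto simp: jet_def cgrad_mult lap_mult)

lemma jet_cmult: "jet Z V f a d l \<Longrightarrow> jet Z V (\<lambda>x. r * f x) (r * a) (r * d) (r * l)"
  using jet_mult[OF jet_const[of Z V r], of f a d l] by simp

lemma jet_diff: "jet Z V f a d l \<Longrightarrow> jet Z V g b e m \<Longrightarrow> jet Z V (\<lambda>x. f x - g x) (a - b) (d - e) (l - m)"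
  using jet_add[OF _ jet_mult[OF jet_const[of Z V "-1"]], of f a d l g b e m] by simp

lemma jet_square:
  assumes "jet Z V f a d l"
  shows "jet Z V (\<lambda>x. (f x)\<^sup>2) (a\<^sup>2) (2 * a * d) (2 * (cmod d)\<^sup>2 + 2 * a * l)"
proof -
  have "cmod d * cmod d = Re d * Re d + Im d * Im d"
    using cmod_power2[of d] by (simp add: power2_eq_square)
  then show ?thesis
    using jet_mult[OF assms assms] by (simp add: power2_eq_square algebra_simps)
qed

lemma bounded_linear_Re_nth: "bounded_linear (\<lambda>x. Re (x $ i))"
  by (rule bounded_linear_compose[OF bounded_linear_Re bounded_linear_vec_nth])

lemma bounded_linear_Im_nth: "bounded_linear (\<lambda>x. Im (x $ i))"
  by (rule bounded_linear_compose[OF bounded_linear_Im bounded_linear_vec_nth])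

lemma jet_Re: "jet Z V (\<lambda>x. Re (x $ i)) (Re (Z $ i)) (V $ i) 0"
  by (simp add: jet_def smooth_at_linear cgrad_linear lap_linear bounded_linear_Re_nth complex_eq_iff)

lemma jet_Im: "jet Z V (\<lambda>x. Im (x $ i)) (Im (Z $ i)) (- \<i> * V $ i) 0"
  by (simp add: jet_def smooth_at_linear cgrad_linear lap_linear bounded_linear_Im_nth complex_eq_iff)

definition nsq :: "'n \<Rightarrow> complex ^ 'n \<Rightarrow> real" where
  "nsq i Z = (Re (Z $ i))\<^sup>2 + (Im (Z $ i))\<^sup>2"

lemma nsq_eq: "nsq i Z = (cmod (Z $ i))\<^sup>2"
  by (simp add: nsq_def cmod_power2)

lemma jet_nsq: "jet Z V (nsq i) ((cmod (Z $ i))\<^sup>2) (2 * (cnj (Z $ i) * V $ i)) (4 * (cmod (V $ i))\<^sup>2)"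
  unfolding nsq_def[abs_def]
  by (rule jet_eq, (rule jet_add | rule jet_square | rule jet_Re | rule jet_Im)+)
    (auto simp: cmod_power2 complex_eq_iff norm_mult algebra_simps)

text \<open>The weight \<open>1 + \<kappa> \<bar>z\<bar>\<^sup>2\<close> contributes \<open>4 \<kappa> \<bar>dz\<bar>\<^sup>2 h\<^sup>2\<close> to the Laplacian of \<open>h\<^sup>2\<close>, which absorbs
  the indefinite term \<open>2 h \<Delta>h\<close>. Any sufficiently large constant would do.\<close>

abbreviation \<kappa> :: real where "\<kappa> \<equiv> 1000"

definition wsq :: "'n \<Rightarrow> (complex ^ 'n \<Rightarrow> real) \<Rightarrow> complex ^ 'n \<Rightarrow> real" where
  "wsq i h Z = (1 + \<kappa> * nsq i Z) * (h Z)\<^sup>2"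

text \<open>\<open>B\<close> bounds the part of the Laplacian of \<open>h\<close> that does not come
  from \<open>dz\<close>. Of the gain \<open>4 \<kappa> |dz|^2 h^2\<close> one quarter pays for the
  cross term between the weight and \<open>h^2\<close>, another for \<open>2 h lap h\<close>, and
  half remains. The bound on \<open>|z|\<close> keeps the weight below \<open>17/16\<close>.\<close>

lemma wsq_lower_bound:
  assumes h: "jet Z V h b d l" and "\<bar>l\<bar> \<le> 2 * cmod (V $ i) * B" "B \<ge> 0" "16 * \<kappa> * (cmod (Z $ i))\<^sup>2 \<le> 1"
  shows "smooth_at (wsq i h) Z"
    and "(cmod d)\<^sup>2 + 2 * \<kappa> * (cmod (V $ i))\<^sup>2 * b\<^sup>2 - B\<^sup>2 / 50 \<le> lap (wsq i h) Z V"
proof -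
  define s a t where "s = cmod (Z $ i)" and "a = cmod (V $ i)" and "t = cmod d"
  let ?c = "Re (\<kappa> * (2 * (cnj (Z $ i) * V $ i)) * cnj (2 * b * d))"
  have j: "jet Z V (wsq i h) ((1 + \<kappa> * s\<^sup>2) * b\<^sup>2)
     ((1 + \<kappa> * s\<^sup>2) * (2 * b * d) + b\<^sup>2 * (\<kappa> * (2 * (cnj (Z $ i) * V $ i))))
     ((1 + \<kappa> * s\<^sup>2) * (2 * t\<^sup>2 + 2 * b * l) + b\<^sup>2 * (\<kappa> * (4 * a\<^sup>2)) + 2 * ?c)"
    unfolding wsq_def[abs_def] s_def a_def t_def
    by (rule jet_eq, (rule jet_mult | rule jet_add | rule jet_const | rule jet_nsq | rule jet_square | rule h)+) simp_all
  then show "smooth_at (wsq i h) Z" by (simp add: jet_def)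
  have nn: "s \<ge> 0" "a \<ge> 0" "t \<ge> 0" by (auto simp: s_def a_def t_def)
  have "\<bar>?c\<bar> \<le> cmod (\<kappa> * (2 * (cnj (Z $ i) * V $ i)) * cnj (2 * b * d))"
    by (rule abs_Re_le_cmod)
  also have "\<dots> = 4 * \<kappa> * (s * a * \<bar>b\<bar> * t)"
    by (simp add: norm_mult s_def a_def t_def)
  finally have c: "\<bar>?c\<bar> \<le> 4 * \<kappa> * (s * a * \<bar>b\<bar> * t)" .
  have s2: "16 * \<kappa> * s\<^sup>2 \<le> 1" using assms(4) by (simp add: s_def)
  have e1: "8 * \<kappa> * (s * a * \<bar>b\<bar> * t) \<le> t\<^sup>2 + \<kappa> * a\<^sup>2 * b\<^sup>2"
  proof -
    have "2 * (4 * \<kappa> * s * a * \<bar>b\<bar>) * t \<le> (4 * \<kappa> * s * a * \<bar>b\<bar>)\<^sup>2 + t\<^sup>2"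
      by (rule sum_squares_bound)
    moreover have "(4 * \<kappa> * s * a * \<bar>b\<bar>)\<^sup>2 = (16 * \<kappa> * s\<^sup>2) * (\<kappa> * a\<^sup>2 * b\<^sup>2)"
      by (simp add: power_mult_distrib)
    moreover have "\<dots> \<le> 1 * (\<kappa> * a\<^sup>2 * b\<^sup>2)"
      by (intro mult_right_mono s2) auto
    ultimately show ?thesis by (simp add: mult_ac)
  qed
  have e2: "(1 + \<kappa> * s\<^sup>2) * (2 * b * l) \<ge> - (\<kappa> * a\<^sup>2 * b\<^sup>2) - B\<^sup>2 / 50"
  proof -
    have "\<bar>(1 + \<kappa> * s\<^sup>2) * (2 * b * l)\<bar> = (1 + \<kappa> * s\<^sup>2) * (2 * \<bar>b\<bar> * \<bar>l\<bar>)"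
      by (simp add: abs_mult)
    also have "\<dots> \<le> 17 / 16 * (2 * \<bar>b\<bar> * (2 * a * B))"
      using s2 assms(2) by (intro mult_mono) (auto simp: a_def assms(3))
    \<comment> \<open>The constants split \<open>17/4 = 2 * 30 * (17/240)\<close> so that
      \<open>30^2 \<le> \<kappa>\<close> and \<open>(17/240)^2 \<le> 1/50\<close>.\<close>
    also have "\<dots> = 2 * (a * \<bar>b\<bar> * 30) * (17 / 240 * B)" by simp
    also have "\<dots> \<le> (a * \<bar>b\<bar> * 30)\<^sup>2 + (17 / 240 * B)\<^sup>2"
      by (rule sum_squares_bound)
    also have "\<dots> \<le> \<kappa> * a\<^sup>2 * b\<^sup>2 + B\<^sup>2 / 50"
      by (simp add: power_mult_distrib power_divide)
    finally show ?thesis by linarith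
  qed
  have e3: "(1 + \<kappa> * s\<^sup>2) * (2 * t\<^sup>2) \<ge> 2 * t\<^sup>2"
    by (simp add: algebra_simps)
  have "lap (wsq i h) Z V = (1 + \<kappa> * s\<^sup>2) * (2 * t\<^sup>2 + 2 * b * l) + b\<^sup>2 * (\<kappa> * (4 * a\<^sup>2)) + 2 * ?c"
    using j by (simp add: jet_def)
  also have "\<dots> = (1 + \<kappa> * s\<^sup>2) * (2 * t\<^sup>2) + (1 + \<kappa> * s\<^sup>2) * (2 * b * l) + 4 * (\<kappa> * a\<^sup>2 * b\<^sup>2) + 2 * ?c"
    by (simp add: algebra_simps)
  also have "\<dots> \<ge> t\<^sup>2 + 2 * (\<kappa> * a\<^sup>2 * b\<^sup>2) - B\<^sup>2 / 50"
    using e1 e2 e3 c by linarith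
  finally show "(cmod d)\<^sup>2 + 2 * \<kappa> * (cmod (V $ i))\<^sup>2 * b\<^sup>2 - B\<^sup>2 / 50 \<le> lap (wsq i h) Z V"
    by (simp add: t_def a_def mult_ac)
qed

text \<open>Real and imaginary part of \<open>\<zeta> - z\<close>-bar \<open>(u\<^sub>1 + \<i> u\<^sub>2)\<close>, where \<open>z\<close>, \<open>w\<^sub>1\<close>, \<open>w\<^sub>2\<close>, \<open>\<zeta>\<close> are the coordinates
  with indices \<open>i\<close>, \<open>m\<close>, \<open>n\<close>, \<open>j\<close>.\<close>

definition defect_Re :: "'n \<Rightarrow> 'n \<Rightarrow> 'n \<Rightarrow> 'n \<Rightarrow> complex ^ 'n \<Rightarrow> real" where
  "defect_Re i m n j Z = Re (Z $ j) - (Re (Z $ i) * Re (Z $ m) + Im (Z $ i) * Re (Z $ n))"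

definition defect_Im :: "'n \<Rightarrow> 'n \<Rightarrow> 'n \<Rightarrow> 'n \<Rightarrow> complex ^ 'n \<Rightarrow> real" where
  "defect_Im i m n j Z = Im (Z $ j) - (Re (Z $ i) * Re (Z $ n) - Im (Z $ i) * Re (Z $ m))"

definition ubar :: "'n \<Rightarrow> 'n \<Rightarrow> complex ^ 'n \<Rightarrow> complex" where
  "ubar m n Z = Complex (Re (Z $ m)) (- Re (Z $ n))"

text \<open>The \<open>dw\<close> part of the gradient of \<open>defect_Re\<close>. It carries a
  factor \<open>z\<close>, so near \<open>z = 0\<close> it is absorbed by the gradients of
  \<open>Im w\<close>.\<close>

definition err_Re :: "'n \<Rightarrow> 'n \<Rightarrow> 'n \<Rightarrow> complex ^ 'n \<Rightarrow> complex ^ 'n \<Rightarrow> complex" where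
  "err_Re i m n Z V = Re (Z $ i) * V $ m + Im (Z $ i) * V $ n"

definition err_Im :: "'n \<Rightarrow> 'n \<Rightarrow> 'n \<Rightarrow> complex ^ 'n \<Rightarrow> complex ^ 'n \<Rightarrow> complex" where
  "err_Im i m n Z V = \<i> * (Re (Z $ i) * V $ n - Im (Z $ i) * V $ m)"

lemma jet_defect_Re:
  "jet Z V (defect_Re i m n j) (defect_Re i m n j Z) (V $ j - ubar m n Z * V $ i - err_Re i m n Z V)
    (- 2 * Re (V $ i * cnj (V $ m) - \<i> * V $ i * cnj (V $ n)))"
  unfolding defect_Re_def[abs_def]
  by (rule jet_eq, (rule jet_diff | rule jet_add | rule jet_mult | rule jet_Re | rule jet_Im)+)
    (auto simp: ubar_def err_Re_def complex_eq_iff algebra_simps)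

lemma jet_defect_Im:
  "jet Z V (defect_Im i m n j) (defect_Im i m n j Z) (- \<i> * (V $ j + ubar m n Z * V $ i - err_Im i m n Z V))
    (- 2 * Re (V $ i * cnj (V $ n) + \<i> * V $ i * cnj (V $ m)))"
  unfolding defect_Im_def[abs_def]
  by (rule jet_eq, (rule jet_diff | rule jet_add | rule jet_mult | rule jet_Re | rule jet_Im)+)
    (auto simp: ubar_def err_Im_def complex_eq_iff algebra_simps)

text \<open>Lagrange's identity: the cross terms of the two squares cancel.\<close>

lemma err_sum: "(cmod (err_Re i m n Z V))\<^sup>2 + (cmod (err_Im i m n Z V))\<^sup>2
    = (cmod (Z $ i))\<^sup>2 * ((cmod (V $ m))\<^sup>2 + (cmod (V $ n))\<^sup>2)"
  by (simp add: err_Re_def err_Im_def cmod_power2 norm_mult) (simp add: power2_eq_square algebra_simps)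

lemma lap_bound:
  "\<bar>- 2 * Re (\<alpha> * cnj \<beta> - \<i> * \<alpha> * cnj \<gamma>)\<bar> \<le> 2 * cmod \<alpha> * (cmod \<beta> + cmod \<gamma>)"
  "\<bar>- 2 * Re (\<alpha> * cnj \<gamma> + \<i> * \<alpha> * cnj \<beta>)\<bar> \<le> 2 * cmod \<alpha> * (cmod \<beta> + cmod \<gamma>)"
proof -
  have "\<bar>Re (\<alpha> * cnj \<beta> - \<i> * \<alpha> * cnj \<gamma>)\<bar> \<le> cmod (\<alpha> * cnj \<beta>) + cmod (\<i> * \<alpha> * cnj \<gamma>)"
    by (rule order_trans[OF abs_Re_le_cmod norm_triangle_ineq4])
  then show "\<bar>- 2 * Re (\<alpha> * cnj \<beta> - \<i> * \<alpha> * cnj \<gamma>)\<bar> \<le> 2 * cmod \<alpha> * (cmod \<beta> + cmod \<gamma>)"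
    by (simp add: norm_mult algebra_simps)
  have "\<bar>Re (\<alpha> * cnj \<gamma> + \<i> * \<alpha> * cnj \<beta>)\<bar> \<le> cmod (\<alpha> * cnj \<gamma>) + cmod (\<i> * \<alpha> * cnj \<beta>)"
    by (rule order_trans[OF abs_Re_le_cmod norm_triangle_ineq])
  then show "\<bar>- 2 * Re (\<alpha> * cnj \<gamma> + \<i> * \<alpha> * cnj \<beta>)\<bar> \<le> 2 * cmod \<alpha> * (cmod \<beta> + cmod \<gamma>)"
    by (simp add: norm_mult algebra_simps)
qed

text \<open>Up to a unit factor the gradients of the real and imaginary part of a complex equation
  have the shape \<open>p - q - e\<close> and \<open>p + q - f\<close>. The parallelogram law turns
  the two into separate control of \<open>p\<close> and \<open>q\<close>, because each perturbed
  square keeps half of \<open>|p - q|^2\<close> or \<open>|p + q|^2\<close>.\<close>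

lemma parallelogram_lower_bound:
  fixes p q e f :: complex
  shows "(cmod p)\<^sup>2 + (cmod q)\<^sup>2 - ((cmod e)\<^sup>2 + (cmod f)\<^sup>2) \<le> (cmod (p - q - e))\<^sup>2 + (cmod (p + q - f))\<^sup>2"
proof -
  have half: "(cmod x)\<^sup>2 / 2 - (cmod y)\<^sup>2 \<le> (cmod (x - y))\<^sup>2" for x y :: complex
  proof -
    have "(cmod x)\<^sup>2 \<le> (cmod (x - y) + cmod y)\<^sup>2"
      by (intro power_mono) (use norm_triangle_ineq[of "x - y" y] in auto)
    also have "\<dots> \<le> 2 * (cmod (x - y))\<^sup>2 + 2 * (cmod y)\<^sup>2"
      using sum_squares_bound[of "cmod (x - y)" "cmod y"] by (simp add: power2_sum)
    finally show ?thesis by simp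
  qed
  have "(cmod (p - q))\<^sup>2 + (cmod (p + q))\<^sup>2 = 2 * (cmod p)\<^sup>2 + 2 * (cmod q)\<^sup>2"
    by (simp add: cmod_power2) (simp add: power2_eq_square algebra_simps)
  then show ?thesis using half[of "p - q" e] half[of "p + q" f] by argo
qed

lemma sum_sq_le: "(a + b)\<^sup>2 \<le> 2 * (a\<^sup>2 + b\<^sup>2)" for a b :: real
  using sum_squares_bound[of a b] by (simp add: power2_sum)

section \<open>The blocks with \<open>2 \<le> \<sigma> \<le> k - 1\<close>\<close>

definition block :: "'n \<Rightarrow> 'n \<Rightarrow> 'n \<Rightarrow> 'n \<Rightarrow> complex ^ 'n \<Rightarrow> real" where
  "block i m n j Z = (wsq i (\<lambda>Z. Im (Z $ m)) Z + wsq i (\<lambda>Z. Im (Z $ n)) Z)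
     + (wsq i (defect_Re i m n j) Z + wsq i (defect_Im i m n j) Z)"

text \<open>The squares of the two imaginary parts yield all of \<open>|dw_m|^2 + |dw_n|^2\<close>.
  Half of it is kept; the rest covers the error terms of the two defects and their losses
  \<open>B^2 / 50\<close>.\<close>

lemma block_lower_bound:
  assumes "16 * \<kappa> * (cmod (Z $ i))\<^sup>2 \<le> 1"
  shows "smooth_at (block i m n j) Z"
    and "((cmod (V $ m))\<^sup>2 + (cmod (V $ n))\<^sup>2) / 2 + (cmod (V $ j))\<^sup>2 + (cmod (V $ i))\<^sup>2 *
      ((cmod (ubar m n Z))\<^sup>2 + 2 * \<kappa> * ((Im (Z $ m))\<^sup>2 + (Im (Z $ n))\<^sup>2 + (defect_Re i m n j Z)\<^sup>2 + (defect_Im i m n j Z)\<^sup>2))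
      \<le> lap (block i m n j) Z V"
proof -
  define a b where "a = (cmod (V $ i))\<^sup>2" and "b = (cmod (V $ m))\<^sup>2 + (cmod (V $ n))\<^sup>2"
  let ?B = "cmod (V $ m) + cmod (V $ n)"
  have B: "?B\<^sup>2 \<le> 2 * b" unfolding b_def by (rule sum_sq_le)
  have B0: "?B \<ge> 0" by simp
  note v = wsq_lower_bound[OF jet_Im _ order_refl assms, where V = V]
  note v1 = v[of m] and v2 = v[of n]
  note r = wsq_lower_bound[OF jet_defect_Re[of Z V i m n j] lap_bound(1) B0 assms]
  note s = wsq_lower_bound[OF jet_defect_Im[of Z V i m n j] lap_bound(2) B0 assms]
  show "smooth_at (block i m n j) Z"
    unfolding block_def[abs_def] by (intro smooth_at_add v1(1) v2(1) r(1) s(1)) auto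
  have sum: "lap (block i m n j) Z V = (lap (wsq i (\<lambda>Z. Im (Z $ m))) Z V + lap (wsq i (\<lambda>Z. Im (Z $ n))) Z V)
     + (lap (wsq i (defect_Re i m n j)) Z V + lap (wsq i (defect_Im i m n j)) Z V)"
    unfolding block_def[abs_def] using v1(1) v2(1) r(1) s(1) by (simp add: lap_add smooth_at_add)
  have p: "(cmod (V $ j))\<^sup>2 + (cmod (ubar m n Z))\<^sup>2 * a - (cmod (Z $ i))\<^sup>2 * b \<le>
     (cmod (V $ j - ubar m n Z * V $ i - err_Re i m n Z V))\<^sup>2 + (cmod (- \<i> * (V $ j + ubar m n Z * V $ i - err_Im i m n Z V)))\<^sup>2"
    using parallelogram_lower_bound[of "V $ j" "ubar m n Z * V $ i" "err_Re i m n Z V" "err_Im i m n Z V"] err_sum[of i m n Z V]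
    by (simp add: norm_mult power_mult_distrib a_def b_def)
  have "b \<ge> 0" by (simp add: b_def)
  then have sb: "(cmod (Z $ i))\<^sup>2 * b \<le> 1/10 * b" using assms by (intro mult_right_mono) auto
  have m1: "(cmod (- \<i> * V $ m))\<^sup>2 + 2 * \<kappa> * a * (Im (Z $ m))\<^sup>2 \<le> lap (wsq i (\<lambda>Z. Im (Z $ m))) Z V"
    using v1(2) by (simp add: a_def)
  have m2: "(cmod (- \<i> * V $ n))\<^sup>2 + 2 * \<kappa> * a * (Im (Z $ n))\<^sup>2 \<le> lap (wsq i (\<lambda>Z. Im (Z $ n))) Z V"
    using v2(2) by (simp add: a_def)
  have "b / 2 + (cmod (V $ j))\<^sup>2 + (a * (cmod (ubar m n Z))\<^sup>2 + (2 * \<kappa> * a * (Im (Z $ m))\<^sup>2 + 2 * \<kappa> * a * (Im (Z $ n))\<^sup>2 + 2 * \<kappa> * a * (defect_Re i m n j Z)\<^sup>2 + 2 * \<kappa> * a * (defect_Im i m n j Z)\<^sup>2))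
      \<le> lap (block i m n j) Z V"
  proof -
    have n: "(cmod (- \<i> * V $ m))\<^sup>2 = (cmod (V $ m))\<^sup>2" "(cmod (- \<i> * V $ n))\<^sup>2 = (cmod (V $ n))\<^sup>2"
      "(cmod (V $ m))\<^sup>2 = b - (cmod (V $ n))\<^sup>2"
      by (auto simp: norm_mult b_def)
    show ?thesis
      using m1 m2 r(2)[folded a_def] s(2)[folded a_def] p sb B \<open>b \<ge> 0\<close>
      unfolding sum n mult.commute[of "(cmod (ubar m n Z))\<^sup>2" a] by linarith
  qed
  then show "((cmod (V $ m))\<^sup>2 + (cmod (V $ n))\<^sup>2) / 2 + (cmod (V $ j))\<^sup>2 + (cmod (V $ i))\<^sup>2 *
      ((cmod (ubar m n Z))\<^sup>2 + 2 * \<kappa> * ((Im (Z $ m))\<^sup>2 + (Im (Z $ n))\<^sup>2 + (defect_Re i m n j Z)\<^sup>2 + (defect_Im i m n j Z)\<^sup>2))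
      \<le> lap (block i m n j) Z V"
    unfolding a_def[symmetric] b_def[symmetric] by (simp add: algebra_simps)
qed

section \<open>The block of \<open>\<zeta>\<^sub>k\<close>\<close>

definition last_Re :: "'n \<Rightarrow> 'n \<Rightarrow> complex ^ 'n \<Rightarrow> real" where
  "last_Re i j Z = Re (Z $ j) - ((Re (Z $ i))\<^sup>2 - (Im (Z $ i))\<^sup>2)"

definition last_Im :: "'n \<Rightarrow> 'n \<Rightarrow> complex ^ 'n \<Rightarrow> real" where
  "last_Im i j Z = Im (Z $ j) + 2 * (Re (Z $ i) * Im (Z $ i))"

lemma jet_last_Re: "jet Z V (last_Re i j) (last_Re i j Z) (V $ j - 2 * Z $ i * V $ i - 0) 0"
  unfolding last_Re_def[abs_def]
  by (rule jet_eq, (rule jet_diff | rule jet_square | rule jet_Re | rule jet_Im)+)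
    (auto simp: complex_eq_iff algebra_simps norm_mult)

lemma jet_last_Im: "jet Z V (last_Im i j) (last_Im i j Z) (- \<i> * (V $ j + 2 * Z $ i * V $ i - 0)) 0"
  unfolding last_Im_def[abs_def]
  by (rule jet_eq, (rule jet_add | rule jet_mult | rule jet_const | rule jet_Re | rule jet_Im)+)
    (auto simp: complex_eq_iff algebra_simps)

definition last_block :: "'n \<Rightarrow> 'n \<Rightarrow> complex ^ 'n \<Rightarrow> real" where
  "last_block i j Z = wsq i (last_Re i j) Z + wsq i (last_Im i j) Z"

text \<open>The square of \<open>z\<close>-bar is harmonic, so both Laplacians are 0 and
  \<open>B = 0\<close> is admissible. The gain \<open>4 |z|^2 |dz|^2\<close> comes from
  \<open>q = 2 z dz\<close> in the parallelogram bound.\<close>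

lemma last_block_lower_bound:
  assumes "16 * \<kappa> * (cmod (Z $ i))\<^sup>2 \<le> 1"
  shows "smooth_at (last_block i j) Z"
    and "(cmod (V $ j))\<^sup>2 + (cmod (V $ i))\<^sup>2 * (4 * (cmod (Z $ i))\<^sup>2 + 2 * \<kappa> * ((last_Re i j Z)\<^sup>2 + (last_Im i j Z)\<^sup>2))
      \<le> lap (last_block i j) Z V"
proof -
  have 0: "\<bar>0\<bar> \<le> 2 * cmod (V $ i) * 0" by simp
  note r = wsq_lower_bound[OF jet_last_Re[of Z V i j] 0 order_refl assms]
  note s = wsq_lower_bound[OF jet_last_Im[of Z V i j] 0 order_refl assms]
  show "smooth_at (last_block i j) Z"
    unfolding last_block_def[abs_def] by (intro smooth_at_add r(1) s(1))
  have sum: "lap (last_block i j) Z V = lap (wsq i (last_Re i j)) Z V + lap (wsq i (last_Im i j)) Z V"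
    unfolding last_block_def[abs_def] using r(1) s(1) by (simp add: lap_add)
  have p: "(cmod (V $ j))\<^sup>2 + (cmod (2 * Z $ i * V $ i))\<^sup>2 \<le>
     (cmod (V $ j - 2 * Z $ i * V $ i - 0))\<^sup>2 + (cmod (- \<i> * (V $ j + 2 * Z $ i * V $ i - 0)))\<^sup>2"
    using parallelogram_lower_bound[of "V $ j" "2 * Z $ i * V $ i" 0 0]
    by (simp add: norm_mult)
  show "(cmod (V $ j))\<^sup>2 + (cmod (V $ i))\<^sup>2 * (4 * (cmod (Z $ i))\<^sup>2 + 2 * \<kappa> * ((last_Re i j Z)\<^sup>2 + (last_Im i j Z)\<^sup>2))
      \<le> lap (last_block i j) Z V"
    using r(2) s(2) p unfolding sum by (simp add: norm_mult power_mult_distrib algebra_simps)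
qed

section \<open>The block of \<open>\<zeta>\<^sub>1\<close>\<close>

lemma mult_le_of_small:
  fixes x r m :: real
  assumes "x \<le> r" "0 \<le> m"
  shows "x * m \<le> r * m"
  by (rule mult_right_mono) (use assms in auto)

lemma two_mult_le: "2 * (x * y) \<le> x\<^sup>2 + y\<^sup>2" for x y :: real
  using sum_squares_bound[of x y] by simp

text \<open>Dictionary: \<open>a = |dz|\<close>, \<open>b = |(dw_1, dw_2)|\<close>,
  \<open>s = |z|\<close>, \<open>A = |u_1 + i u_2|\<close>; \<open>F\<close> is
  \<open>first_Re\<close>, with gradient of length \<open>y\<close> and Laplacian \<open>l\<close>;
  \<open>t\<close> is the length of the gradient of \<open>defect_Im\<close>; \<open>C\<close> is
  the cross term of the coefficient \<open>\<kappa> |z|^2 + |u|^2\<close> with \<open>F^2\<close>.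
  The danger is \<open>2 F l\<close>, about \<open>- 8 F a^2\<close>. Multiplied by
  \<open>A^2\<close> it is balanced by \<open>F^2 a^2\<close> from the weight and by
  \<open>A^4 a^2\<close>, which is available because \<open>y\<close> is close to
  \<open>2 A a\<close> up to \<open>t\<close> and small errors. Multiplied by
  \<open>\<kappa> s^2\<close> it costs a little \<open>s^2 a^2\<close>, which stays as a
  deficit.\<close>

lemma first_block_estimate:
  fixes a b s A f t y F l C :: real
  assumes nn: "0 \<le> a" "0 \<le> b" "0 \<le> s" "0 \<le> A" "0 \<le> t" "0 \<le> y" and f: "f = \<bar>F\<bar>"
    and r: "s \<le> 1 / 100000" "A \<le> 1 / 100000" "f \<le> 1 / 100000"
    and y: "y \<le> 2 * A * a + t + 2 * s * a + 2 * s * b" "2 * A * a \<le> y + t + 2 * s * a + 2 * s * b"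
    and l: "\<bar>l + 4 * a\<^sup>2\<bar> \<le> 3 * a * b"
    and C: "\<bar>C\<bar> \<le> 4 * f * y * (2 * \<kappa> * s * a + 2 * A * b)"
  shows "\<kappa> * F\<^sup>2 * a\<^sup>2 + A ^ 4 * a\<^sup>2 - 3 * (s\<^sup>2 * a\<^sup>2) - t\<^sup>2 / 2 - b\<^sup>2 / 4 \<le>
    ((\<kappa> * s\<^sup>2 + A\<^sup>2) * (2 * y\<^sup>2 + 2 * F * l) + F\<^sup>2 * (\<kappa> * (4 * a\<^sup>2) + 2 * b\<^sup>2) + C)
     + (12 * F\<^sup>2 * y\<^sup>2 + 4 * F^3 * l)"
proof -
  let ?r = "1 / 100000 :: real"
  have f0: "0 \<le> f" by (simp add: f)
  define fa sa where "fa = f * a" and "sa = s * a"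
  have nn2: "0 \<le> fa" "0 \<le> sa" using nn f0 by (auto simp: fa_def sa_def)
  have AM: "2 * (fa * sa) \<le> fa\<^sup>2 + sa\<^sup>2" "2 * (fa * t) \<le> fa\<^sup>2 + t\<^sup>2" "2 * (fa * b) \<le> fa\<^sup>2 + b\<^sup>2"
    by (rule two_mult_le)+
  \<comment> \<open>The first half of the cross term \<open>C\<close>. The percentages come from
    \<open>8 * \<kappa> / 100000 = 8/100\<close>.\<close>
  have s1: "8 * \<kappa> * (f * s * a * y) \<le> (8/100) * (fa\<^sup>2 + sa\<^sup>2) + (4/100) * (fa\<^sup>2 + t\<^sup>2) + (16/100) * sa\<^sup>2 + (5/100) * (fa\<^sup>2 + b\<^sup>2)"
  proof -
    have "f * s * a * y \<le> f * s * a * (2 * A * a + t + 2 * s * a + 2 * s * b)"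
      using y(1) nn f0 by (intro mult_left_mono) auto
    also have "\<dots> = 2 * (A * (fa * sa)) + s * (fa * t) + 2 * (f * sa\<^sup>2) + 2 * (s * (s * (fa * b)))"
      by (simp add: fa_def sa_def power2_eq_square algebra_simps)
    also have "\<dots> \<le> 2 * (?r * (fa * sa)) + ?r * (fa * t) + 2 * (?r * sa\<^sup>2) + 2 * (?r * (?r * (fa * b)))"
    proof -
      have "s * (s * (fa * b)) \<le> ?r * (?r * (fa * b))"
        using r nn nn2 by (intro mult_mono) auto
      then show ?thesis
        using mult_le_of_small[OF r(2), of "fa * sa"] mult_le_of_small[OF r(1), of "fa * t"]
          mult_le_of_small[OF r(3), of "sa\<^sup>2"] nn nn2 by (simp del: times_divide_eq_left times_divide_eq_right mult_1_left mult.left_commute mult.commute)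
    qed
    finally have le: "f * s * a * y \<le> \<dots>" .
    \<comment> \<open>Stated for fresh variables, so that the products become atoms of a linear
      problem.\<close>
    have "8 * \<kappa> * X \<le> (8/100) * (\<alpha> + u) + (4/100) * (\<alpha> + \<tau>) + (16/100) * u + (5/100) * (\<alpha> + \<beta>)"
      if "X \<le> 2 * (?r * p) + ?r * q + 2 * (?r * u) + 2 * (?r * (?r * w))" "2 * p \<le> \<alpha> + u" "2 * q \<le> \<alpha> + \<tau>"
        "2 * w \<le> \<alpha> + \<beta>" "0 \<le> \<alpha>" "0 \<le> \<beta>" for X p q u w \<alpha> \<beta> \<tau> :: real
      using that by (simp add: field_simps)
    from this[OF le AM zero_le_power2 zero_le_power2] show ?thesis .
  qed
  \<comment> \<open>The second half of \<open>C\<close>, charged to one of the two copies of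
    \<open>A^2 y^2\<close>.\<close>
  have s2: "8 * (f * A * b * y) \<le> A\<^sup>2 * y\<^sup>2 + (1/100) * b\<^sup>2"
  proof -
    have "2 * ((A * y) * (4 * f * b)) \<le> (A * y)\<^sup>2 + (4 * f * b)\<^sup>2" by (rule two_mult_le)
    moreover have "f\<^sup>2 * b\<^sup>2 \<le> 1 / 1600 * b\<^sup>2"
    proof (rule mult_le_of_small)
      have "f\<^sup>2 \<le> ?r\<^sup>2" using r f0 by (intro power_mono) auto
      then show "f\<^sup>2 \<le> 1/1600" by (simp add: power_divide)
    qed simp
    ultimately show ?thesis by (simp add: power_mult_distrib mult_ac power_divide)
  qed
  have Fl: "- (f * (4 * a\<^sup>2 + 3 * a * b)) \<le> F * l"
  proof -
    have "\<bar>l\<bar> \<le> 4 * a\<^sup>2 + 3 * a * b" using l zero_le_power2[of a] unfolding abs_le_iff by linarith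
    then have "\<bar>F * l\<bar> \<le> f * (4 * a\<^sup>2 + 3 * a * b)"
      unfolding abs_mult f by (intro mult_left_mono) auto
    then show ?thesis by linarith
  qed
  have f2: "F\<^sup>2 = f\<^sup>2" by (simp add: f)
  \<comment> \<open>The term \<open>8 A^2 F a^2\<close> is split as twice \<open>A^2 a\<close> times
    \<open>4 F a\<close>, giving \<open>A^4 a^2\<close> and \<open>16 F^2 a^2\<close>; the remaining
    parts are small.\<close>
  have s3: "- ((8/100) * sa\<^sup>2 + A^4 * a\<^sup>2 + 16 * fa\<^sup>2 + (5/100) * (fa\<^sup>2 + b\<^sup>2)) \<le> (\<kappa> * s\<^sup>2 + A\<^sup>2) * (2 * F * l)"
  proof -
    define M where "M = \<kappa> * s\<^sup>2 + A\<^sup>2"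
    have M0: "0 \<le> M" by (simp add: M_def)
    have 1: "M * (2 * (- (f * (4 * a\<^sup>2 + 3 * a * b)))) \<le> M * (2 * F * l)"
      using mult_left_mono[OF Fl, of "2 * M"] M0 by (simp add: mult_ac)
    have 2: "M * (2 * (- (f * (4 * a\<^sup>2 + 3 * a * b))))
        = - (8 * \<kappa> * (f * sa\<^sup>2) + 2 * ((A\<^sup>2 * a) * (4 * fa)) + 6 * (M * (fa * b)))"
      by (simp add: M_def fa_def sa_def power2_eq_square algebra_simps)
    have 3: "f * sa\<^sup>2 \<le> ?r * sa\<^sup>2" by (rule mult_le_of_small[OF r(3)]) simp
    have "2 * ((A\<^sup>2 * a) * (4 * fa)) \<le> (A\<^sup>2 * a)\<^sup>2 + (4 * fa)\<^sup>2" by (rule two_mult_le)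
    then have 4: "2 * ((A\<^sup>2 * a) * (4 * fa)) \<le> A^4 * a\<^sup>2 + 16 * fa\<^sup>2" by (simp add: power_mult_distrib)
    have 5: "M * (fa * b) \<le> 1/100 * (fa * b)"
    proof (rule mult_le_of_small)
      have "s\<^sup>2 \<le> ?r\<^sup>2" "A\<^sup>2 \<le> ?r\<^sup>2" using r nn by (auto intro!: power_mono)
      then show "M \<le> 1/100" by (simp add: M_def power_divide)
    qed (use nn nn2 in simp)
    have "- ((8/100) * u + q + 16 * \<alpha> + (5/100) * (\<alpha> + \<beta>)) \<le> Y"
      if "X \<le> Y" "X = - (8 * \<kappa> * p + P + 6 * R)" "p \<le> ?r * u" "P \<le> q + 16 * \<alpha>" "R \<le> 1/100 * w" "2 * w \<le> \<alpha> + \<beta>"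
        "0 \<le> \<alpha>" "0 \<le> \<beta>" for u q \<alpha> \<beta> X Y p P R w :: real
      using that by (simp add: field_simps)
    from this[OF 1 2 3 4 5 AM(3) zero_le_power2 zero_le_power2] show ?thesis unfolding M_def .
  qed
  have s4: "- (fa\<^sup>2 + (5/100) * (fa\<^sup>2 + b\<^sup>2)) \<le> 4 * F^3 * l"
  proof -
    have 1: "F\<^sup>2 * (- (f * (4 * a\<^sup>2 + 3 * a * b))) \<le> F\<^sup>2 * (F * l)"
      by (intro mult_left_mono Fl) auto
    have 2: "F\<^sup>2 * (- (f * (4 * a\<^sup>2 + 3 * a * b))) = - (4 * (f * fa\<^sup>2) + 3 * (f\<^sup>2 * (fa * b)))"
      unfolding f2 by (simp add: fa_def power2_eq_square algebra_simps)
    have 3: "f * fa\<^sup>2 \<le> ?r * fa\<^sup>2" by (rule mult_le_of_small[OF r(3)]) simp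
    have 4: "f\<^sup>2 * (fa * b) \<le> 1/1000 * (fa * b)"
    proof (rule mult_le_of_small)
      have "f\<^sup>2 \<le> ?r\<^sup>2" using r f0 by (intro power_mono) auto
      then show "f\<^sup>2 \<le> 1/1000" by (simp add: power_divide)
    qed (use nn nn2 in auto)
    have 5: "4 * F^3 * l = 4 * (F\<^sup>2 * (F * l))" by (simp add: power3_eq_cube power2_eq_square)
    have "- (\<alpha> + (5/100) * (\<alpha> + \<beta>)) \<le> Z"
      if "X \<le> Y" "X = - (4 * p + 3 * q)" "p \<le> ?r * \<alpha>" "q \<le> 1/1000 * w" "Z = 4 * Y" "2 * w \<le> \<alpha> + \<beta>"
        "0 \<le> \<alpha>" "0 \<le> \<beta>" for \<alpha> \<beta> X Y Z p q w :: real
      using that by (simp add: field_simps)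
    from this[OF 1 2 3 4 5 AM(3) zero_le_power2 zero_le_power2] show ?thesis .
  qed
  \<comment> \<open>The other copy of \<open>A^2 y^2\<close> yields \<open>2 A^4 a^2\<close>, of
    which the preceding estimates use one half.\<close>
  have s5: "2 * A^4 * a\<^sup>2 - (1/100) * (t\<^sup>2 + sa\<^sup>2 + b\<^sup>2) \<le> A\<^sup>2 * y\<^sup>2"
  proof -
    define e where "e = t + 2 * s * a + 2 * s * b"
    have e0: "0 \<le> e" using nn by (auto simp: e_def)
    have "(2 * A * a)\<^sup>2 \<le> (y + e)\<^sup>2" using y(2) nn by (intro power_mono) (auto simp: e_def)
    also have "\<dots> \<le> 2 * (y\<^sup>2 + e\<^sup>2)" by (rule sum_sq_le)
    finally have 1: "2 * (A\<^sup>2 * a\<^sup>2) - e\<^sup>2 \<le> y\<^sup>2" by (simp add: power_mult_distrib)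
    have "e\<^sup>2 \<le> 2 * ((t + 2 * s * a)\<^sup>2 + (2 * s * b)\<^sup>2)" unfolding e_def by (rule sum_sq_le)
    moreover have "(t + 2 * s * a)\<^sup>2 \<le> 2 * (t\<^sup>2 + (2 * s * a)\<^sup>2)" by (rule sum_sq_le)
    moreover have "(2 * s * a)\<^sup>2 = 4 * sa\<^sup>2" by (simp add: sa_def power_mult_distrib)
    moreover have "(2 * s * b)\<^sup>2 \<le> 4 * b\<^sup>2"
    proof -
      have "s\<^sup>2 * b\<^sup>2 \<le> 1 * b\<^sup>2"
        using r(1) nn by (intro mult_right_mono) (auto simp: power_le_one)
      then show ?thesis by (simp add: power_mult_distrib)
    qed
    moreover have "x \<le> 16 * (\<tau> + u + \<beta>)"
      if "x \<le> 2 * (p + q)" "p \<le> 2 * (\<tau> + w)" "w = 4 * u" "q \<le> 4 * \<beta>" "0 \<le> \<tau>" "0 \<le> \<beta>"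
      for x p q \<tau> u w \<beta> :: real
      using that by argo
    ultimately have 2: "e\<^sup>2 \<le> 16 * (t\<^sup>2 + sa\<^sup>2 + b\<^sup>2)" by (meson zero_le_power2)
    have "A\<^sup>2 \<le> ?r\<^sup>2" using r nn by (intro power_mono) auto
    then have "A\<^sup>2 \<le> 1/1600" by (simp add: power_divide)
    then have "A\<^sup>2 * e\<^sup>2 \<le> 1/1600 * (16 * (t\<^sup>2 + sa\<^sup>2 + b\<^sup>2))" by (intro mult_mono 2) auto
    then have 3: "A\<^sup>2 * e\<^sup>2 \<le> (1/100) * (t\<^sup>2 + sa\<^sup>2 + b\<^sup>2)" by simp
    have "A\<^sup>2 * (2 * (A\<^sup>2 * a\<^sup>2) - e\<^sup>2) \<le> A\<^sup>2 * y\<^sup>2" by (intro mult_left_mono 1) auto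
    moreover have "A\<^sup>2 * (2 * (A\<^sup>2 * a\<^sup>2) - e\<^sup>2) = 2 * A^4 * a\<^sup>2 - A\<^sup>2 * e\<^sup>2"
      by (simp add: power4_eq_xxxx power2_eq_square algebra_simps)
    ultimately show ?thesis using 3 by linarith
  qed
  have Cb: "- (8 * \<kappa> * (f * s * a * y) + 8 * (f * A * b * y)) \<le> C"
  proof -
    have "4 * f * y * (2 * \<kappa> * s * a + 2 * A * b) = 8 * \<kappa> * (f * s * a * y) + 8 * (f * A * b * y)"
      by (simp add: algebra_simps)
    then show ?thesis using C by linarith
  qed
  have pos: "0 \<le> s\<^sup>2 * y\<^sup>2" "0 \<le> F\<^sup>2 * b\<^sup>2" "0 \<le> F\<^sup>2 * y\<^sup>2" "0 \<le> fa\<^sup>2" "0 \<le> sa\<^sup>2" "0 \<le> b\<^sup>2" "0 \<le> t\<^sup>2" by auto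
  have "((\<kappa> * s\<^sup>2 + A\<^sup>2) * (2 * y\<^sup>2 + 2 * F * l) + F\<^sup>2 * (\<kappa> * (4 * a\<^sup>2) + 2 * b\<^sup>2) + C) + (12 * F\<^sup>2 * y\<^sup>2 + 4 * F^3 * l)
    = 2 * \<kappa> * (s\<^sup>2 * y\<^sup>2) + 2 * (A\<^sup>2 * y\<^sup>2) + (\<kappa> * s\<^sup>2 + A\<^sup>2) * (2 * F * l) + 4 * \<kappa> * fa\<^sup>2 + 2 * (F\<^sup>2 * b\<^sup>2) + C
      + 12 * (F\<^sup>2 * y\<^sup>2) + 4 * F^3 * l"
    by (simp add: f2 fa_def power_mult_distrib algebra_simps)
  moreover have "\<kappa> * F\<^sup>2 * a\<^sup>2 = \<kappa> * fa\<^sup>2" "s\<^sup>2 * a\<^sup>2 = sa\<^sup>2" "2 * A^4 * a\<^sup>2 = 2 * (A^4 * a\<^sup>2)"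
    by (auto simp: f2 fa_def sa_def power_mult_distrib)
  moreover have "\<kappa> * \<alpha> + q - 3 * u - \<tau> / 2 - \<beta> / 4 \<le>
      2 * \<kappa> * sy + 2 * Ay + ml + 4 * \<kappa> * \<alpha> + 2 * Fb + C' + 12 * Fy + F3"
    if "8 * \<kappa> * x1 \<le> (8/100) * (\<alpha> + u) + (4/100) * (\<alpha> + \<tau>) + (16/100) * u + (5/100) * (\<alpha> + \<beta>)"
      "8 * x2 \<le> Ay + (1/100) * \<beta>" "- ((8/100) * u + q + 16 * \<alpha> + (5/100) * (\<alpha> + \<beta>)) \<le> ml"
      "- (\<alpha> + (5/100) * (\<alpha> + \<beta>)) \<le> F3" "2 * q - (1/100) * (\<tau> + u + \<beta>) \<le> Ay"
      "- (8 * \<kappa> * x1 + 8 * x2) \<le> C'" "0 \<le> sy" "0 \<le> Fb" "0 \<le> Fy" "0 \<le> \<alpha>" "0 \<le> u" "0 \<le> \<beta>" "0 \<le> \<tau>"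
    for \<alpha> \<beta> \<tau> u q x1 x2 Ay ml F3 C' sy Fb Fy :: real
    using that by (simp add: field_simps)
  note this[OF s1 s2 s3 s4 _ Cb pos]
  ultimately show ?thesis using s5 by simp
qed

definition first_Re :: "'n \<Rightarrow> 'n \<Rightarrow> 'n \<Rightarrow> 'n \<Rightarrow> complex ^ 'n \<Rightarrow> real" where
  "first_Re i m n j Z = defect_Re i m n j Z - nsq i Z"

text \<open>Near the origin \<open>(Re (\<zeta>\<^sub>1 - \<bar>z\<bar>\<^sup>2 - \<dots>))\<^sup>2\<close> must not enter with a nonzero constant coefficient: the
  Laplacian \<open>- 4 \<bar>dz\<bar>\<^sup>2\<close> of the base would give a Levi form that is negative on one side of the model.
  Hence this square appears only with coefficients that vanish at the origin.\<close>

definition first_block :: "'n \<Rightarrow> 'n \<Rightarrow> 'n \<Rightarrow> 'n \<Rightarrow> complex ^ 'n \<Rightarrow> real" where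
  "first_block i m n j Z = (wsq i (\<lambda>Z. Im (Z $ m)) Z + wsq i (\<lambda>Z. Im (Z $ n)) Z + wsq i (defect_Im i m n j) Z)
     + ((\<kappa> * nsq i Z + ((Re (Z $ m))\<^sup>2 + (Re (Z $ n))\<^sup>2)) * (first_Re i m n j Z)\<^sup>2 + ((first_Re i m n j Z)\<^sup>2)\<^sup>2)"

lemma jet_first_Re:
  "jet Z V (first_Re i m n j) (first_Re i m n j Z)
    (V $ j - ubar m n Z * V $ i - err_Re i m n Z V - 2 * (cnj (Z $ i) * V $ i))
    (- 2 * Re (V $ i * cnj (V $ m) - \<i> * V $ i * cnj (V $ n)) - 4 * (cmod (V $ i))\<^sup>2)"
  unfolding first_Re_def[abs_def] by (rule jet_eq, rule jet_diff[OF jet_defect_Re jet_nsq]) (simp_all add: nsq_eq)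

lemma first_block_lower_bound:
  assumes small: "cmod (Z $ i) \<le> 1 / 100000" "cmod (ubar m n Z) \<le> 1 / 100000" "\<bar>first_Re i m n j Z\<bar> \<le> 1 / 100000"
  shows "smooth_at (first_block i m n j) Z"
    and "((cmod (V $ m))\<^sup>2 + (cmod (V $ n))\<^sup>2) / 2 + (cmod (V $ j + ubar m n Z * V $ i - err_Im i m n Z V))\<^sup>2 / 2
      + (cmod (V $ i))\<^sup>2 * (2 * \<kappa> * ((Im (Z $ m))\<^sup>2 + (Im (Z $ n))\<^sup>2 + (defect_Im i m n j Z)\<^sup>2)
        + \<kappa> * (first_Re i m n j Z)\<^sup>2 + cmod (ubar m n Z) ^ 4 - 3 * (cmod (Z $ i))\<^sup>2)
      \<le> lap (first_block i m n j) Z V"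
proof -
  define a b s A t where "a = cmod (V $ i)" and "b = sqrt ((cmod (V $ m))\<^sup>2 + (cmod (V $ n))\<^sup>2)"
    and "s = cmod (Z $ i)" and "A = cmod (ubar m n Z)" and "t = cmod (V $ j + ubar m n Z * V $ i - err_Im i m n Z V)"
  define dF lF where "dF = V $ j - ubar m n Z * V $ i - err_Re i m n Z V - 2 * (cnj (Z $ i) * V $ i)"
    and "lF = - 2 * Re (V $ i * cnj (V $ m) - \<i> * V $ i * cnj (V $ n)) - 4 * (cmod (V $ i))\<^sup>2"
  define y F where "y = cmod dF" and "F = first_Re i m n j Z"
  define P where "P = (\<lambda>Z::complex^'a. (Re (Z $ m))\<^sup>2 + (Re (Z $ n))\<^sup>2)"
  define dP where "dP = 2 * (Re (Z $ m) * V $ m + Re (Z $ n) * V $ n)"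
  have b2: "b\<^sup>2 = (cmod (V $ m))\<^sup>2 + (cmod (V $ n))\<^sup>2" by (simp add: b_def)
  have nn: "0 \<le> a" "0 \<le> b" "0 \<le> s" "0 \<le> A" "0 \<le> t" "0 \<le> y"
    by (auto simp: a_def b_def s_def A_def t_def y_def)
  have sm: "16 * \<kappa> * (cmod (Z $ i))\<^sup>2 \<le> 1"
  proof -
    have "(cmod (Z $ i))\<^sup>2 \<le> (1 / 100000)\<^sup>2" by (intro power_mono small(1)) auto
    then show ?thesis by (simp add: power_divide)
  qed
  let ?B = "cmod (V $ m) + cmod (V $ n)"
  have B: "?B\<^sup>2 \<le> 2 * b\<^sup>2" unfolding b2 by (rule sum_sq_le)
  have B0: "?B \<ge> 0" by simp
  have B': "2 * ?B \<le> 3 * b"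
  proof (rule power2_le_imp_le)
    have "4 * ?B\<^sup>2 \<le> 9 * b\<^sup>2" using B zero_le_power2[of b] by linarith
    then show "(2 * ?B)\<^sup>2 \<le> (3 * b)\<^sup>2" unfolding power_mult_distrib by simp
  qed (use nn in simp)
  have 0: "\<bar>0\<bar> \<le> 2 * cmod (V $ i) * 0" by simp
  note v1 = wsq_lower_bound[OF jet_Im[of Z V m] 0 order_refl sm]
  note v2 = wsq_lower_bound[OF jet_Im[of Z V n] 0 order_refl sm]
  note g = wsq_lower_bound[OF jet_defect_Im[of Z V i m n j] lap_bound(2) B0 sm]
  have jF: "jet Z V (first_Re i m n j) F dF lF"
    unfolding F_def dF_def lF_def by (rule jet_first_Re)
  have jP: "jet Z V P (A\<^sup>2) dP (2 * b\<^sup>2)"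
    unfolding P_def dP_def b2 A_def
    by (rule jet_eq, (rule jet_add | rule jet_square | rule jet_Re)+)
      (auto simp: ubar_def cmod_power2 algebra_simps)
  define R where "R = (\<lambda>Z. (\<kappa> * nsq i Z + P Z) * (first_Re i m n j Z)\<^sup>2 + ((first_Re i m n j Z)\<^sup>2)\<^sup>2)"
  define C where "C = 2 * Re ((\<kappa> * (2 * (cnj (Z $ i) * V $ i)) + dP) * cnj (2 * complex_of_real F * dF))"
  have "jet Z V (\<lambda>Z. \<kappa> * nsq i Z) (\<kappa> * s\<^sup>2) (\<kappa> * (2 * (cnj (Z $ i) * V $ i))) (\<kappa> * (4 * a\<^sup>2))"
    unfolding s_def a_def by (rule jet_cmult[OF jet_nsq])
  note jR = jet_add[OF jet_mult[OF jet_add[OF this jP] jet_square[OF jF]] jet_square[OF jet_square[OF jF]],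
      folded R_def C_def y_def]
  have "(cmod (2 * complex_of_real F * dF))\<^sup>2 = 4 * (F\<^sup>2 * y\<^sup>2)"
    by (simp add: norm_mult power_mult_distrib y_def)
  with jR have lapR: "lap R Z V = ((\<kappa> * s\<^sup>2 + A\<^sup>2) * (2 * y\<^sup>2 + 2 * F * lF) + F\<^sup>2 * (\<kappa> * (4 * a\<^sup>2) + 2 * b\<^sup>2) + C)
     + (2 * (4 * (F\<^sup>2 * y\<^sup>2)) + 2 * F\<^sup>2 * (2 * y\<^sup>2 + 2 * F * lF))"
    unfolding jet_def by metis
  also have "2 * (4 * (F\<^sup>2 * y\<^sup>2)) + 2 * F\<^sup>2 * (2 * y\<^sup>2 + 2 * F * lF) = 12 * F\<^sup>2 * y\<^sup>2 + 4 * F^3 * lF"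
    by (simp add: power2_eq_square power3_eq_cube algebra_simps)
  finally have lapR: "lap R Z V = ((\<kappa> * s\<^sup>2 + A\<^sup>2) * (2 * y\<^sup>2 + 2 * F * lF) + F\<^sup>2 * (\<kappa> * (4 * a\<^sup>2) + 2 * b\<^sup>2) + C)
     + (12 * F\<^sup>2 * y\<^sup>2 + 4 * F^3 * lF)" .
  have sv: "smooth_at (wsq i (\<lambda>Z. Im (Z $ m))) Z" "smooth_at (wsq i (\<lambda>Z. Im (Z $ n))) Z"
    "smooth_at (wsq i (defect_Im i m n j)) Z" "smooth_at R Z"
    using v1(1) v2(1) g(1) jR[unfolded jet_def, THEN conjunct1] by blast+
  have eq: "first_block i m n j = (\<lambda>Z. (wsq i (\<lambda>Z. Im (Z $ m)) Z + wsq i (\<lambda>Z. Im (Z $ n)) Z + wsq i (defect_Im i m n j) Z) + R Z)"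
    by (simp add: first_block_def[abs_def] R_def P_def)
  show "smooth_at (first_block i m n j) Z"
    unfolding eq by (intro smooth_at_add sv)
  have sum: "lap (first_block i m n j) Z V = lap (wsq i (\<lambda>Z. Im (Z $ m))) Z V + lap (wsq i (\<lambda>Z. Im (Z $ n))) Z V
     + lap (wsq i (defect_Im i m n j)) Z V + lap R Z V"
    unfolding eq using sv by (simp add: lap_add smooth_at_add)
  have err: "cmod (err_Re i m n Z V) \<le> s * b" "cmod (err_Im i m n Z V) \<le> s * b"
  proof -
    have "(cmod (err_Re i m n Z V))\<^sup>2 + (cmod (err_Im i m n Z V))\<^sup>2 = (s * b)\<^sup>2"
      by (simp add: err_sum s_def power_mult_distrib b2)
    then have "(cmod (err_Re i m n Z V))\<^sup>2 \<le> (s * b)\<^sup>2" "(cmod (err_Im i m n Z V))\<^sup>2 \<le> (s * b)\<^sup>2"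
      using zero_le_power2[of "cmod (err_Re i m n Z V)"] zero_le_power2[of "cmod (err_Im i m n Z V)"] by linarith+
    then show "cmod (err_Re i m n Z V) \<le> s * b" "cmod (err_Im i m n Z V) \<le> s * b"
      using nn by (auto intro: power2_le_imp_le)
  qed
  \<comment> \<open>Up to unit factors, the gradients of \<open>defect_Im\<close> and
    \<open>first_Re\<close> differ by \<open>2 * ubar * dz\<close> plus terms with a factor
    \<open>z\<close> or its conjugate. This links \<open>y\<close> and \<open>t\<close> to
    \<open>A * a\<close>.\<close>
  define q where "q = (V $ j + ubar m n Z * V $ i - err_Im i m n Z V) - dF"
  have q: "q = 2 * (ubar m n Z * V $ i) + (err_Re i m n Z V - err_Im i m n Z V + 2 * (cnj (Z $ i) * V $ i))"
    by (simp add: q_def dF_def)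
  have e: "cmod (err_Re i m n Z V - err_Im i m n Z V + 2 * (cnj (Z $ i) * V $ i)) \<le> 2 * s * b + 2 * s * a"
    using norm_triangle_ineq[of "err_Re i m n Z V - err_Im i m n Z V" "2 * (cnj (Z $ i) * V $ i)"]
      norm_triangle_ineq4[of "err_Re i m n Z V" "err_Im i m n Z V"] err
    by (simp add: norm_mult s_def a_def)
  have q1: "cmod q \<le> 2 * A * a + (2 * s * b + 2 * s * a)"
    unfolding q using e norm_triangle_ineq[of "2 * (ubar m n Z * V $ i)" "err_Re i m n Z V - err_Im i m n Z V + 2 * (cnj (Z $ i) * V $ i)"]
    by (simp add: norm_mult A_def a_def)
  have q2: "2 * A * a \<le> cmod q + (2 * s * b + 2 * s * a)"
    unfolding q using e norm_diff_ineq[of "2 * (ubar m n Z * V $ i)" "err_Re i m n Z V - err_Im i m n Z V + 2 * (cnj (Z $ i) * V $ i)"]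
    by (simp add: norm_mult A_def a_def)
  have q3: "y \<le> t + cmod q" "cmod q \<le> t + y"
    using norm_triangle_ineq4[of "V $ j + ubar m n Z * V $ i - err_Im i m n Z V" q]
      norm_triangle_ineq4[of "V $ j + ubar m n Z * V $ i - err_Im i m n Z V" dF]
    by (auto simp: q_def y_def t_def)
  have main: "\<kappa> * F\<^sup>2 * a\<^sup>2 + A ^ 4 * a\<^sup>2 - 3 * (s\<^sup>2 * a\<^sup>2) - t\<^sup>2 / 2 - b\<^sup>2 / 4 \<le> lap R Z V"
  proof -
    have "\<bar>lF + 4 * a\<^sup>2\<bar> \<le> 3 * a * b"
    proof -
      have "\<bar>lF + 4 * a\<^sup>2\<bar> \<le> 2 * a * ?B"
        using lap_bound(1)[of "V $ i" "V $ m" "V $ n"] by (simp add: lF_def a_def)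
      also have "\<dots> \<le> a * (3 * b)" using mult_left_mono[OF B' nn(1)] by (simp add: mult_ac)
      finally show ?thesis by (simp add: mult_ac)
    qed
    moreover have "\<bar>C\<bar> \<le> 4 * \<bar>F\<bar> * y * (2 * \<kappa> * s * a + 2 * A * b)"
    proof -
      have "cmod dP \<le> 2 * A * b"
      proof -
        have "(cmod dP)\<^sup>2 = 4 * (cmod (Re (Z $ m) * V $ m + Re (Z $ n) * V $ n))\<^sup>2"
          unfolding dP_def norm_mult power_mult_distrib by simp
        \<comment> \<open>Lagrange's identity with the real vector \<open>(u_1, u_2)\<close>;
          dropping the subtracted square gives the Cauchy-Schwarz bound.\<close>
        also have "\<dots> = 4 * (A\<^sup>2 * b\<^sup>2 - (cmod (Re (Z $ m) * V $ n - Re (Z $ n) * V $ m))\<^sup>2)"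
          unfolding b2 A_def ubar_def by (simp add: cmod_power2) (simp add: power2_eq_square algebra_simps)
        also have "\<dots> \<le> (2 * A * b)\<^sup>2" by (simp add: power_mult_distrib)
        finally show ?thesis by (rule power2_le_imp_le) (use nn in auto)
      qed
      then have "cmod (\<kappa> * (2 * (cnj (Z $ i) * V $ i)) + dP) \<le> 2 * \<kappa> * s * a + 2 * A * b"
        using norm_triangle_ineq[of "\<kappa> * (2 * (cnj (Z $ i) * V $ i))" dP] by (simp add: norm_mult s_def a_def)
      then have "cmod (\<kappa> * (2 * (cnj (Z $ i) * V $ i)) + dP) * cmod (cnj (2 * complex_of_real F * dF)) \<le> (2 * \<kappa> * s * a + 2 * A * b) * (2 * \<bar>F\<bar> * y)"
        by (intro mult_mono) (auto simp: norm_mult y_def nn)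
      from mult_left_mono[OF this, of 2] have "2 * (cmod (\<kappa> * (2 * (cnj (Z $ i) * V $ i)) + dP) * cmod (cnj (2 * complex_of_real F * dF)))
          \<le> 4 * \<bar>F\<bar> * y * (2 * \<kappa> * s * a + 2 * A * b)" by (simp add: mult_ac)
      moreover have "\<bar>C\<bar> \<le> 2 * (cmod (\<kappa> * (2 * (cnj (Z $ i) * V $ i)) + dP) * cmod (cnj (2 * complex_of_real F * dF)))"
        using abs_Re_le_cmod[of "(\<kappa> * (2 * (cnj (Z $ i) * V $ i)) + dP) * cnj (2 * complex_of_real F * dF)"]
        unfolding C_def abs_mult norm_mult[symmetric] by simp
      ultimately show ?thesis by (rule order_trans[rotated])
    qed
    ultimately show ?thesis
      using first_block_estimate[OF nn refl _ _ _ _ _, of F lF C] small q1 q2 q3 lapR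
      by (simp add: s_def[symmetric] A_def[symmetric] F_def[symmetric])
  qed
  have n: "(cmod (- \<i> * V $ m))\<^sup>2 + (cmod (- \<i> * V $ n))\<^sup>2 = b\<^sup>2"
      "(cmod (- \<i> * (V $ j + ubar m n Z * V $ i - err_Im i m n Z V)))\<^sup>2 = t\<^sup>2"
    by (auto simp: norm_mult b2 t_def)
  have 1: "(cmod (- \<i> * V $ m))\<^sup>2 + 2 * \<kappa> * a\<^sup>2 * (Im (Z $ m))\<^sup>2 \<le> lap (wsq i (\<lambda>Z. Im (Z $ m))) Z V"
    "(cmod (- \<i> * V $ n))\<^sup>2 + 2 * \<kappa> * a\<^sup>2 * (Im (Z $ n))\<^sup>2 \<le> lap (wsq i (\<lambda>Z. Im (Z $ n))) Z V"
    using v1(2) v2(2) by (auto simp: a_def)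
  have 2: "t\<^sup>2 + 2 * \<kappa> * a\<^sup>2 * (defect_Im i m n j Z)\<^sup>2 - ?B\<^sup>2 / 50 \<le> lap (wsq i (defect_Im i m n j)) Z V"
    using g(2) unfolding n(2) by (simp add: a_def)
  have "b\<^sup>2 / 2 + t\<^sup>2 / 2 + (2 * \<kappa> * a\<^sup>2 * (Im (Z $ m))\<^sup>2 + 2 * \<kappa> * a\<^sup>2 * (Im (Z $ n))\<^sup>2 + 2 * \<kappa> * a\<^sup>2 * (defect_Im i m n j Z)\<^sup>2
       + \<kappa> * F\<^sup>2 * a\<^sup>2 + A ^ 4 * a\<^sup>2 - 3 * (s\<^sup>2 * a\<^sup>2)) \<le> lap (first_block i m n j) Z V"
    using main 1 2 B n(1) zero_le_power2[of b] unfolding sum by linarith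
  then show "((cmod (V $ m))\<^sup>2 + (cmod (V $ n))\<^sup>2) / 2 + (cmod (V $ j + ubar m n Z * V $ i - err_Im i m n Z V))\<^sup>2 / 2
      + (cmod (V $ i))\<^sup>2 * (2 * \<kappa> * ((Im (Z $ m))\<^sup>2 + (Im (Z $ n))\<^sup>2 + (defect_Im i m n j Z)\<^sup>2)
        + \<kappa> * (first_Re i m n j Z)\<^sup>2 + cmod (ubar m n Z) ^ 4 - 3 * (cmod (Z $ i))\<^sup>2)
      \<le> lap (first_block i m n j) Z V"
    unfolding b2[symmetric] t_def[symmetric] a_def[symmetric] s_def[symmetric] A_def[symmetric] F_def[symmetric]
    by (simp add: algebra_simps)
qed

section \<open>The potential of the model and its zero set\<close>

definition model_potential :: "nat \<Rightarrow> (nat \<Rightarrow> 'n) \<Rightarrow> complex ^ 'n \<Rightarrow> real" where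
  "model_potential k c Z =
     (\<Sum>\<sigma>\<in>{2..k - 1}. block (c 0) (c (2 * \<sigma> - 1)) (c (2 * \<sigma>)) (c (2 * k - 2 + \<sigma>)) Z)
     + (last_block (c 0) (c (2 * k - 2 + k)) Z + first_block (c 0) (c 1) (c 2) (c (2 * k - 2 + 1)) Z)"

text \<open>These are the three quantities whose smallness the block estimates use; the other
  coordinates are only restricted through them.\<close>

definition model_nbhd :: "nat \<Rightarrow> (nat \<Rightarrow> 'n) \<Rightarrow> (complex ^ 'n) set" where
  "model_nbhd k c = {Z. cmod (Z $ c 0) < 1 / 100000 \<and> cmod (ubar (c 1) (c 2) Z) < 1 / 100000
     \<and> \<bar>first_Re (c 0) (c 1) (c 2) (c (2 * k - 2 + 1)) Z\<bar> < 1 / 100000}"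

lemma open_model_nbhd: "open (model_nbhd k c :: (complex ^ 'n::finite) set)"
  unfolding model_nbhd_def first_Re_def defect_Re_def nsq_def ubar_def Complex_eq
  by (intro open_Collect_conj open_Collect_less continuous_intros)

lemma zero_in_model_nbhd: "0 \<in> model_nbhd k c"
  by (simp add: model_nbhd_def first_Re_def defect_Re_def nsq_def ubar_def zero_complex.code[symmetric])

lemma wsq_nonneg: "wsq i h Z \<ge> 0"
  and wsq_eq_0_iff: "wsq i h Z = 0 \<longleftrightarrow> h Z = 0"
proof -
  have "1 + \<kappa> * nsq i Z > 0" by (simp add: nsq_def add_pos_nonneg)
  then show "wsq i h Z \<ge> 0" "wsq i h Z = 0 \<longleftrightarrow> h Z = 0" by (auto simp: wsq_def)
qed

lemma block_nonneg: "block i m n j Z \<ge> 0"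
  and block_eq_0_iff: "block i m n j Z = 0 \<longleftrightarrow>
    Im (Z $ m) = 0 \<and> Im (Z $ n) = 0 \<and> Z $ j = cnj (Z $ i) * (complex_of_real (Re (Z $ m)) + \<i> * complex_of_real (Re (Z $ n)))"
proof -
  note nn = wsq_nonneg[of i "\<lambda>Z. Im (Z $ m)" Z] wsq_nonneg[of i "\<lambda>Z. Im (Z $ n)" Z]
    wsq_nonneg[of i "defect_Re i m n j" Z] wsq_nonneg[of i "defect_Im i m n j" Z]
  show "block i m n j Z \<ge> 0" using nn by (simp add: block_def)
  have "block i m n j Z = 0 \<longleftrightarrow> wsq i (\<lambda>Z. Im (Z $ m)) Z = 0 \<and> wsq i (\<lambda>Z. Im (Z $ n)) Z = 0
      \<and> wsq i (defect_Re i m n j) Z = 0 \<and> wsq i (defect_Im i m n j) Z = 0"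
    using nn unfolding block_def by linarith
  then show "block i m n j Z = 0 \<longleftrightarrow>
    Im (Z $ m) = 0 \<and> Im (Z $ n) = 0 \<and> Z $ j = cnj (Z $ i) * (complex_of_real (Re (Z $ m)) + \<i> * complex_of_real (Re (Z $ n)))"
    by (auto simp: wsq_eq_0_iff defect_Re_def defect_Im_def complex_eq_iff)
qed

lemma last_block_nonneg: "last_block i j Z \<ge> 0"
  and last_block_eq_0_iff: "last_block i j Z = 0 \<longleftrightarrow> Z $ j = (cnj (Z $ i))\<^sup>2"
  using wsq_nonneg[of i "last_Re i j" Z] wsq_nonneg[of i "last_Im i j" Z]
  by (auto simp: last_block_def add_nonneg_eq_0_iff wsq_eq_0_iff last_Re_def last_Im_def complex_eq_iff power2_eq_square algebra_simps)

text \<open>Where \<open>z\<close>, \<open>u_1\<close> and \<open>u_2\<close> all vanish the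
  weighted square of \<open>first_Re\<close> vanishes too; there it is the fourth power that detects
  \<open>first_Re\<close>.\<close>

lemma first_block_nonneg: "first_block i m n j Z \<ge> 0"
  and first_block_eq_0_iff: "first_block i m n j Z = 0 \<longleftrightarrow> Im (Z $ m) = 0 \<and> Im (Z $ n) = 0 \<and>
    Z $ j = complex_of_real ((cmod (Z $ i))\<^sup>2) + cnj (Z $ i) * (complex_of_real (Re (Z $ m)) + \<i> * complex_of_real (Re (Z $ n)))"
proof -
  let ?F = "first_Re i m n j Z"
  have nn: "(\<kappa> * nsq i Z + ((Re (Z $ m))\<^sup>2 + (Re (Z $ n))\<^sup>2)) * ?F\<^sup>2 \<ge> 0" "(?F\<^sup>2)\<^sup>2 \<ge> 0"
    by (auto simp: nsq_def)
  note nn = nn wsq_nonneg[of i "\<lambda>Z. Im (Z $ m)" Z] wsq_nonneg[of i "\<lambda>Z. Im (Z $ n)" Z] wsq_nonneg[of i "defect_Im i m n j" Z]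
  show "first_block i m n j Z \<ge> 0" using nn by (simp add: first_block_def)
  have "first_block i m n j Z = 0 \<longleftrightarrow> wsq i (\<lambda>Z. Im (Z $ m)) Z = 0 \<and> wsq i (\<lambda>Z. Im (Z $ n)) Z = 0
      \<and> wsq i (defect_Im i m n j) Z = 0 \<and> (\<kappa> * nsq i Z + ((Re (Z $ m))\<^sup>2 + (Re (Z $ n))\<^sup>2)) * ?F\<^sup>2 = 0 \<and> (?F\<^sup>2)\<^sup>2 = 0"
    using nn unfolding first_block_def by linarith
  also have "\<dots> \<longleftrightarrow> Im (Z $ m) = 0 \<and> Im (Z $ n) = 0 \<and> defect_Im i m n j Z = 0 \<and> ?F = 0"
    by (auto simp: wsq_eq_0_iff)
  finally show "first_block i m n j Z = 0 \<longleftrightarrow> Im (Z $ m) = 0 \<and> Im (Z $ n) = 0 \<and>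
    Z $ j = complex_of_real ((cmod (Z $ i))\<^sup>2) + cnj (Z $ i) * (complex_of_real (Re (Z $ m)) + \<i> * complex_of_real (Re (Z $ n)))"
    by (auto simp: defect_Re_def defect_Im_def first_Re_def nsq_eq complex_eq_iff)
qed

lemma model_potential_nonneg: "model_potential k c Z \<ge> 0"
  unfolding model_potential_def
  by (intro add_nonneg_nonneg sum_nonneg block_nonneg last_block_nonneg first_block_nonneg)

lemma model_potential_eq_0_iff:
  fixes c :: "nat \<Rightarrow> 'n::finite"
  assumes "k > 1"
  shows "model_potential k c Z = 0 \<longleftrightarrow> Z \<in> BC_model k c"
proof -
  have s: "(\<Sum>\<sigma>\<in>{2..k - 1}. block (c 0) (c (2 * \<sigma> - 1)) (c (2 * \<sigma>)) (c (2 * k - 2 + \<sigma>)) Z) \<ge> 0"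
    by (intro sum_nonneg block_nonneg)
  \<comment> \<open>The real coordinates come in pairs \<open>(2 \<sigma> - 1, 2 \<sigma>)\<close>
    for \<open>1 \<le> \<sigma> \<le> k - 1\<close>. The pair \<open>(1, 2)\<close>, present since
    \<open>k > 1\<close>, belongs to the block of \<open>\<zeta>\<^sub>1\<close>.\<close>
  have tau: "(\<forall>\<tau>\<in>{1..2 * k - 2}. P \<tau>) \<longleftrightarrow> (\<forall>\<sigma>\<in>{2..k - 1}. P (2 * \<sigma> - 1) \<and> P (2 * \<sigma>)) \<and> P 1 \<and> P 2" for P :: "nat \<Rightarrow> bool"
  proof (intro iffI conjI ballI)
    assume R: "(\<forall>\<sigma>\<in>{2..k - 1}. P (2 * \<sigma> - 1) \<and> P (2 * \<sigma>)) \<and> P 1 \<and> P 2"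
    fix \<tau> assume \<tau>: "\<tau> \<in> {1..2 * k - 2}"
    define \<sigma> where "\<sigma> = (\<tau> + 1) div 2"
    have "\<tau> = 2 * \<sigma> - 1 \<or> \<tau> = 2 * \<sigma>" "\<sigma> = 1 \<or> \<sigma> \<in> {2..k - 1}" using \<tau> by (auto simp: \<sigma>_def)
    then show "P \<tau>" using R by (auto simp: numeral_2_eq_2)
  next
    fix \<sigma> assume L: "\<forall>\<tau>\<in>{1..2 * k - 2}. P \<tau>" and "\<sigma> \<in> {2..k - 1}"
    then have "2 * \<sigma> - 1 \<in> {1..2 * k - 2}" "2 * \<sigma> \<in> {1..2 * k - 2}" by auto
    then show "P (2 * \<sigma> - 1)" "P (2 * \<sigma>)" using L by blast+
  qed (use assms in auto)
  have "model_potential k c Z = 0 \<longleftrightarrow>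
      (\<forall>\<sigma>\<in>{2..k - 1}. block (c 0) (c (2 * \<sigma> - 1)) (c (2 * \<sigma>)) (c (2 * k - 2 + \<sigma>)) Z = 0)
      \<and> last_block (c 0) (c (2 * k - 2 + k)) Z = 0 \<and> first_block (c 0) (c 1) (c 2) (c (2 * k - 2 + 1)) Z = 0"
    unfolding model_potential_def
    using s last_block_nonneg[of "c 0" "c (2 * k - 2 + k)" Z] first_block_nonneg[of "c 0" "c 1" "c 2" "c (2 * k - 2 + 1)" Z]
    by (subst sum_nonneg_eq_0_iff[symmetric]) (auto simp: block_nonneg add_nonneg_eq_0_iff)
  also have "\<dots> \<longleftrightarrow> Z \<in> BC_model k c"
    unfolding BC_model_def mem_Collect_eq Let_def tau block_eq_0_iff last_block_eq_0_iff first_block_eq_0_iff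
    by blast
  finally show ?thesis .
qed

text \<open>A sum of nonnegative lower bounds that is not positive vanishes term by term. If
  \<open>dz = 0\<close>, this forces \<open>V = 0\<close>; otherwise the coefficients of
  \<open>|dz|^2\<close> vanish, which forces \<open>Z = 0\<close>.\<close>

lemma model_potential_lap_pos:
  fixes c :: "nat \<Rightarrow> 'n::finite"
  assumes "k > 1" "bij_betw c {0..<3 * k - 1} UNIV" "Z \<in> model_nbhd k c"
  shows "smooth_at (model_potential k c) Z" and "Z \<noteq> 0 \<Longrightarrow> lap_pos (model_potential k c) Z"
proof -
  have small: "cmod (Z $ c 0) \<le> 1 / 100000" "cmod (ubar (c 1) (c 2) Z) \<le> 1 / 100000"
    "\<bar>first_Re (c 0) (c 1) (c 2) (c (2 * k - 2 + 1)) Z\<bar> \<le> 1 / 100000"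
    using assms(3) by (auto simp: model_nbhd_def)
  have sm: "16 * \<kappa> * (cmod (Z $ c 0))\<^sup>2 \<le> 1"
  proof -
    have "(cmod (Z $ c 0))\<^sup>2 \<le> (1 / 100000)\<^sup>2" by (intro power_mono small(1)) auto
    then show ?thesis by (simp add: power_divide)
  qed
  note sB = block_lower_bound(1)[OF sm] and sK = last_block_lower_bound(1)[OF sm] and s1 = first_block_lower_bound(1)[OF small]
  show "smooth_at (model_potential k c) Z"
    unfolding model_potential_def[abs_def] by (intro smooth_at_add smooth_at_sum sB sK s1)
  assume "Z \<noteq> 0"
  show "lap_pos (model_potential k c) Z"
    unfolding lap_pos_def
  proof (intro allI impI, rule ccontr)
    fix V :: "complex ^ 'n" assume "V \<noteq> 0" and "\<not> lap (model_potential k c) Z V > 0"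
    then have le0: "lap (model_potential k c) Z V \<le> 0" by simp
    let ?i = "c 0" and ?m = "\<lambda>\<sigma>. c (2 * \<sigma> - 1)" and ?n = "\<lambda>\<sigma>. c (2 * \<sigma>)" and ?j = "\<lambda>\<sigma>. c (2 * k - 2 + \<sigma>)"
    let ?a = "(cmod (V $ ?i))\<^sup>2" and ?F = "first_Re ?i (c 1) (c 2) (?j 1) Z" and ?G = "defect_Im ?i (c 1) (c 2) (?j 1) Z"
    let ?t = "V $ ?j 1 + ubar (c 1) (c 2) Z * V $ ?i - err_Im ?i (c 1) (c 2) Z V"
    define X where "X \<sigma> = ((cmod (V $ ?m \<sigma>))\<^sup>2 + (cmod (V $ ?n \<sigma>))\<^sup>2) / 2 + (cmod (V $ ?j \<sigma>))\<^sup>2 + ?a *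
      ((cmod (ubar (?m \<sigma>) (?n \<sigma>) Z))\<^sup>2 + 2 * \<kappa> * ((Im (Z $ ?m \<sigma>))\<^sup>2 + (Im (Z $ ?n \<sigma>))\<^sup>2
        + (defect_Re ?i (?m \<sigma>) (?n \<sigma>) (?j \<sigma>) Z)\<^sup>2 + (defect_Im ?i (?m \<sigma>) (?n \<sigma>) (?j \<sigma>) Z)\<^sup>2))" for \<sigma>
    define Y1 where "Y1 = (cmod (V $ ?j k))\<^sup>2 + ((cmod (V $ c 1))\<^sup>2 + (cmod (V $ c 2))\<^sup>2) / 2 + (cmod ?t)\<^sup>2 / 2"
    \<comment> \<open>The term \<open>|z|^2\<close> is the surplus \<open>4 - 3\<close> of the last
      block over the deficit of the first one.\<close>
    define Y2 where "Y2 = (cmod (Z $ ?i))\<^sup>2 + 2 * \<kappa> * ((last_Re ?i (?j k) Z)\<^sup>2 + (last_Im ?i (?j k) Z)\<^sup>2)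
      + 2 * \<kappa> * ((Im (Z $ c 1))\<^sup>2 + (Im (Z $ c 2))\<^sup>2 + ?G\<^sup>2) + \<kappa> * ?F\<^sup>2 + cmod (ubar (c 1) (c 2) Z) ^ 4"
    have X0: "X \<sigma> \<ge> 0" for \<sigma> by (simp add: X_def)
    have Y0: "Y1 \<ge> 0" "Y2 \<ge> 0" by (simp_all add: Y1_def Y2_def)
    have "lap (model_potential k c) Z V = (\<Sum>\<sigma>\<in>{2..k - 1}. lap (block ?i (?m \<sigma>) (?n \<sigma>) (?j \<sigma>)) Z V)
       + (lap (last_block ?i (?j k)) Z V + lap (first_block ?i (c 1) (c 2) (?j 1)) Z V)"
      unfolding model_potential_def[abs_def] using sB sK s1 by (simp add: lap_add lap_sum smooth_at_sum smooth_at_add)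
    also have "\<dots> \<ge> (\<Sum>\<sigma>\<in>{2..k - 1}. X \<sigma>) + (Y1 + ?a * Y2)"
    proof (rule add_mono)
      show "(\<Sum>\<sigma>\<in>{2..k - 1}. X \<sigma>) \<le> (\<Sum>\<sigma>\<in>{2..k - 1}. lap (block ?i (?m \<sigma>) (?n \<sigma>) (?j \<sigma>)) Z V)"
        unfolding X_def by (rule sum_mono) (rule block_lower_bound(2)[OF sm])
      have "Y1 + ?a * Y2 = ((cmod (V $ ?j k))\<^sup>2 + ?a * (4 * (cmod (Z $ ?i))\<^sup>2 + 2 * \<kappa> * ((last_Re ?i (?j k) Z)\<^sup>2 + (last_Im ?i (?j k) Z)\<^sup>2)))
        + (((cmod (V $ c 1))\<^sup>2 + (cmod (V $ c 2))\<^sup>2) / 2 + (cmod ?t)\<^sup>2 / 2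
         + ?a * (2 * \<kappa> * ((Im (Z $ c 1))\<^sup>2 + (Im (Z $ c 2))\<^sup>2 + ?G\<^sup>2) + \<kappa> * ?F\<^sup>2 + cmod (ubar (c 1) (c 2) Z) ^ 4 - 3 * (cmod (Z $ ?i))\<^sup>2))"
        by (simp add: Y1_def Y2_def algebra_simps)
      also have "\<dots> \<le> lap (last_block ?i (?j k)) Z V + lap (first_block ?i (c 1) (c 2) (?j 1)) Z V"
        by (intro add_mono last_block_lower_bound(2)[OF sm] first_block_lower_bound(2)[OF small])
      finally show "Y1 + ?a * Y2 \<le> lap (last_block ?i (?j k)) Z V + lap (first_block ?i (c 1) (c 2) (?j 1)) Z V" .
    qed
    finally have "(\<Sum>\<sigma>\<in>{2..k - 1}. X \<sigma>) + (Y1 + ?a * Y2) \<le> 0" using le0 by linarith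
    moreover have "(\<Sum>\<sigma>\<in>{2..k - 1}. X \<sigma>) \<ge> 0" "?a * Y2 \<ge> 0" using X0 Y0 by (auto intro: sum_nonneg)
    ultimately have sum0: "(\<Sum>\<sigma>\<in>{2..k - 1}. X \<sigma>) = 0" and Y: "Y1 = 0" "?a * Y2 = 0" using Y0 by linarith+
    have X: "X \<sigma> = 0" if "\<sigma> \<in> {2..k - 1}" for \<sigma>
      using sum0 X0 that by (subst (asm) sum_nonneg_eq_0_iff) auto
    have V1: "V $ ?j k = 0" "V $ c 1 = 0" "V $ c 2 = 0" "?t = 0"
    proof -
      have "(cmod (V $ ?j k))\<^sup>2 = 0 \<and> (cmod (V $ c 1))\<^sup>2 = 0 \<and> (cmod (V $ c 2))\<^sup>2 = 0 \<and> (cmod ?t)\<^sup>2 = 0"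
        using Y(1) zero_le_power2[of "cmod (V $ ?j k)"] zero_le_power2[of "cmod (V $ c 1)"]
          zero_le_power2[of "cmod (V $ c 2)"] zero_le_power2[of "cmod ?t"] unfolding Y1_def by argo
      then show "V $ ?j k = 0" "V $ c 1 = 0" "V $ c 2 = 0" "?t = 0" by (auto simp only: zero_eq_power2 norm_eq_zero)
    qed
    have Vs: "V $ ?m \<sigma> = 0" "V $ ?n \<sigma> = 0" "V $ ?j \<sigma> = 0" if "\<sigma> \<in> {2..k - 1}" for \<sigma>
    proof -
      have "(cmod (V $ ?m \<sigma>))\<^sup>2 = 0 \<and> (cmod (V $ ?n \<sigma>))\<^sup>2 = 0 \<and> (cmod (V $ ?j \<sigma>))\<^sup>2 = 0"
      proof -
        have "?a * ((cmod (ubar (?m \<sigma>) (?n \<sigma>) Z))\<^sup>2 + 2 * \<kappa> * ((Im (Z $ ?m \<sigma>))\<^sup>2 + (Im (Z $ ?n \<sigma>))\<^sup>2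
          + (defect_Re ?i (?m \<sigma>) (?n \<sigma>) (?j \<sigma>) Z)\<^sup>2 + (defect_Im ?i (?m \<sigma>) (?n \<sigma>) (?j \<sigma>) Z)\<^sup>2)) \<ge> 0" by simp
        then show ?thesis
          using X[OF that] zero_le_power2[of "cmod (V $ ?m \<sigma>)"] zero_le_power2[of "cmod (V $ ?n \<sigma>)"]
            zero_le_power2[of "cmod (V $ ?j \<sigma>)"] unfolding X_def by argo
      qed
      then show "V $ ?m \<sigma> = 0" "V $ ?n \<sigma> = 0" "V $ ?j \<sigma> = 0" by auto
    qed
    have idx: "\<tau> = 0 \<or> \<tau> = 1 \<or> \<tau> = 2 \<or> (\<exists>\<sigma>\<in>{2..k - 1}. \<tau> = 2 * \<sigma> - 1 \<or> \<tau> = 2 * \<sigma> \<or> \<tau> = 2 * k - 2 + \<sigma>)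
        \<or> \<tau> = 2 * k - 2 + 1 \<or> \<tau> = 2 * k - 2 + k" if "\<tau> < 3 * k - 1" for \<tau>
    proof (cases "\<tau> \<le> 2 * k - 2")
      case True
      then have "\<tau> \<le> 2 \<or> (\<tau> + 1) div 2 \<in> {2..k - 1} \<and> (\<tau> = 2 * ((\<tau> + 1) div 2) - 1 \<or> \<tau> = 2 * ((\<tau> + 1) div 2))"
        by auto
      then show ?thesis by (auto simp: le_Suc_eq numeral_2_eq_2)
    next
      case False
      then have "\<tau> = 2 * k - 2 + (\<tau> - (2 * k - 2))" by simp
      moreover have "\<tau> - (2 * k - 2) = 1 \<or> \<tau> - (2 * k - 2) = k \<or> \<tau> - (2 * k - 2) \<in> {2..k - 1}"
        using that False by auto
      ultimately show ?thesis by metis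
    qed
    \<comment> \<open>Used for the direction \<open>V\<close> when \<open>dz = 0\<close> and for the
      point \<open>Z\<close> when \<open>dz\<close> is nonzero.\<close>
    have all_coords: "U = 0" if "U $ c 0 = 0" "U $ c 1 = 0" "U $ c 2 = 0" "U $ ?j 1 = 0" "U $ ?j k = 0"
      "\<And>\<sigma>. \<sigma> \<in> {2..k - 1} \<Longrightarrow> U $ ?m \<sigma> = 0 \<and> U $ ?n \<sigma> = 0 \<and> U $ ?j \<sigma> = 0" for U :: "complex ^ 'n"
    proof -
      have "U $ q = 0" for q
      proof -
        obtain \<tau> where "\<tau> < 3 * k - 1" "q = c \<tau>" using assms(2) by (force simp: bij_betw_def)
        then show ?thesis using idx[of \<tau>] that by metis
      qed
      then show ?thesis by (simp add: vec_eq_iff)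
    qed
    show False
    proof (cases "V $ ?i = 0")
      case True
      then have "V $ ?j 1 = 0" using V1 by (simp add: err_Im_def)
      then have "V = 0" using all_coords[of V] True V1 Vs by blast
      then show False using \<open>V \<noteq> 0\<close> by simp
    next
      case False
      then have a: "?a > 0" by simp
      have "Y2 = 0" using Y(2) a by simp
      then have "(cmod (Z $ ?i))\<^sup>2 = 0 \<and> (last_Re ?i (?j k) Z)\<^sup>2 = 0 \<and> (last_Im ?i (?j k) Z)\<^sup>2 = 0
        \<and> (Im (Z $ c 1))\<^sup>2 = 0 \<and> (Im (Z $ c 2))\<^sup>2 = 0 \<and> ?G\<^sup>2 = 0 \<and> ?F\<^sup>2 = 0 \<and> cmod (ubar (c 1) (c 2) Z) ^ 4 = 0"
        using zero_le_power2[of "cmod (Z $ ?i)"] zero_le_power2[of "last_Re ?i (?j k) Z"] zero_le_power2[of "last_Im ?i (?j k) Z"]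
          zero_le_power2[of "Im (Z $ c 1)"] zero_le_power2[of "Im (Z $ c 2)"] zero_le_power2[of ?G] zero_le_power2[of ?F]
          zero_le_power[of "cmod (ubar (c 1) (c 2) Z)" 4, OF norm_ge_zero]
        unfolding Y2_def by argo
      then have z: "Z $ ?i = 0" and kk: "last_Re ?i (?j k) Z = 0" "last_Im ?i (?j k) Z = 0" and im: "Im (Z $ c 1) = 0" "Im (Z $ c 2) = 0"
        and G: "?G = 0" and F: "?F = 0" and u: "ubar (c 1) (c 2) Z = 0"
        by simp_all
      have "Z = 0"
      proof (rule all_coords)
        show "Z $ c 0 = 0" by (rule z)
        show "Z $ c 1 = 0" "Z $ c 2 = 0" using im u by (auto simp: ubar_def complex_eq_iff)
        show "Z $ ?j 1 = 0" using G F z by (simp add: first_Re_def defect_Re_def defect_Im_def nsq_def complex_eq_iff)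
        show "Z $ ?j k = 0" using kk z by (simp add: last_Re_def last_Im_def complex_eq_iff)
        fix \<sigma> assume \<sigma>: "\<sigma> \<in> {2..k - 1}"
        let ?M = "(cmod (ubar (?m \<sigma>) (?n \<sigma>) Z))\<^sup>2 + 2 * \<kappa> * ((Im (Z $ ?m \<sigma>))\<^sup>2 + (Im (Z $ ?n \<sigma>))\<^sup>2
          + (defect_Re ?i (?m \<sigma>) (?n \<sigma>) (?j \<sigma>) Z)\<^sup>2 + (defect_Im ?i (?m \<sigma>) (?n \<sigma>) (?j \<sigma>) Z)\<^sup>2)"
        have "?a * ?M = 0" using X[OF \<sigma>] Vs[OF \<sigma>] by (simp add: X_def)
        then have "?M = 0" using a by simp
        then have "(cmod (ubar (?m \<sigma>) (?n \<sigma>) Z))\<^sup>2 = 0 \<and> (Im (Z $ ?m \<sigma>))\<^sup>2 = 0 \<and> (Im (Z $ ?n \<sigma>))\<^sup>2 = 0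
          \<and> (defect_Re ?i (?m \<sigma>) (?n \<sigma>) (?j \<sigma>) Z)\<^sup>2 = 0 \<and> (defect_Im ?i (?m \<sigma>) (?n \<sigma>) (?j \<sigma>) Z)\<^sup>2 = 0"
          using zero_le_power2[of "cmod (ubar (?m \<sigma>) (?n \<sigma>) Z)"] zero_le_power2[of "Im (Z $ ?m \<sigma>)"] zero_le_power2[of "Im (Z $ ?n \<sigma>)"]
            zero_le_power2[of "defect_Re ?i (?m \<sigma>) (?n \<sigma>) (?j \<sigma>) Z"] zero_le_power2[of "defect_Im ?i (?m \<sigma>) (?n \<sigma>) (?j \<sigma>) Z"] by argo
        then show "Z $ ?m \<sigma> = 0 \<and> Z $ ?n \<sigma> = 0 \<and> Z $ ?j \<sigma> = 0"
          using z by (simp add: ubar_def defect_Re_def defect_Im_def complex_eq_iff)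
      qed
      then show False using \<open>Z \<noteq> 0\<close> by simp
    qed
  qed
qed

section \<open>Local and global defining functions\<close>

lemma dder_at_zero_minimum:
  fixes \<rho> :: "'a::real_normed_vector \<Rightarrow> real"
  assumes "smooth_at \<rho> x" "open U" "x \<in> U" "\<And>y. y \<in> U \<Longrightarrow> \<rho> y \<ge> 0" "\<rho> x = 0"
  shows "dder \<rho> x v = 0"
proof -
  have "dder \<rho> x = (\<lambda>v. 0)"
    by (rule differential_zero_maxmin[OF assms(3,2) smooth_at_has_derivative[OF assms(1)]]) (use assms in auto)
  then show ?thesis by simp
qed

text \<open>The chart pulls the straight line through \<open>f x\<close> with velocity
  \<open>dder f x w\<close>, which stays in \<open>L\<close>, back to a curve in \<open>M\<close>
  with velocity \<open>w\<close>.\<close>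

lemma chart_tangent:
  fixes f g :: "'a::euclidean_space \<Rightarrow> 'a"
  assumes U: "open U" "open V" "homeomorphism U V f g" "smooth_on U f" "smooth_on V g"
    and L: "subspace L" "f ` (M \<inter> U) = L \<inter> V" and x: "x \<in> M" "x \<in> U" and w: "dder f x w \<in> L"
  shows "w \<in> tangent_space M x"
proof -
  have sf: "smooth_at f x" and sg: "\<And>y. y \<in> V \<Longrightarrow> smooth_at g y"
    using U x by (auto simp: smooth_on_iff_smooth_at)
  have fx: "f x \<in> V" "f x \<in> L" "g (f x) = x"
    using U(3) L(2) x by (auto simp: homeomorphism_def)
  define \<gamma> where "\<gamma> t = g (f x + t *\<^sub>R dder f x w)" for t
  obtain r where r: "r > 0" "ball (f x) r \<subseteq> V" using U(2) fx(1) by (meson open_contains_ball)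
  obtain N where N: "N > 0" "norm (dder f x w) \<le> N"
    by (metis linordered_field_no_ub less_le_trans less_imp_le norm_ge_zero le_less_trans)
  define e where "e = r / (2 * N)"
  have e: "e > 0" using r N by (simp add: e_def)
  have inV: "f x + t *\<^sub>R dder f x w \<in> V" if "t \<in> {-e<..<e}" for t
  proof -
    have "dist (f x) (f x + t *\<^sub>R dder f x w) = \<bar>t\<bar> * norm (dder f x w)" by (simp add: dist_norm)
    also have "\<dots> \<le> e * N" using that N by (intro mult_mono) auto
    also have "\<dots> < r" using r N by (simp add: e_def)
    finally show ?thesis using r(2) by auto
  qed
  have s: "smooth_at (\<lambda>t. f x + t *\<^sub>R dder f x w) t" for t :: real
    by (intro smooth_at_add smooth_at_const smooth_at_linear bounded_linear_scaleR_left)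
  have "smooth_at \<gamma> t" if "t \<in> {-e<..<e}" for t
    unfolding \<gamma>_def[abs_def] by (rule smooth_at_compose[OF s sg[OF inV[OF that]]])
  then have "smooth_on {-e<..<e} \<gamma>" by (simp add: smooth_on_iff_smooth_at)
  moreover have "\<gamma> t \<in> M" if "t \<in> {-e<..<e}" for t
  proof -
    have "f x + t *\<^sub>R dder f x w \<in> L \<inter> V"
      using inV[OF that] L(1) fx w by (auto intro: subspace_add subspace_scale)
    then obtain y where "y \<in> M \<inter> U" "f y = f x + t *\<^sub>R dder f x w" using L(2) by (metis imageE)
    moreover from this have "g (f y) = y" using U(3) by (auto simp: homeomorphism_def)
    ultimately show ?thesis by (auto simp: \<gamma>_def)
  qed
  moreover have "\<gamma> 0 = x" by (simp add: \<gamma>_def fx)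
  moreover have "(\<gamma> has_vector_derivative w) (at 0)"
  proof -
    have "(\<gamma> has_derivative (\<lambda>h. dder g (f x + 0 *\<^sub>R dder f x w) (h *\<^sub>R dder f x w))) (at 0)"
      unfolding \<gamma>_def[abs_def]
      by (rule has_derivative_compose[where f = "\<lambda>t. f x + t *\<^sub>R dder f x w" and g = g, OF _ smooth_at_has_derivative])
        (auto intro!: derivative_eq_intros sg fx)
    moreover have "dder g (f x) (dder f x w) = w"
    proof -
      have "dder (\<lambda>y. g (f y)) x w = dder g (f x) (dder f x w)"
        by (rule dder_smooth_compose[OF sf sg[OF fx(1)]])
      moreover have "dder (\<lambda>y. g (f y)) x w = dder (\<lambda>y. y) x w"
        using U(1,3) x(2) by (intro dder_cong_ev) (auto simp: eventually_nhds homeomorphism_def)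
      ultimately show ?thesis by simp
    qed
    ultimately show ?thesis
      using linear_dder_at[OF sg[OF fx(1)]] by (simp add: has_vector_derivative_def linear_cmul)
  qed
  ultimately show ?thesis unfolding tangent_space_def using e by blast
qed

lemma local_defining_function_totally_real:
  fixes M :: "(complex ^ 'n::finite) set"
  assumes "smooth_submanifold d M" "p \<in> M"
  obtains U \<rho> where "open U" "p \<in> U" "\<And>x. x \<in> U \<Longrightarrow> smooth_at \<rho> x" "\<And>x. x \<in> U \<Longrightarrow> \<rho> x \<ge> 0"
    "\<And>x. x \<in> U \<Longrightarrow> \<rho> x = 0 \<longleftrightarrow> x \<in> M"
    "\<And>x. x \<in> U \<Longrightarrow> x \<in> M \<Longrightarrow> totally_real_at M x \<Longrightarrow> lap_pos \<rho> x"
proof -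
  obtain U V L f g where *: "open U \<and> open V \<and> p \<in> U \<and> subspace (L :: (complex ^ 'n) set) \<and> dim L = d \<and>
      homeomorphism U V f g \<and> smooth_on U f \<and> smooth_on V g \<and> f ` (M \<inter> U) = L \<inter> V"
    using bspec[OF assms(1)[unfolded smooth_submanifold_def] assms(2)] by (elim exE) (rule that)
  then have U: "open U" "open V" "p \<in> U" "subspace L"
    and ch: "homeomorphism U V f g" "smooth_on U f" "smooth_on V g" "f ` (M \<inter> U) = L \<inter> V"
    by simp_all
  \<comment> \<open>A basis of the orthogonal complement provides linear equations for
    \<open>L\<close>; the sum of their squares plays the part of the squared distance.\<close>
  obtain B where B: "B \<subseteq> L\<^sup>\<bottom>" "independent B" "L\<^sup>\<bottom> \<subseteq> span B"
    by (metis basis_exists)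
  have fin: "finite B" using B(2) by (rule independent_imp_finite)
  have LB: "y \<in> L \<longleftrightarrow> (\<forall>b\<in>B. b \<bullet> y = 0)" for y
  proof
    assume "y \<in> L"
    then show "\<forall>b\<in>B. b \<bullet> y = 0" using B(1) by (auto simp: orthogonal_comp_def orthogonal_def inner_commute)
  next
    assume "\<forall>b\<in>B. b \<bullet> y = 0"
    then have "orthogonal y z" if "z \<in> span B" for z
      using that by (intro orthogonal_to_span[of z B y]) (auto simp: orthogonal_def inner_commute)
    then have "y \<in> L\<^sup>\<bottom>\<^sup>\<bottom>" using B(3) by (auto simp: orthogonal_comp_def orthogonal_commute)
    then show "y \<in> L" using orthogonal_comp_self[OF U(4)] by simp
  qed
  define \<rho> where "\<rho> x = (\<Sum>b\<in>B. (b \<bullet> f x)\<^sup>2)" for x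
  have sf: "smooth_at f x" if "x \<in> U" for x using ch(2) U(1) that by (simp add: smooth_on_iff_smooth_at)
  have sb: "smooth_at (\<lambda>x. b \<bullet> f x) x" if "x \<in> U" for x b
    by (intro smooth_at_bilinear[OF bounded_bilinear_inner] smooth_at_const sf that)
  have \<rho>0: "\<rho> x = 0 \<longleftrightarrow> f x \<in> L" for x
    using fin by (simp add: \<rho>_def LB sum_nonneg_eq_0_iff)
  have zero: "\<rho> x = 0 \<longleftrightarrow> x \<in> M" if "x \<in> U" for x
  proof
    assume "\<rho> x = 0"
    then have "f x \<in> L \<inter> V" using \<rho>0 ch(1) that by (auto simp: homeomorphism_def)
    then obtain y where "y \<in> M \<inter> U" "f y = f x" using ch(4) by (metis imageE)
    then show "x \<in> M" using ch(1) that by (metis IntE homeomorphism_apply1)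
  next
    assume "x \<in> M"
    then show "\<rho> x = 0" using \<rho>0 ch(4) that by blast
  qed
  show thesis
  proof (rule that[OF U(1,3)])
    show "smooth_at \<rho> x" if "x \<in> U" for x
      unfolding \<rho>_def[abs_def] by (intro smooth_at_sum smooth_at_power sb that)
    show "\<rho> x \<ge> 0" for x by (simp add: \<rho>_def sum_nonneg)
    show "\<rho> x = 0 \<longleftrightarrow> x \<in> M" if "x \<in> U" for x by (rule zero[OF that])
    fix x assume x: "x \<in> U" "x \<in> M" "totally_real_at M x"
    show "lap_pos \<rho> x"
      unfolding lap_pos_def
    proof (intro allI impI, rule ccontr)
      fix v :: "complex ^ 'n" assume "v \<noteq> 0" and neg: "\<not> lap \<rho> x v > 0"
      have fL: "f x \<in> L" using zero[OF x(1)] x(2) \<rho>0 by simp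
      have "lap (\<lambda>x. (b \<bullet> f x)\<^sup>2) x v = 2 * (cmod (cgrad (\<lambda>x. b \<bullet> f x) x v))\<^sup>2" if "b \<in> B" for b
        using jet_square[of x v "\<lambda>x. b \<bullet> f x" 0] sb[OF x(1), of b] fL that by (auto simp: jet_def LB)
      then have "lap \<rho> x v = (\<Sum>b\<in>B. 2 * (cmod (cgrad (\<lambda>x. b \<bullet> f x) x v))\<^sup>2)"
        unfolding \<rho>_def[abs_def] by (simp add: lap_sum smooth_at_power sb x(1))
      moreover have "(\<Sum>b\<in>B. 2 * (cmod (cgrad (\<lambda>x. b \<bullet> f x) x v))\<^sup>2) \<ge> 0" by (intro sum_nonneg) auto
      ultimately have "(\<Sum>b\<in>B. 2 * (cmod (cgrad (\<lambda>x. b \<bullet> f x) x v))\<^sup>2) = 0" using neg by linarith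
      then have "\<forall>b\<in>B. cgrad (\<lambda>x. b \<bullet> f x) x v = 0" using fin by (simp add: sum_nonneg_eq_0_iff)
      moreover have "dder (\<lambda>x. b \<bullet> f x) x u = b \<bullet> dder f x u" for b u
        using dder_bilinear[OF bounded_bilinear_inner smooth_at_const sf[OF x(1)]] by simp
      ultimately have L: "dder f x v \<in> L" "dder f x (\<i> *s v) \<in> L"
        by (auto simp: cgrad_def LB complex_eq_iff)
      have "dder f x (- (\<i> *s v)) = - dder f x (\<i> *s v)"
        using linear_dder_at[OF sf[OF x(1)]] by (rule linear_neg)
      then have L': "dder f x (- (\<i> *s v)) \<in> L" using L(2) U(4) by (simp add: subspace_neg)
      note T = chart_tangent[OF U(1,2) ch(1-3) U(4) ch(4) x(2,1)]
      \<comment> \<open>Both \<open>v\<close> and \<open>- \<i> v\<close> are tangent, and this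
        identity shows \<open>v\<close> in the image of the tangent space under multiplication by
        \<open>\<i>\<close>.\<close>
      have "v = \<i> *s (- (\<i> *s v))" by (simp add: vec_eq_iff)
      then have "v \<in> complex_tangent_space M x"
        unfolding complex_tangent_space_def using T[OF L(1)] T[OF L'] by blast
      then show False using x(3) \<open>v \<noteq> 0\<close> by (simp add: totally_real_at_def)
    qed
  qed
qed

lemma local_defining_function_singular:
  fixes M :: "(complex ^ 'n::finite) set"
  assumes k: "k > 1" "bij_betw c {0..<3 * k - 1} (UNIV :: 'n set)" and p: "generic_CR_singularity k c M p"
  obtains U \<rho> where "open U" "p \<in> U" "\<And>x. x \<in> U \<Longrightarrow> smooth_at \<rho> x" "\<And>x. x \<in> U \<Longrightarrow> \<rho> x \<ge> 0"
    "\<And>x. x \<in> U \<Longrightarrow> \<rho> x = 0 \<longleftrightarrow> x \<in> M"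
    "\<And>x. x \<in> U \<Longrightarrow> x \<noteq> p \<Longrightarrow> lap_pos \<rho> x"
proof -
  obtain W W' \<Phi> where W: "open W" "p \<in> W" "open W'" "0 \<in> W'" and bih: "biholomorphic_map W W' \<Phi>"
    and \<Phi>p: "\<Phi> p = 0" and im: "\<Phi> ` (M \<inter> W) = BC_model k c \<inter> W'"
    using p unfolding generic_CR_singularity_def by metis
  have bij: "bij_betw \<Phi> W W'" and hol: "holomorphic_map_on W \<Phi>" and hol': "holomorphic_map_on W' (inv_into W \<Phi>)"
    using bih by (auto simp: biholomorphic_map_def)
  have s: "smooth_at \<Phi> x" if "x \<in> W" for x using holomorphic_map_smooth_at[OF W(1) hol that] .
  \<comment> \<open>The holomorphic inverse leaves \<open>dder \<Phi> x\<close> no kernel, so strict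
    positivity of the Levi form survives the change of coordinates.\<close>
  have inj: "dder \<Phi> x v \<noteq> 0" if "x \<in> W" "v \<noteq> 0" for x v
  proof
    assume 0: "dder \<Phi> x v = 0"
    have "\<Phi> x \<in> W'" using bij that by (auto simp: bij_betw_def)
    then have s': "smooth_at (inv_into W \<Phi>) (\<Phi> x)" by (rule holomorphic_map_smooth_at[OF W(3) hol'])
    have "dder (\<lambda>y. inv_into W \<Phi> (\<Phi> y)) x v = dder (inv_into W \<Phi>) (\<Phi> x) (dder \<Phi> x v)"
      by (rule dder_smooth_compose[OF s[OF that(1)] s'])
    also have "\<dots> = 0" using 0 linear_dder_at[OF s'] by (simp add: linear_0)
    also have "dder (\<lambda>y. inv_into W \<Phi> (\<Phi> y)) x v = dder (\<lambda>y. y) x v"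
      using W(1) that(1) bij by (intro dder_cong_ev) (auto simp: eventually_nhds bij_betw_def)
    finally show False using that(2) by simp
  qed
  have "continuous_on W \<Phi>"
    by (intro continuous_at_imp_continuous_on ballI smooth_at_continuous s)
  then have o: "open (W \<inter> \<Phi> -` model_nbhd k c)"
    using W(1) open_model_nbhd by (rule continuous_open_preimage)
  note m = model_potential_lap_pos[OF k]
  show thesis
  proof (rule that[OF o, of "\<lambda>x. model_potential k c (\<Phi> x)"])
    show "p \<in> W \<inter> \<Phi> -` model_nbhd k c" using W(2) \<Phi>p zero_in_model_nbhd by simp
    show "smooth_at (\<lambda>x. model_potential k c (\<Phi> x)) x" if "x \<in> W \<inter> \<Phi> -` model_nbhd k c" for x
      using that by (intro smooth_at_compose[OF s m(1)]) auto
    show "model_potential k c (\<Phi> x) \<ge> 0" for x by (rule model_potential_nonneg)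
    show "model_potential k c (\<Phi> x) = 0 \<longleftrightarrow> x \<in> M" if "x \<in> W \<inter> \<Phi> -` model_nbhd k c" for x
    proof -
      have x: "x \<in> W" and x': "\<Phi> x \<in> W'" using that bij by (auto simp: bij_betw_def)
      have "\<Phi> x \<in> BC_model k c \<longleftrightarrow> x \<in> M"
      proof
        assume "\<Phi> x \<in> BC_model k c"
        then have "\<Phi> x \<in> \<Phi> ` (M \<inter> W)" using im x' by simp
        then obtain y where "y \<in> M" "y \<in> W" "\<Phi> x = \<Phi> y" by auto
        then show "x \<in> M" using bij x by (metis bij_betw_def inj_onD)
      qed (use im x in blast)
      then show ?thesis by (simp add: model_potential_eq_0_iff[OF k(1)])
    qed
    fix x assume x: "x \<in> W \<inter> \<Phi> -` model_nbhd k c" "x \<noteq> p"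
    then have xW: "x \<in> W" and xN: "\<Phi> x \<in> model_nbhd k c" by auto
    have "\<Phi> x \<noteq> 0" using bij x W(2) \<Phi>p by (metis IntE bij_betw_def inj_onD)
    then have "lap_pos (model_potential k c) (\<Phi> x)" by (rule m(2)[OF xN])
    then show "lap_pos (\<lambda>x. model_potential k c (\<Phi> x)) x"
      unfolding lap_pos_def lap_holomorphic_compose[OF W(1) hol xW m(1)[OF xN]]
      using inj[OF xW] by blast
  qed
qed

section \<open>Gluing the local defining functions\<close>

lemma lap_mult_at_zero:
  fixes f \<rho> :: "complex ^ 'n::finite \<Rightarrow> real"
  assumes "smooth_at f x" "smooth_at \<rho> x" "open U" "x \<in> U" "\<And>y. y \<in> U \<Longrightarrow> \<rho> y \<ge> 0" "\<rho> x = 0"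
  shows "lap (\<lambda>x. f x * \<rho> x) x v = f x * lap \<rho> x v"
proof -
  have "cgrad \<rho> x v = 0"
    using dder_at_zero_minimum[OF assms(2-6)] by (simp add: cgrad_def complex_eq_iff)
  then show ?thesis using assms(1,2,6) by (simp add: lap_mult)
qed

text \<open>At a point outside \<open>S\<close>, positivity on \<open>M\<close> is enough, since
  openness supplies the rest after gluing. At a point of \<open>S\<close> a whole punctured
  neighbourhood is demanded, which openness could not provide. The last clause keeps the supports of
  the other bumps away from \<open>S\<close>.\<close>

definition local_defining ::
    "(complex ^ 'n) set \<Rightarrow> (complex ^ 'n) set \<Rightarrow> complex ^ 'n \<Rightarrow> (complex ^ 'n) set \<Rightarrow> (complex ^ 'n \<Rightarrow> real) \<Rightarrow> bool" where
  "local_defining M S p U \<rho> \<longleftrightarrow> open U \<and> p \<in> U \<and> (\<forall>x\<in>U. smooth_at \<rho> x \<and> \<rho> x \<ge> 0 \<and> (\<rho> x = 0 \<longleftrightarrow> x \<in> M))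
     \<and> (\<forall>x\<in>U \<inter> M - S. lap_pos \<rho> x) \<and> (p \<in> S \<longrightarrow> (\<forall>x\<in>U - {p}. lap_pos \<rho> x)) \<and> U \<inter> S \<subseteq> {p}"

lemma global_defining_function:
  fixes M :: "(complex ^ 'n::finite) set"
  assumes M: "compact M" "S \<subseteq> M" "finite S"
    and loc: "\<And>p. p \<in> M \<Longrightarrow> \<exists>U \<rho>. local_defining M S p U \<rho>"
  obtains U \<rho> where "open U" "M \<subseteq> U" "\<And>x. smooth_at \<rho> x" "\<And>x. \<rho> x \<ge> 0"
    "\<And>x. x \<in> U \<Longrightarrow> \<rho> x = 0 \<longleftrightarrow> x \<in> M" "\<And>x. x \<in> U - S \<Longrightarrow> lap_pos \<rho> x"
proof -
  obtain U \<rho> where loc': "\<And>p. p \<in> M \<Longrightarrow> local_defining M S p (U p) (\<rho> p)" using loc by metis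
  have U: "open (U p) \<and> p \<in> U p" and US: "U p \<inter> S \<subseteq> {p}" if "p \<in> M" for p
    using loc'[OF that] by (simp_all add: local_defining_def)
  have \<rho>: "smooth_at (\<rho> p) x \<and> \<rho> p x \<ge> 0 \<and> (\<rho> p x = 0 \<longleftrightarrow> x \<in> M)" if "p \<in> M" "x \<in> U p" for p x
    using loc'[OF that(1)] that(2) by (simp add: local_defining_def)
  have pos: "lap_pos (\<rho> p) x" if "p \<in> M" "x \<in> U p" "x \<in> M" "x \<notin> S" for p x
    using loc'[OF that(1)] that(2-) by (simp add: local_defining_def)
  have posS: "lap_pos (\<rho> p) x" if "p \<in> S" "x \<in> U p" "x \<noteq> p" for p x
    using loc'[of p] that M(2) unfolding local_defining_def by blast
  have "\<exists>r>0. cball p (2 * r) \<subseteq> U p" if "p \<in> M" for p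
  proof -
    have "open (U p)" "p \<in> U p" using U[OF that] by auto
    then obtain e where "e > 0" "cball p e \<subseteq> U p"
      using open_contains_cball[of "U p"] by blast
    then show ?thesis by (intro exI[of _ "e / 2"]) simp
  qed
  then obtain r where r: "\<And>p. p \<in> M \<Longrightarrow> r p > 0 \<and> cball p (2 * r p) \<subseteq> U p" by metis
  have "M \<subseteq> (\<Union>p\<in>M. ball p (r p))" using r by force
  then obtain F0 where F0: "F0 \<subseteq> M" "finite F0" "M \<subseteq> (\<Union>p\<in>F0. ball p (r p))"
    using compactE_image[OF M(1), of M "\<lambda>p. ball p (r p)"] by auto
  \<comment> \<open>Adding \<open>S\<close> to the centres guarantees that each singular point has
    its own local function in the sum.\<close>
  define F where "F = F0 \<union> S"
  have F: "F \<subseteq> M" "finite F" "S \<subseteq> F" "M \<subseteq> (\<Union>p\<in>F. ball p (r p))" using F0 M by (auto simp: F_def)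
  have "\<exists>\<theta>::complex ^ 'n \<Rightarrow> real. \<forall>x. smooth_at \<theta> x \<and> 0 \<le> \<theta> x \<and> (dist x p < r p \<longrightarrow> \<theta> x = 1)
      \<and> (dist x p \<ge> 2 * r p \<longrightarrow> \<theta> x = 0)" if "p \<in> M" for p
  proof -
    have "r p > 0" using r that by blast
    then show ?thesis by (rule exists_bump[of "r p" p]) blast
  qed
  then obtain \<theta> :: "complex ^ 'n \<Rightarrow> complex ^ 'n \<Rightarrow> real"
    where th: "\<And>p x. p \<in> M \<Longrightarrow> smooth_at (\<theta> p) x \<and> 0 \<le> \<theta> p x \<and> (dist x p < r p \<longrightarrow> \<theta> p x = 1)
      \<and> (dist x p \<ge> 2 * r p \<longrightarrow> \<theta> p x = 0)"
    by metis
  \<comment> \<open>Nothing is known of \<open>\<rho> p\<close> off \<open>U p\<close>; the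
    extension by 0 is smooth since \<open>\<theta> p\<close> vanishes outside a closed ball inside
    \<open>U p\<close>.\<close>
  define \<psi> where "\<psi> p x = (if x \<in> U p then \<theta> p x * \<rho> p x else 0)" for p x
  have ev_in: "\<forall>\<^sub>F y in nhds x. \<theta> p y * \<rho> p y = \<psi> p y" if "p \<in> M" "x \<in> U p" for p x
    using U[OF that(1)] that(2) by (auto simp: eventually_nhds \<psi>_def)
  have out: "\<psi> p y = 0" if "p \<in> M" "y \<notin> cball p (2 * r p)" for p y
    using th[OF that(1), of y] that(2) by (simp add: \<psi>_def dist_commute)
  have s\<psi>: "smooth_at (\<psi> p) x" if "p \<in> M" for p x
  proof (cases "x \<in> U p")
    case True
    then have "smooth_at (\<lambda>y. \<theta> p y * \<rho> p y) x" using th \<rho> that by (intro smooth_at_mult) auto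
    then show ?thesis by (rule smooth_at_cong) (rule ev_in[OF that True])
  next
    case False
    then have "x \<in> - cball p (2 * r p)" using r[OF that] by blast
    then have "\<forall>\<^sub>F y in nhds x. 0 = \<psi> p y"
      unfolding eventually_nhds using out[OF that] by (intro exI[of _ "- cball p (2 * r p)"]) auto
    then show ?thesis by (rule smooth_at_cong[OF smooth_at_const])
  qed
  have \<psi>0: "\<psi> p x \<ge> 0" if "p \<in> M" for p x using th \<rho> that by (simp add: \<psi>_def)
  define R where "R x = (\<Sum>p\<in>F. \<psi> p x)" for x
  have sR: "smooth_at R x" for x
    unfolding R_def[abs_def] using s\<psi> F(1) by (intro smooth_at_sum) blast
  have R0: "R x \<ge> 0" for x unfolding R_def using \<psi>0 F(1) by (intro sum_nonneg) blast
  have posM: "lap_pos R x" if "x \<in> M" "x \<notin> S" for x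
    unfolding lap_pos_def
  proof (intro allI impI)
    fix v :: "complex ^ 'n" assume "v \<noteq> 0"
    have l: "lap (\<psi> p) x v = (if x \<in> U p then \<theta> p x * lap (\<rho> p) x v else 0)" if p: "p \<in> F" for p
    proof (cases "x \<in> U p")
      case True
      have pM: "p \<in> M" using p F(1) by blast
      have "lap (\<psi> p) x v = lap (\<lambda>y. \<theta> p y * \<rho> p y) x v"
        using lap_cong_ev[OF ev_in[OF pM True]] by simp
      also have "\<dots> = \<theta> p x * lap (\<rho> p) x v"
        by (rule lap_mult_at_zero[where U = "U p"]) (use th \<rho> U pM True \<open>x \<in> M\<close> in auto)
      finally show ?thesis using True by simp
    next
      case False
      have pM: "p \<in> M" using p F(1) by blast
      have "x \<in> - cball p (2 * r p)" using r[OF pM] False by blast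
      then have "\<forall>\<^sub>F y in nhds x. \<psi> p y = 0"
        unfolding eventually_nhds using out[OF pM] by (intro exI[of _ "- cball p (2 * r p)"]) auto
      then show ?thesis using False lap_cong_ev[of "\<psi> p" "\<lambda>y. 0" x v] by simp
    qed
    have nn: "lap (\<psi> p) x v \<ge> 0" if "p \<in> F" for p
    proof -
      have pM: "p \<in> M" using that F(1) by blast
      have "lap (\<rho> p) x v \<ge> 0" if "x \<in> U p"
        using pos[OF pM that \<open>x \<in> M\<close> \<open>x \<notin> S\<close>] \<open>v \<noteq> 0\<close> by (simp add: lap_pos_def less_imp_le)
      then show ?thesis using l[OF that] th[OF pM, of x] by simp
    qed
    obtain p where p: "p \<in> F" "x \<in> ball p (r p)" using F(4) \<open>x \<in> M\<close> by blast
    have pM: "p \<in> M" using p F(1) by blast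
    have "x \<in> U p" using r[OF pM] p(2) by auto
    then have "lap (\<psi> p) x v > 0"
      using l[OF p(1)] th[OF pM, of x] p(2) pos[OF pM _ \<open>x \<in> M\<close> \<open>x \<notin> S\<close>] \<open>v \<noteq> 0\<close>
      by (simp add: dist_commute lap_pos_def)
    then have "(\<Sum>p\<in>F. lap (\<psi> p) x v) > 0"
      using nn p(1) F(2) by (intro sum_pos2) auto
    then show "lap R x v > 0"
      unfolding R_def[abs_def] using s\<psi> F(1) by (subst lap_sum) auto
  qed
  \<comment> \<open>For singular \<open>p\<close>, all other summands vanish on \<open>N p\<close>
    and the bump of \<open>p\<close> is 1, so \<open>R\<close> coincides with
    \<open>\<rho> p\<close> there and no cutoff disturbs the explicit estimate.\<close>
  define N where "N p = ball p (r p) \<inter> (\<Inter>q\<in>F - {p}. - cball q (2 * r q))" for p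
  have oN: "open (N p)" for p unfolding N_def using F(2) by (intro open_Int open_INT) auto
  have pN: "p \<in> N p" if "p \<in> S" for p
  proof -
    have "p \<notin> cball q (2 * r q)" if "q \<in> F" "q \<noteq> p" for q
      using r[of q] US[of q] that \<open>p \<in> S\<close> F(1) by blast
    moreover have "r p > 0" using r that M(2) by blast
    ultimately show ?thesis by (simp add: N_def)
  qed
  have posN: "lap_pos R x" if "p \<in> S" "x \<in> N p" "x \<noteq> p" for p x
  proof -
    have pM: "p \<in> M" "p \<in> F" using that M(2) F(3) by auto
    have "R y = \<rho> p y" if "y \<in> N p" for y
    proof -
      have "\<psi> q y = 0" if "q \<in> F - {p}" for q
        using that \<open>y \<in> N p\<close> out[of q y] F(1) by (auto simp: N_def)
      then have "R y = \<psi> p y"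
        unfolding R_def using pM F(2) by (simp add: sum.remove[of F p])
      moreover have "y \<in> ball p (r p)" using that by (simp add: N_def)
      moreover from this have "y \<in> U p" using r[OF pM(1)] by auto
      ultimately show ?thesis using th[OF pM(1), of y] by (simp add: \<psi>_def dist_commute)
    qed
    then have "\<forall>\<^sub>F y in nhds x. R y = \<rho> p y"
      using oN that(2) unfolding eventually_nhds by blast
    moreover have "x \<in> U p" using that(2) r[OF pM(1)] by (auto simp: N_def)
    ultimately show ?thesis using posS[OF that(1) _ that(3)] by (simp add: lap_pos_def lap_cong_ev)
  qed
  show thesis
  \<comment> \<open>Positivity may fail at the points of \<open>S\<close> themselves; the sets
    \<open>N p\<close> keep them inside the open set.\<close>
  proof (rule that[of "(\<Union>p\<in>F. ball p (r p)) \<inter> ({x \<in> UNIV. lap_pos R x} \<union> (\<Union>p\<in>S. N p))" R])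
    show "open ((\<Union>p\<in>F. ball p (r p)) \<inter> ({x \<in> UNIV. lap_pos R x} \<union> (\<Union>p\<in>S. N p)))"
      by (intro open_Int open_Un open_UN ballI open_lap_pos oN sR open_UNIV open_ball)
    show "M \<subseteq> (\<Union>p\<in>F. ball p (r p)) \<inter> ({x \<in> UNIV. lap_pos R x} \<union> (\<Union>p\<in>S. N p))"
      using F(4) posM pN by blast
    show "R x = 0 \<longleftrightarrow> x \<in> M" if x: "x \<in> (\<Union>p\<in>F. ball p (r p)) \<inter> ({x \<in> UNIV. lap_pos R x} \<union> (\<Union>p\<in>S. N p))" for x
    proof
      assume "R x = 0"
      then have z: "\<psi> p x = 0" if "p \<in> F" for p
        using that \<psi>0 F(1,2) unfolding R_def by (subst (asm) sum_nonneg_eq_0_iff) auto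
      obtain p where p: "p \<in> F" "x \<in> ball p (r p)" using x by blast
      have pM: "p \<in> M" using p F(1) by blast
      have "x \<in> U p" using r[OF pM] p(2) by auto
      then show "x \<in> M" using z[OF p(1)] th[OF pM, of x] \<rho>[OF pM] p(2) by (simp add: \<psi>_def dist_commute)
    next
      assume "x \<in> M"
      then have "\<psi> p x = 0" if "p \<in> F" for p using \<rho> that F(1) by (auto simp: \<psi>_def)
      then show "R x = 0" by (simp add: R_def)
    qed
    show "lap_pos R x" if "x \<in> (\<Union>p\<in>F. ball p (r p)) \<inter> ({x \<in> UNIV. lap_pos R x} \<union> (\<Union>p\<in>S. N p)) - S" for x
      using that posN by blast
  qed (use sR R0 in auto)
qed

lemma BC_defining_function:
  fixes M :: "(complex ^ 'n::finite) set"
  assumes "k > 1" "bij_betw c {0..<3 * k - 1} (UNIV :: 'n set)" "smooth_submanifold d M" "compact M"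
    "S \<subseteq> M" "finite S" "\<And>p. p \<in> M - S \<Longrightarrow> totally_real_at M p" "\<And>p. p \<in> S \<Longrightarrow> generic_CR_singularity k c M p"
  obtains U \<rho> where "open U" "M \<subseteq> U" "\<And>x. smooth_at \<rho> x" "\<And>x. \<rho> x \<ge> (0::real)"
    "\<And>x. x \<in> U \<Longrightarrow> \<rho> x = 0 \<longleftrightarrow> x \<in> M" "\<And>x. x \<in> U - S \<Longrightarrow> lap_pos \<rho> x"
proof (rule global_defining_function[OF assms(4-6)])
  fix p assume "p \<in> M"
  have "open (- (S - {p}))" using assms(6) by (intro open_Compl finite_imp_closed) auto
  then obtain N where N: "open N" "p \<in> N" "N \<inter> S \<subseteq> {p}" by (rule that[of "- (S - {p})"]) auto
  show "\<exists>U \<rho>. local_defining M S p U \<rho>"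
  proof (cases "p \<in> S")
    case True
    obtain U \<rho> where "open U" "p \<in> U" "\<And>x. x \<in> U \<Longrightarrow> smooth_at \<rho> x" "\<And>x. x \<in> U \<Longrightarrow> \<rho> x \<ge> (0::real)"
      "\<And>x. x \<in> U \<Longrightarrow> \<rho> x = 0 \<longleftrightarrow> x \<in> M" "\<And>x. x \<in> U \<Longrightarrow> x \<noteq> p \<Longrightarrow> lap_pos \<rho> x"
      using local_defining_function_singular[OF assms(1,2) assms(8)[OF True]] by metis
    then show ?thesis using N True
      by (intro exI[of _ "U \<inter> N"] exI[of _ \<rho>]) (auto simp: local_defining_def)
  next
    case False
    obtain U \<rho> where "open U" "p \<in> U" "\<And>x. x \<in> U \<Longrightarrow> smooth_at \<rho> x" "\<And>x. x \<in> U \<Longrightarrow> \<rho> x \<ge> (0::real)"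
      "\<And>x. x \<in> U \<Longrightarrow> \<rho> x = 0 \<longleftrightarrow> x \<in> M" "\<And>x. x \<in> U \<Longrightarrow> x \<in> M \<Longrightarrow> totally_real_at M x \<Longrightarrow> lap_pos \<rho> x"
      using local_defining_function_totally_real[OF assms(3) \<open>p \<in> M\<close>] by metis
    then show ?thesis using N False assms(7)
      by (intro exI[of _ "U \<inter> N"] exI[of _ \<rho>]) (auto simp: local_defining_def)
  qed
qed (rule that)

section \<open>Plurisubharmonic functions\<close>

lemma smooth_polar_derivatives:
  fixes h :: "complex \<Rightarrow> real"
  assumes "\<And>\<xi>. smooth_at h \<xi>"
  shows "((\<lambda>r. h (of_real r * cis t)) has_real_derivative
      cos t * dder h (of_real r * cis t) 1 + sin t * dder h (of_real r * cis t) \<i>) (at r)"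
    and "((\<lambda>t. h (of_real r * cis t)) has_real_derivative
      r * (cos t * dder h (of_real r * cis t) \<i> - sin t * dder h (of_real r * cis t) 1)) (at t)"
proof -
  have lin: "dder h \<xi> (Complex a b) = a * dder h \<xi> 1 + b * dder h \<xi> \<i>" for \<xi> a b
  proof -
    have "Complex a b = a *\<^sub>R 1 + b *\<^sub>R \<i>" by (simp add: complex_eq_iff)
    then show ?thesis using linear_dder_at[OF assms] by (simp add: linear_add linear_cmul)
  qed
  have "((\<lambda>r. h (of_real r * cis t)) has_derivative (\<lambda>s. dder h (of_real r * cis t) (of_real s * cis t))) (at r)"
    by (rule has_derivative_compose[where g = h, OF _ smooth_at_has_derivative[OF assms]])
      (auto intro!: derivative_eq_intros)
  moreover have "dder h \<xi> (of_real s * cis t) = (cos t * dder h \<xi> 1 + sin t * dder h \<xi> \<i>) * s" for \<xi> s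
  proof -
    have "of_real s * cis t = Complex (s * cos t) (s * sin t)" by (simp add: complex_eq_iff)
    then show ?thesis by (simp add: lin algebra_simps)
  qed
  ultimately show "((\<lambda>r. h (of_real r * cis t)) has_real_derivative
      cos t * dder h (of_real r * cis t) 1 + sin t * dder h (of_real r * cis t) \<i>) (at r)"
    by (simp add: has_field_derivative_def)
  have "((\<lambda>t. h (of_real r * cis t)) has_derivative (\<lambda>s. dder h (of_real r * cis t) (of_real r * (s *\<^sub>R (\<i> * cis t))))) (at t)"
    by (rule has_derivative_compose[where g = h, OF _ smooth_at_has_derivative[OF assms]])
      (auto intro!: derivative_eq_intros simp: scaleR_conv_of_real)
  moreover have "dder h \<xi> (of_real r * (s *\<^sub>R (\<i> * cis t))) = (r * (cos t * dder h \<xi> \<i> - sin t * dder h \<xi> 1)) * s" for \<xi> s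
  proof -
    have "of_real r * (s *\<^sub>R (\<i> * cis t)) = Complex (- r * s * sin t) (r * s * cos t)" by (simp add: complex_eq_iff)
    then show ?thesis by (simp add: lin algebra_simps)
  qed
  ultimately show "((\<lambda>t. h (of_real r * cis t)) has_real_derivative
      r * (cos t * dder h (of_real r * cis t) \<i> - sin t * dder h (of_real r * cis t) 1)) (at t)"
    by (simp add: has_field_derivative_def)
qed

text \<open>The circular mean \<open>m\<close> satisfies \<open>r (r m')' = r\<^sup>2 \<integral> \<Delta> h \<ge> 0\<close>, because the term
  \<open>\<partial>\<^sup>2 h / \<partial>t\<^sup>2\<close> of the Laplacian in polar coordinates integrates to zero over the circle.\<close>

lemma sub_mean_value:
  fixes h :: "complex \<Rightarrow> real"
  assumes s: "\<And>\<xi>. smooth_at h \<xi>" and L: "\<And>\<xi>. dder2 h \<xi> 1 1 + dder2 h \<xi> \<i> \<i> \<ge> 0"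
  shows "2 * pi * h 0 \<le> integral {0..2 * pi} (\<lambda>t. h (cis t))"
proof -
  define e where "e r t = of_real r * cis t" for r t
  define m where "m r = integral (cbox 0 (2 * pi)) (\<lambda>t. h (e r t))" for r
  define n where "n r t = cos t * dder h (e r t) 1 + sin t * dder h (e r t) \<i>" for r t
  define w where "w r t = r * (cos t * dder h (e r t) \<i> - sin t * dder h (e r t) 1)" for r t
  define nr where "nr r t = cos t * (cos t * dder2 h (e r t) 1 1 + sin t * dder2 h (e r t) \<i> 1)
      + sin t * (cos t * dder2 h (e r t) 1 \<i> + sin t * dder2 h (e r t) \<i> \<i>)" for r t
  \<comment> \<open>This is the second angular derivative, from \<open>r^2 \<Delta> h = r
    \<partial>_r (r \<partial>_r h) + \<partial>_t^2 h\<close>; \<open>n\<close> and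
    \<open>w\<close> are the first radial and angular derivatives.\<close>
  define wt where "wt r t = r\<^sup>2 * (dder2 h (e r t) 1 1 + dder2 h (e r t) \<i> \<i>) - r * (n r t + r * nr r t)" for r t
  have s1: "smooth_at (\<lambda>\<xi>. dder h \<xi> u) \<xi>" for u \<xi> by (rule smooth_at_dder[OF s])
  have cont: "continuous_on A (\<lambda>p. k (e (fst p) (snd p)))" if "\<And>\<xi>. smooth_at k \<xi>" for k :: "complex \<Rightarrow> real" and A
  proof -
    have "continuous_on UNIV k" by (intro continuous_at_imp_continuous_on ballI smooth_at_continuous that)
    then show ?thesis unfolding e_def by (rule continuous_on_compose2) (auto intro!: continuous_intros)
  qed
  have s2: "smooth_at (\<lambda>\<xi>. dder2 h \<xi> u v) \<xi>" for u v \<xi> by (rule smooth_at_dder2[OF s])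
  have cont_n: "continuous_on A (\<lambda>p. n (fst p) (snd p))" for A
    unfolding n_def by (intro continuous_intros cont s1)
  have cont_nr: "continuous_on A (\<lambda>p. nr (fst p) (snd p))" for A
    unfolding nr_def by (intro continuous_intros cont s2)
  have slice: "continuous_on A (\<lambda>t. k r t)" if "\<And>A. continuous_on A (\<lambda>p. k (fst p) (snd p))"
    for k :: "real \<Rightarrow> real \<Rightarrow> real" and r A
  proof -
    have "continuous_on A (\<lambda>t. (r, t))" by (intro continuous_on_Pair continuous_on_const continuous_on_id)
    from continuous_on_compose2[OF that[of UNIV] this] show ?thesis by simp
  qed
  have dm: "(m has_real_derivative integral (cbox 0 (2 * pi)) (n r)) (at r)" for r
    unfolding m_def
  proof (rule leibniz_rule_field_derivative[where U = UNIV])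
    show "((\<lambda>r. h (e r t)) has_real_derivative n r t) (at r)" for r t
      unfolding e_def n_def by (rule smooth_polar_derivatives(1)[OF s])
    show "(\<lambda>t. h (e r t)) integrable_on cbox 0 (2 * pi)" for r
      unfolding cbox_interval by (intro integrable_continuous_real slice cont s)
    show "continuous_on (UNIV \<times> cbox 0 (2 * pi)) (\<lambda>(r, t). n r t)"
      using cont_n by (simp add: case_prod_beta')
  qed simp_all
  have dn: "((\<lambda>r. integral (cbox 0 (2 * pi)) (\<lambda>t. r * n r t)) has_real_derivative
      integral (cbox 0 (2 * pi)) (\<lambda>t. n r t + r * nr r t)) (at r)" for r
  proof (rule leibniz_rule_field_derivative[where U = UNIV])
    show "((\<lambda>r. r * n r t) has_real_derivative (n r t + r * nr r t)) (at r)" for r t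
    proof -
      have "((\<lambda>r. n r t) has_real_derivative nr r t) (at r)"
        unfolding n_def nr_def dder2_def e_def
        by (intro DERIV_add DERIV_cmult smooth_polar_derivatives(1) s1)
      then show ?thesis by (auto intro!: derivative_eq_intros)
    qed
    show "(\<lambda>t. r * n r t) integrable_on cbox 0 (2 * pi)" for r
      unfolding cbox_interval by (intro integrable_continuous_real continuous_intros slice cont_n)
    show "continuous_on (UNIV \<times> cbox 0 (2 * pi)) (\<lambda>(r, t). n r t + r * nr r t)"
      unfolding case_prod_beta' by (intro continuous_intros cont_n cont_nr)
  qed simp_all
  have dw: "((w r) has_real_derivative wt r t) (at t)" for r t
  proof -
    have "((w r) has_real_derivative
       r * ((- sin t * dder h (e r t) \<i> + r * (cos t * dder2 h (e r t) \<i> \<i> - sin t * dder2 h (e r t) 1 \<i>) * cos t)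
        - (cos t * dder h (e r t) 1 + r * (cos t * dder2 h (e r t) \<i> 1 - sin t * dder2 h (e r t) 1 1) * sin t))) (at t)"
      unfolding w_def dder2_def e_def
      by (intro DERIV_cmult DERIV_diff DERIV_mult DERIV_cos DERIV_sin smooth_polar_derivatives(2) s1)
    moreover have "r * ((- sin t * dder h (e r t) \<i> + r * (cos t * dder2 h (e r t) \<i> \<i> - sin t * dder2 h (e r t) 1 \<i>) * cos t)
        - (cos t * dder h (e r t) 1 + r * (cos t * dder2 h (e r t) \<i> 1 - sin t * dder2 h (e r t) 1 1) * sin t)) = wt r t"
    proof -
      have "cos t * cos t + sin t * sin t = 1" using sin_cos_squared_add3[of t] by simp
      then show ?thesis unfolding wt_def n_def nr_def power2_eq_square by algebra
    qed
    ultimately show ?thesis by simp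
  qed
  have pn: "integral (cbox 0 (2 * pi)) (\<lambda>t. n r t + r * nr r t) \<ge> 0" if "r > 0" for r
  proof -
    have "(wt r has_integral (w r (2 * pi) - w r 0)) {0..2 * pi}"
      by (rule fundamental_theorem_of_calculus) (auto intro: dw DERIV_subset simp: has_real_derivative_iff_has_vector_derivative[symmetric])
    \<comment> \<open>Periodicity of the angular derivative makes the integral of \<open>wt\<close>
      vanish.\<close>
    moreover have "w r (2 * pi) = w r 0" by (simp add: w_def e_def cis.ctr complex_eq_iff)
    ultimately have "(wt r has_integral 0) {0..2 * pi}" by simp
    moreover have "((\<lambda>t. r * (n r t + r * nr r t)) has_integral r * integral (cbox 0 (2 * pi)) (\<lambda>t. n r t + r * nr r t)) {0..2 * pi}"
      unfolding cbox_interval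
      by (intro has_integral_mult_right integrable_integral integrable_continuous_real continuous_intros slice[OF cont_n] slice[OF cont_nr])
    ultimately have "((\<lambda>t. wt r t + r * (n r t + r * nr r t)) has_integral 0 + r * integral (cbox 0 (2 * pi)) (\<lambda>t. n r t + r * nr r t)) {0..2 * pi}"
      by (rule has_integral_add)
    then have "0 \<le> r * integral (cbox 0 (2 * pi)) (\<lambda>t. n r t + r * nr r t)"
      by (simp add: wt_def) (rule has_integral_nonneg, assumption, simp add: L)
    then show ?thesis using that by (simp add: zero_le_mult_iff)
  qed
  \<comment> \<open>The integral of \<open>r * n\<close> vanishes at \<open>r = 0\<close> and is
    nondecreasing. A second monotonicity argument then compares the mean at radius 1 with the value
    at the centre.\<close>
  have n0: "integral (cbox 0 (2 * pi)) (n r) \<ge> 0" if "r > 0" for r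
  proof -
    have "(\<lambda>r. integral (cbox 0 (2 * pi)) (\<lambda>t. r * n r t)) 0 \<le> (\<lambda>r. integral (cbox 0 (2 * pi)) (\<lambda>t. r * n r t)) r"
      by (rule DERIV_nonneg_imp_increasing_open) (use that dn pn in \<open>auto intro!: DERIV_isCont continuous_at_imp_continuous_on\<close>)
    then have "0 \<le> r * integral (cbox 0 (2 * pi)) (n r)" by simp
    then show ?thesis using that by (simp add: zero_le_mult_iff)
  qed
  have "m 0 \<le> m 1"
    by (rule DERIV_nonneg_imp_increasing_open) (use dm n0 in \<open>auto intro!: DERIV_isCont continuous_at_imp_continuous_on\<close>)
  then show ?thesis by (simp add: m_def e_def)
qed

text \<open>Since \<open>\<xi> \<mapsto> a + \<xi> v\<close> is affine, the planar Laplacian of the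
  restriction is \<open>lap \<phi>\<close> in direction \<open>v\<close>, and the claim reduces to
  one complex variable.\<close>

lemma plurisubharmonic_if_lap_nonneg:
  fixes \<phi> :: "complex ^ 'n::finite \<Rightarrow> real"
  assumes s: "\<And>x. smooth_at \<phi> x" and L: "\<And>x v. lap \<phi> x v \<ge> 0"
  shows "plurisubharmonic_on UNIV \<phi>"
  unfolding plurisubharmonic_on_def
proof (intro conjI allI impI)
  show "continuous_on UNIV \<phi>" by (intro continuous_at_imp_continuous_on ballI smooth_at_continuous s)
  fix a v :: "complex ^ 'n"
  define h where "h \<xi> = \<phi> (a + \<xi> *s v)" for \<xi>
  have l: "smooth_at (\<lambda>\<xi>. a + \<xi> *s v) \<xi>" for \<xi>
    by (intro smooth_at_add smooth_at_const smooth_at_linear bounded_linear_cvec_scale)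
  have d: "dder (\<lambda>\<xi>. a + \<xi> *s v) \<xi> u = u *s v" for \<xi> u
    by (rule dder_eq)
      (auto intro!: derivative_eq_intros bounded_linear_imp_has_derivative bounded_linear_cvec_scale)
  have "dder2 (\<lambda>\<xi>. a + \<xi> *s v) \<xi> u u' = 0" for \<xi> u u'
    by (simp add: dder2_def d)
  then have dd: "dder2 h \<xi> u u' = dder2 \<phi> (a + \<xi> *s v) (u *s v) (u' *s v)" for \<xi> u u'
    unfolding h_def[abs_def] using linear_0[OF linear_dder_at[OF s]]
    by (simp add: dder2_compose[OF l s] d)
  have "2 * pi * h 0 \<le> integral {0..2 * pi} (\<lambda>t. h (cis t))"
  proof (rule sub_mean_value)
    show "smooth_at h \<xi>" for \<xi> unfolding h_def[abs_def] by (rule smooth_at_compose[OF l s])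
    show "dder2 h \<xi> 1 1 + dder2 h \<xi> \<i> \<i> \<ge> 0" for \<xi>
      using L[of "a + \<xi> *s v" v] by (simp add: dd lap_def)
  qed
  then show "\<phi> a \<le> 1 / (2 * pi) * integral {0..2 * pi} (\<lambda>t. \<phi> (a + cis t *s v))"
    by (simp add: h_def field_simps)
qed

section \<open>Plurisubharmonic functions adapted to a convex set\<close>

lemma hol_on_const: "hol_on W (\<lambda>x. c)"
  by (rule hol_onI[where F' = "\<lambda>x v. 0"]) (auto intro: derivative_intros)

lemma hol_on_coord: "hol_on W (\<lambda>x. x $ i)"
  by (rule hol_onI[where F' = "\<lambda>x v. v $ i"])
    (auto intro!: bounded_linear_imp_has_derivative bounded_linear_vec_nth)

lemma hol_on_add:
  assumes "hol_on W f" "hol_on W g"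
  shows "hol_on W (\<lambda>x. f x + g x)"
proof (rule hol_onI)
  show "((\<lambda>x. f x + g x) has_derivative (\<lambda>v. dder f x v + dder g x v)) (at x)" if "x \<in> W" for x
    by (intro has_derivative_add hol_on_has_derivative[OF assms(1) that] hol_on_has_derivative[OF assms(2) that])
qed (use assms in \<open>simp add: hol_on_def algebra_simps\<close>)

lemma hol_on_mult:
  assumes "hol_on W f" "hol_on W g"
  shows "hol_on W (\<lambda>x. f x * g x)"
proof (rule hol_onI)
  show "((\<lambda>x. f x * g x) has_derivative (\<lambda>v. f x * dder g x v + dder f x v * g x)) (at x)" if "x \<in> W" for x
    by (intro has_derivative_mult hol_on_has_derivative[OF assms(1) that] hol_on_has_derivative[OF assms(2) that])
qed (use assms in \<open>simp add: hol_on_def algebra_simps\<close>)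

lemma hol_on_diff: "hol_on W f \<Longrightarrow> hol_on W g \<Longrightarrow> hol_on W (\<lambda>x. f x - g x)"
  using hol_on_add[OF _ hol_on_mult[OF hol_on_const[of W "-1"]], of f g] by simp

lemma hol_on_power: "hol_on W f \<Longrightarrow> hol_on W (\<lambda>x. f x ^ n)"
  by (induction n) (auto intro: hol_on_const hol_on_mult)

lemma hol_on_prod: "(\<And>i. i \<in> I \<Longrightarrow> hol_on W (f i)) \<Longrightarrow> hol_on W (\<lambda>x. \<Prod>i\<in>I. f i x)"
  by (induction I rule: infinite_finite_induct) (auto intro: hol_on_const hol_on_mult)

lemma hol_on_sum: "(\<And>i. i \<in> I \<Longrightarrow> hol_on W (f i)) \<Longrightarrow> hol_on W (\<lambda>x. \<Sum>i\<in>I. f i x)"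
  by (induction I rule: infinite_finite_induct) (auto intro: hol_on_const hol_on_add)

lemma holomorphic_polynomial_hol_on:
  assumes "holomorphic_polynomial P"
  shows "hol_on UNIV P"
proof -
  obtain A :: "('a \<Rightarrow> nat) set" and a where "P = (\<lambda>z. \<Sum>\<alpha>\<in>A. a \<alpha> * (\<Prod>i\<in>UNIV. (z $ i) ^ \<alpha> i))"
    using assms unfolding holomorphic_polynomial_def by blast
  then show ?thesis
    by (auto intro!: hol_on_sum hol_on_mult hol_on_prod hol_on_power hol_on_coord hol_on_const)
qed

text \<open>The real and imaginary part of \<open>P\<close> are harmonic on complex lines, so in the
  sum of their squares only the gradient terms survive in the Laplacian.\<close>

lemma cmod_square_jet:
  fixes P :: "complex ^ 'n::finite \<Rightarrow> complex"
  assumes "hol_on UNIV P"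
  shows "jet x v (\<lambda>y. (cmod (P y))\<^sup>2) ((cmod (P x))\<^sup>2) (2 * cnj (P x) * dder P x v) (4 * (cmod (dder P x v))\<^sup>2)"
proof -
  note s = hol_on_smooth_at[OF open_UNIV assms UNIV_I]
  have i: "dder P x (\<i> *s v) = \<i> * dder P x v" using assms by (simp add: hol_on_def)
  have lin: "smooth_at (\<lambda>y. l (P y)) x" "dder (\<lambda>y. l (P y)) x u = l (dder P x u)"
    "dder2 (\<lambda>y. l (P y)) x u u' = l (dder2 P x u u')"
    if l: "bounded_linear l" for l :: "complex \<Rightarrow> real" and u u'
    using smooth_at_linear_compose[OF l s] dder_smooth_compose[OF s smooth_at_linear[OF l]]
      dder2_compose[OF s smooth_at_linear[OF l]]
    by (simp_all add: dder_linear[OF l] dder2_linear[OF l])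
  have lap0: "lap (\<lambda>y. l (P y)) x v = 0" if l: "bounded_linear l" for l :: "complex \<Rightarrow> real"
  proof -
    have "lap (\<lambda>y. l (P y)) x v = l (lap P x v)"
      using bounded_linear.linear[OF l] by (simp add: lap_def lin(3)[OF l] linear_add)
    then show ?thesis
      using hol_on_lap[OF open_UNIV assms UNIV_I] bounded_linear.linear[OF l] by (simp add: linear_0)
  qed
  have "jet x v (\<lambda>y. Re (P y)) (Re (P x)) (dder P x v) 0"
    using lin(1,2)[OF bounded_linear_Re] lap0[OF bounded_linear_Re] by (simp add: jet_def cgrad_def i complex_eq_iff)
  moreover have "jet x v (\<lambda>y. Im (P y)) (Im (P x)) (- \<i> * dder P x v) 0"
    using lin(1,2)[OF bounded_linear_Im] lap0[OF bounded_linear_Im] by (simp add: jet_def cgrad_def i complex_eq_iff)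
  ultimately have "jet x v (\<lambda>y. (Re (P y))\<^sup>2 + (Im (P y))\<^sup>2) ((Re (P x))\<^sup>2 + (Im (P x))\<^sup>2)
      (2 * complex_of_real (Re (P x)) * dder P x v + 2 * complex_of_real (Im (P x)) * (- \<i> * dder P x v))
      ((2 * (cmod (dder P x v))\<^sup>2 + 2 * Re (P x) * 0) + (2 * (cmod (- \<i> * dder P x v))\<^sup>2 + 2 * Im (P x) * 0))"
    by (intro jet_add jet_square)
  then show ?thesis
    unfolding cmod_power2[of "P _"]
    by (rule jet_eq) (auto simp: norm_mult complex_eq_iff algebra_simps)
qed

lemma norm_square_jet:
  fixes x v :: "complex ^ 'n::finite"
  shows "\<exists>d. jet x v (\<lambda>y. (norm y)\<^sup>2) ((norm x)\<^sup>2) d (4 * (norm v)\<^sup>2)"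
proof -
  have eq: "(norm y)\<^sup>2 = (\<Sum>i\<in>UNIV. nsq i y)" for y :: "complex ^ 'n"
    by (simp add: norm_vec_def L2_set_def nsq_eq sum_nonneg)
  have s: "smooth_at (nsq i) x" "lap (nsq i) x v = 4 * nsq i v" for i
    using jet_nsq[of x v i] by (auto simp: jet_def nsq_eq)
  have "smooth_at (\<lambda>y. \<Sum>i\<in>UNIV. nsq i y) x" by (intro smooth_at_sum s)
  moreover have "lap (\<lambda>y. \<Sum>i\<in>UNIV. nsq i y) x v = 4 * (\<Sum>i\<in>UNIV. nsq i v)"
    by (simp add: lap_sum s sum_distrib_left)
  ultimately show ?thesis by (simp add: jet_def eq)
qed

section \<open>Ramps and the exhaustion of the complement\<close>

lemma convex_ramp_compose:
  assumes "smooth_at u x"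
  shows "smooth_at (\<lambda>y. convex_ramp (u y)) x"
    and "lap (\<lambda>y. convex_ramp (u y)) x v =
      flat_exp [:0, 0, 0, 1:] (u x) * (cmod (cgrad u x v))\<^sup>2 + flat_exp [:1, 1:] (u x) * lap u x v"
  by (rule smooth_at_compose[OF assms smooth_at_convex_ramp])
    (rule lap_compose_real[OF assms smooth_at_convex_ramp dder_convex_ramp dder2_convex_ramp])

lemma convex_ramp_compose_psh:
  fixes u :: "complex ^ 'n::finite \<Rightarrow> real"
  assumes "smooth_at u x" "\<And>v. v \<noteq> 0 \<Longrightarrow> lap u x v > 0"
  shows "lap (\<lambda>y. convex_ramp (u y)) x v \<ge> 0" and "u x > 0 \<Longrightarrow> lap_pos (\<lambda>y. convex_ramp (u y)) x"
    and "u x \<le> 0 \<Longrightarrow> lap (\<lambda>y. convex_ramp (u y)) x v = 0"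
proof -
  have "lap u x v \<ge> 0"
  proof (cases "v = 0")
    case True
    then show ?thesis using lap_scale[OF assms(1), of 0 v] by simp
  qed (use assms(2)[of v] in simp)
  then show "lap (\<lambda>y. convex_ramp (u y)) x v \<ge> 0"
    unfolding convex_ramp_compose(2)[OF assms(1)] by (simp add: flat_exp_coeffs_pos)
  show "lap_pos (\<lambda>y. convex_ramp (u y)) x" if "u x > 0"
    unfolding lap_pos_def convex_ramp_compose(2)[OF assms(1)]
    using assms(2) that by (auto simp: flat_exp_coeffs_pos intro!: add_nonneg_pos)
  show "lap (\<lambda>y. convex_ramp (u y)) x v = 0" if "u x \<le> 0"
    unfolding convex_ramp_compose(2)[OF assms(1)] using that by simp
qed

text \<open>One compactness argument for both kinds of convexity. \<open>Good\<close> holds the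
  properties stable under sums, \<open>Pos\<close> an open condition that adding good functions
  preserves. \<open>f0\<close> handles the outside of a ball; inside it the complement of
  \<open>W\<close> is compact and needs finitely many local functions.\<close>

lemma exhaust_by_sum:
  fixes M W :: "(complex ^ 'n::finite) set" and Good :: "(complex ^ 'n \<Rightarrow> real) \<Rightarrow> bool"
    and Pos :: "(complex ^ 'n \<Rightarrow> real) \<Rightarrow> complex ^ 'n \<Rightarrow> bool"
  assumes add: "\<And>f g. Good f \<Longrightarrow> Good g \<Longrightarrow> Good (\<lambda>x. f x + g x)"
    and pos1: "\<And>f g x. Good f \<Longrightarrow> Good g \<Longrightarrow> Pos f x \<Longrightarrow> Pos (\<lambda>x. f x + g x) x"
    and pos2: "\<And>f g x. Good f \<Longrightarrow> Good g \<Longrightarrow> Pos g x \<Longrightarrow> Pos (\<lambda>x. f x + g x) x"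
    and op: "\<And>f. Good f \<Longrightarrow> open {x. Pos f x}"
    and far: "Good f0" "\<And>x. norm x > R \<Longrightarrow> Pos f0 x"
    and loc: "\<And>x. x \<notin> M \<Longrightarrow> \<exists>f. Good f \<and> Pos f x"
    and W: "open W" "M \<subseteq> W"
  obtains f where "Good f" "\<And>x. x \<notin> W \<Longrightarrow> Pos f x"
proof -
  obtain f where f: "\<And>x. x \<notin> M \<Longrightarrow> Good (f x) \<and> Pos (f x) x" using loc by metis
  have "compact (cball 0 R - W)" using W(1) by (intro compact_diff compact_cball)
  moreover have "cball 0 R - W \<subseteq> (\<Union>x\<in>cball 0 R - W. {y. Pos (f x) y})" using f W(2) by blast
  moreover have "open {y. Pos (f x) y}" if "x \<in> cball 0 R - W" for x using that f W(2) op by blast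
  ultimately obtain F where F: "F \<subseteq> cball 0 R - W" "finite F" "cball 0 R - W \<subseteq> (\<Union>x\<in>F. {y. Pos (f x) y})"
    using compactE_image by metis
  have "\<exists>g. Good g \<and> (\<forall>y. (norm y > R \<or> y \<in> (\<Union>x\<in>F. {y. Pos (f x) y})) \<longrightarrow> Pos g y)"
    using F(2,1)
  proof (induction F)
    case empty
    then show ?case using far by auto
  next
    case (insert a F)
    then obtain g where g: "Good g" "\<And>y. norm y > R \<or> y \<in> (\<Union>x\<in>F. {y. Pos (f x) y}) \<Longrightarrow> Pos g y" by auto
    have "Good (f a)" using insert.prems f W(2) by blast
    then show ?case using g add pos1 pos2 by (intro exI[of _ "\<lambda>x. g x + f a x"]) auto
  qed
  then obtain g where g: "Good g" "\<And>y. norm y > R \<or> y \<in> (\<Union>x\<in>F. {y. Pos (f x) y}) \<Longrightarrow> Pos g y" by blast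
  show thesis
  proof (rule that[OF g(1)])
    fix x assume "x \<notin> W"
    then have "norm x > R \<or> x \<in> cball 0 R - W" by auto
    then show "Pos g x" using F(3) g(2)[of x] by blast
  qed
qed

lemma compact_norm_bound:
  fixes M :: "'a::real_normed_vector set"
  assumes "compact M"
  obtains R where "R > 0" "\<And>x. x \<in> M \<Longrightarrow> norm x \<le> R"
  using compact_imp_bounded[OF assms] by (metis bounded_pos)

lemma norm_square_minus:
  fixes x v :: "complex ^ 'n::finite"
  shows "smooth_at (\<lambda>y. (norm y)\<^sup>2 - r) x" and "v \<noteq> 0 \<Longrightarrow> lap (\<lambda>y. (norm y)\<^sup>2 - r) x v > 0"
proof -
  obtain d where "jet x v (\<lambda>y. (norm y)\<^sup>2) ((norm x)\<^sup>2) d (4 * (norm v)\<^sup>2)" using norm_square_jet by blast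
  from jet_diff[OF this jet_const]
  show "smooth_at (\<lambda>y. (norm y)\<^sup>2 - r) x" "v \<noteq> 0 \<Longrightarrow> lap (\<lambda>y. (norm y)\<^sup>2 - r) x v > 0"
    by (auto simp: jet_def)
qed

lemma lap_pos_addI:
  assumes "smooth_at f x" "smooth_at g x" "lap_pos f x" "\<And>v. lap g x v \<ge> 0"
  shows "lap_pos (\<lambda>x. f x + g x) x" "lap_pos (\<lambda>x. g x + f x) x"
  using assms by (auto simp: lap_pos_def lap_add add_pos_nonneg add_nonneg_pos)

lemma polynomially_convex_exhaustion:
  fixes M W :: "(complex ^ 'n::finite) set"
  assumes M: "compact M" "polynomially_convex M" and W: "open W" "M \<subseteq> W"
  obtains \<psi> :: "complex ^ 'n \<Rightarrow> real" where "\<And>x. smooth_at \<psi> x" "\<And>x v. lap \<psi> x v \<ge> 0" "\<And>x. \<psi> x \<ge> 0"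
    "\<And>x. x \<in> M \<Longrightarrow> \<psi> x = 0" "\<And>x. x \<notin> W \<Longrightarrow> \<psi> x > 0 \<and> lap_pos \<psi> x"
proof -
  define Good where "Good \<psi> \<longleftrightarrow> (\<forall>x. smooth_at \<psi> x \<and> (\<forall>v. lap \<psi> x v \<ge> 0) \<and> \<psi> x \<ge> 0) \<and> (\<forall>x\<in>M. \<psi> x = 0)"
    for \<psi> :: "complex ^ 'n \<Rightarrow> real"
  define Pos where "Pos \<psi> x \<longleftrightarrow> \<psi> x > 0 \<and> lap_pos \<psi> x" for \<psi> :: "complex ^ 'n \<Rightarrow> real" and x
  obtain R where R: "R > 0" "\<And>x. x \<in> M \<Longrightarrow> norm x \<le> R" by (rule compact_norm_bound[OF M(1)]) blast
  have ramp: "Good (\<lambda>y. convex_ramp (u y)) \<and> (\<forall>x. u x > 0 \<longrightarrow> Pos (\<lambda>y. convex_ramp (u y)) x)"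
    if "\<And>x. smooth_at u x" "\<And>x v. v \<noteq> 0 \<Longrightarrow> lap u x v > 0" "\<And>x. x \<in> M \<Longrightarrow> u x \<le> 0" for u
    unfolding Good_def Pos_def
    using convex_ramp_compose(1)[OF that(1)] convex_ramp_compose_psh(1,2)[OF that(1,2)] that(3)
    by (simp add: convex_ramp_nonneg convex_ramp_pos convex_ramp_zero)
  have far: "Good (\<lambda>y. convex_ramp ((norm y)\<^sup>2 - R\<^sup>2)) \<and> (\<forall>x. (norm x)\<^sup>2 - R\<^sup>2 > 0 \<longrightarrow> Pos (\<lambda>y. convex_ramp ((norm y)\<^sup>2 - R\<^sup>2)) x)"
    by (rule ramp) (use norm_square_minus R in \<open>auto intro!: power_mono\<close>)
  obtain \<psi> where \<psi>: "Good \<psi>" "\<And>x. x \<notin> W \<Longrightarrow> Pos \<psi> x"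
  proof (rule exhaust_by_sum[of Good Pos "\<lambda>y. convex_ramp ((norm y)\<^sup>2 - R\<^sup>2)" R M W])
    show "Good (\<lambda>x. f x + g x)" if "Good f" "Good g" for f g
      using that by (auto simp: Good_def lap_add)
    show "Pos (\<lambda>x. f x + g x) x" if "Good f" "Good g" "Pos f x" for f g x
      using that lap_pos_addI(1)[of f x g] by (auto simp: Good_def Pos_def add_pos_nonneg)
    show "Pos (\<lambda>x. f x + g x) x" if "Good f" "Good g" "Pos g x" for f g x
      using that lap_pos_addI(2)[of g x f] by (auto simp: Good_def Pos_def add_nonneg_pos)
    show "open {x. Pos f x}" if "Good f" for f
    proof -
      have "\<forall>x. smooth_at f x" using that by (simp add: Good_def)
      then have "open {x. 0 < f x}" "open {x. lap_pos f x}"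
        using open_lap_pos[OF open_UNIV, of f]
        by (auto intro!: open_Collect_less continuous_intros continuous_at_imp_continuous_on smooth_at_continuous)
      then show ?thesis unfolding Pos_def by (rule open_Collect_conj)
    qed
    show "Good (\<lambda>y. convex_ramp ((norm y)\<^sup>2 - R\<^sup>2))" using far by blast
    show "Pos (\<lambda>y. convex_ramp ((norm y)\<^sup>2 - R\<^sup>2)) x" if "norm x > R" for x
      using far that R(1) by (auto simp: power_strict_mono)
    fix x assume "x \<notin> M"
    then have "x \<notin> polynomial_hull M" using M(2) by (simp add: polynomially_convex_def)
    then obtain P where P: "holomorphic_polynomial P" "cmod (P x) > (SUP y\<in>M. cmod (P y))"
      by (auto simp: polynomial_hull_def not_le)
    note hol = holomorphic_polynomial_hol_on[OF P(1)]
    have "bdd_above ((\<lambda>y. cmod (P y)) ` M)"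
      using M(1) continuous_on_subset[OF hol_on_continuous[OF hol]]
      by (intro bounded_imp_bdd_above compact_imp_bounded compact_continuous_image continuous_intros) auto
    then have le: "cmod (P y) \<le> (SUP y\<in>M. cmod (P y))" if "y \<in> M" for y
      using that by (rule cSUP_upper[rotated])
    \<comment> \<open>The empty set is treated apart, because its supremum gives no lower bound 0
      with which to square the strict inequality.\<close>
    obtain d where d: "d > 0" "\<And>y. y \<in> M \<Longrightarrow> (cmod (P y))\<^sup>2 + d \<le> (cmod (P x))\<^sup>2"
    proof (cases "M = {}")
      case True
      then show ?thesis using that[of 1] by simp
    next
      case False
      then have s0: "(SUP y\<in>M. cmod (P y)) \<ge> 0" using le norm_ge_zero order_trans by (metis ex_in_conv)
      show ?thesis
      proof (rule that[of "(cmod (P x))\<^sup>2 - (SUP y\<in>M. cmod (P y))\<^sup>2"])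
        show "0 < (cmod (P x))\<^sup>2 - (SUP y\<in>M. cmod (P y))\<^sup>2"
          using power_strict_mono[OF P(2) s0, of 2] by simp
        show "(cmod (P y))\<^sup>2 + ((cmod (P x))\<^sup>2 - (SUP y\<in>M. cmod (P y))\<^sup>2) \<le> (cmod (P x))\<^sup>2" if "y \<in> M" for y
          using power_mono[OF le[OF that], of 2] by simp
      qed
    qed
    \<comment> \<open>On \<open>M\<close> the added term \<open>\<epsilon> |y|^2\<close> is then at
      most \<open>d / 2\<close>, half of the gap between \<open>|P|^2\<close> on \<open>M\<close>
      and at \<open>x\<close>; the threshold in \<open>u\<close> sits in the middle of the
      gap.\<close>
    define \<epsilon> where "\<epsilon> = d / (2 * R\<^sup>2)"
    have \<epsilon>: "\<epsilon> > 0" "\<epsilon> * R\<^sup>2 = d / 2" using d(1) R(1) by (auto simp: \<epsilon>_def)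
    define u where "u y = (cmod (P y))\<^sup>2 + \<epsilon> * (norm y)\<^sup>2 - ((cmod (P x))\<^sup>2 - d / 2)" for y
    have ju: "\<exists>d. jet y v u (u y) d (4 * (cmod (dder P y v))\<^sup>2 + \<epsilon> * (4 * (norm v)\<^sup>2))" for y v
    proof -
      obtain e where e: "jet y v (\<lambda>y. (norm y)\<^sup>2) ((norm y)\<^sup>2) e (4 * (norm v)\<^sup>2)" using norm_square_jet by blast
      from jet_diff[OF jet_add[OF cmod_square_jet[OF hol] jet_cmult[OF e, of \<epsilon>]] jet_const[of y v "(cmod (P x))\<^sup>2 - d / 2"]]
      show ?thesis unfolding u_def by auto
    qed
    have "Good (\<lambda>y. convex_ramp (u y)) \<and> (\<forall>x. u x > 0 \<longrightarrow> Pos (\<lambda>y. convex_ramp (u y)) x)"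
    proof (rule ramp)
      show "smooth_at u y" for y using ju[of y 0] by (auto simp: jet_def)
      show "lap u y v > 0" if "v \<noteq> 0" for y v using ju[of y v] that \<epsilon>(1) by (auto simp: jet_def add_nonneg_pos)
      show "u y \<le> 0" if "y \<in> M" for y
      proof -
        have "\<epsilon> * (norm y)\<^sup>2 \<le> \<epsilon> * R\<^sup>2" using R(2)[OF that] \<epsilon>(1) by (intro mult_left_mono power_mono) auto
        then show ?thesis using d(2)[OF that] \<epsilon>(2) unfolding u_def by linarith
      qed
    qed
    moreover have "u x > 0" using \<epsilon>(1) d(1) by (simp add: u_def add_nonneg_pos)
    ultimately show "\<exists>f. Good f \<and> Pos f x" by blast
  qed (use W that in \<open>blast+\<close>)
  show thesis by (rule that[of \<psi>]) (use \<psi> in \<open>auto simp: Good_def Pos_def\<close>)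
qed

text \<open>A radial potential \<open>H (\<bar>w\<bar>\<^sup>2)\<close> on \<open>\<complex>\<close> with \<open>\<Delta> = 4 (s H')'\<close> at \<open>s = \<bar>w\<bar>\<^sup>2\<close>. The choice
  \<open>s H' = s / (s + e s)\<close>, where \<open>e\<close> vanishes for \<open>s \<ge> 2\<close>, makes it a constant plus \<open>2 ln \<bar>w\<bar>\<close> there.\<close>

lemma truncated_logarithm:
  obtains H h1 h2 :: "real \<Rightarrow> real" where
    "\<And>s. s > -1 \<Longrightarrow> smooth_at H s" "\<And>s v. s > -1 \<Longrightarrow> dder H s v = h1 s * v"
    "\<And>s v w. s > -1 \<Longrightarrow> dder2 H s v w = h2 s * v * w"
    "\<And>s. s \<ge> 0 \<Longrightarrow> s * h2 s + h1 s \<ge> 0" "\<And>s. s \<ge> 2 \<Longrightarrow> s * h2 s + h1 s = 0" "h1 0 > 0"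
proof -
  define den where "den s = s + convex_ramp (2 - s)" for s
  define h1 where "h1 s = 1 / den s" for s
  define h2 where "h2 s = - (1 - flat_exp [:1, 1:] (2 - s)) / (den s)\<^sup>2" for s
  \<comment> \<open>The base point -1 leaves room to the left of 0, so that \<open>H\<close> is
    smooth at \<open>s = 0\<close>, where \<open>\<bar>F\<bar>\<^sup>2\<close> takes its
    minimum.\<close>
  define H where "H s = integral {-1..s} h1" for s
  \<comment> \<open>With \<open>t = 2 - s\<close> this follows from
    \<open>t * exp (- 1 / t) \<ge> t - 1\<close>.\<close>
  have den: "den s \<ge> 1" for s
  proof (cases "s < 2")
    case True
    define t where "t = 2 - s"
    have "t > 0" using True by (simp add: t_def)
    have "1 - 1 / t \<le> exp (- (1 / t))" using exp_ge_add_one_self[of "- (1 / t)"] by simp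
    then have "t * (1 - 1 / t) \<le> t * exp (- (1 / t))" using \<open>t > 0\<close> by (intro mult_left_mono) auto
    moreover have "t * (1 - 1 / t) = t - 1" using \<open>t > 0\<close> by (simp add: field_simps)
    moreover have "den s = 2 - t + t * exp (- (1 / t))" using \<open>t > 0\<close> by (simp add: den_def t_def convex_ramp_def flat_exp_def)
    ultimately show ?thesis by simp
  qed (simp add: den_def convex_ramp_zero)
  have sden: "smooth_at den s" for s
    unfolding den_def
    by (intro smooth_at_add smooth_at_linear bounded_linear_ident smooth_at_compose[OF _ smooth_at_convex_ramp] smooth_at_diff smooth_at_const)
  have den0: "den s \<noteq> 0" for s using den[of s] by simp
  have sh1: "smooth_at h1 s" for s
    unfolding h1_def by (intro smooth_at_divide smooth_at_const sden den0)
  have dden: "(den has_real_derivative 1 - flat_exp [:1, 1:] (2 - s)) (at s)" for s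
    unfolding den_def
    by (auto intro!: derivative_eq_intros DERIV_chain2[OF convex_ramp_has_derivative])
  have dh1: "(h1 has_real_derivative h2 s) (at s)" for s
    unfolding h1_def h2_def using den0
    by (auto intro!: derivative_eq_intros dden simp: power2_eq_square)
  have dH: "(H has_real_derivative h1 s) (at s)" if "s > -1" for s
  proof -
    have "continuous_on {-1..s + 1} h1" by (intro continuous_at_imp_continuous_on ballI smooth_at_continuous sh1)
    then have "(H has_real_derivative h1 s) (at s within {-1..s + 1})"
      unfolding H_def by (rule integral_has_real_derivative) (use that in auto)
    moreover have "s \<in> interior {-1..s + 1}" using that by simp
    ultimately show ?thesis using at_within_interior by metis
  qed
  have sH: "smooth_at H s" if "s > -1" for s
  proof -
    have "Ck_on m {-1<..} H" for m
    proof (cases m)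
      case 0
      have "continuous_on {-1<..} H"
        by (rule DERIV_continuous_on) (use dH in \<open>auto intro: DERIV_subset\<close>)
      then show ?thesis using 0 by simp
    next
      case (Suc n)
      have "Ck_on n {-1<..} h1"
        using sh1 smooth_on_iff_smooth_at[of "{-1<..}" h1] by (simp add: smooth_on_def)
      then have "Ck_on n {-1<..} (\<lambda>s. h1 s * v)" for v
        by (intro Ck_on_bilinear[OF bounded_bilinear_mult] Ck_on_const) auto
      then show ?thesis unfolding Suc
        by (intro Ck_on_SucI[where f' = "\<lambda>s v. h1 s * v"]) (use dH in \<open>auto simp: has_field_derivative_def\<close>)
    qed
    then show ?thesis using that unfolding smooth_at_def smooth_on_def by (intro exI[of _ "{-1<..}"]) auto
  qed
  have dd: "dder H s v = h1 s * v" if "s > -1" for s v by (rule dder_field[OF dH[OF that]])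
  show thesis
  proof (rule that[of H h1 h2])
    show "dder2 H s v w = h2 s * v * w" if "s > -1" for s v w
    proof -
      have "\<forall>\<^sub>F y in nhds s. dder H y w = h1 y * w"
        unfolding eventually_nhds using dd that by (intro exI[of _ "{-1<..}"]) auto
      then have "dder2 H s v w = dder (\<lambda>y. h1 y * w) s v" unfolding dder2_def by (rule dder_cong_ev)
      also have "\<dots> = h2 s * w * v" by (rule dder_field) (intro DERIV_cmult_right dh1)
      finally show ?thesis by simp
    qed
    have eq: "s * h2 s + h1 s = (convex_ramp (2 - s) + s * flat_exp [:1, 1:] (2 - s)) / (den s)\<^sup>2" for s
    proof -
      have "h1 s = den s / (den s)\<^sup>2" using den0 by (simp add: h1_def power2_eq_square)
      moreover have "s * h2 s = (- (s * (1 - flat_exp [:1, 1:] (2 - s)))) / (den s)\<^sup>2"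
        unfolding h2_def by (simp only: times_divide_eq_right mult_minus_right)
      ultimately have "s * h2 s + h1 s = (- (s * (1 - flat_exp [:1, 1:] (2 - s))) + den s) / (den s)\<^sup>2"
        by (simp only: add_divide_distrib)
      then show ?thesis by (simp add: den_def algebra_simps)
    qed
    show "s * h2 s + h1 s \<ge> 0" if "s \<ge> 0" for s
      unfolding eq using that flat_exp_coeffs_pos(1)[of "2 - s"] convex_ramp_nonneg[of "2 - s"] by simp
    show "s * h2 s + h1 s = 0" if "s \<ge> 2" for s
      unfolding eq using that by (simp add: convex_ramp_zero)
    show "h1 0 > 0" using den[of 0] by (simp add: h1_def)
  qed (use sH dd in auto)
qed

lemma rationally_convex_exhaustion:
  fixes M W :: "(complex ^ 'n::finite) set"
  assumes M: "compact M" "rationally_convex M" and W: "open W" "M \<subseteq> W"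
  obtains \<psi> :: "complex ^ 'n \<Rightarrow> real" where "\<And>x. smooth_at \<psi> x" "\<And>x v. lap \<psi> x v \<ge> 0"
    "\<And>x v. x \<in> M \<Longrightarrow> lap \<psi> x v = 0" "\<And>x. x \<notin> W \<Longrightarrow> lap_pos \<psi> x"
proof -
  define Good where "Good \<psi> \<longleftrightarrow> (\<forall>x. smooth_at \<psi> x \<and> (\<forall>v. lap \<psi> x v \<ge> 0)) \<and> (\<forall>x\<in>M. \<forall>v. lap \<psi> x v = 0)"
    for \<psi> :: "complex ^ 'n \<Rightarrow> real"
  obtain R where R: "R > 0" "\<And>x. x \<in> M \<Longrightarrow> norm x \<le> R" by (rule compact_norm_bound[OF M(1)]) blast
  obtain H h1 h2 :: "real \<Rightarrow> real" where H: "\<And>s. s > -1 \<Longrightarrow> smooth_at H s" "\<And>s v. s > -1 \<Longrightarrow> dder H s v = h1 s * v"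
    "\<And>s v w. s > -1 \<Longrightarrow> dder2 H s v w = h2 s * v * w"
    and h: "\<And>s. s \<ge> 0 \<Longrightarrow> s * h2 s + h1 s \<ge> 0" "\<And>s. s \<ge> 2 \<Longrightarrow> s * h2 s + h1 s = 0" "h1 0 > 0"
    by (rule truncated_logarithm) blast
  have comp: "smooth_at (\<lambda>y. H ((cmod (Q y))\<^sup>2)) x \<and> lap (\<lambda>y. H ((cmod (Q y))\<^sup>2)) x v =
      4 * (cmod (dder Q x v))\<^sup>2 * ((cmod (Q x))\<^sup>2 * h2 ((cmod (Q x))\<^sup>2) + h1 ((cmod (Q x))\<^sup>2))"
    if "hol_on UNIV Q" for Q :: "complex ^ 'n \<Rightarrow> complex" and x v
  proof -
    have g: "(cmod (Q x))\<^sup>2 > -1" by (rule less_le_trans[of _ 0]) auto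
    have j: "smooth_at (\<lambda>y. (cmod (Q y))\<^sup>2) x" "cgrad (\<lambda>y. (cmod (Q y))\<^sup>2) x v = 2 * cnj (Q x) * dder Q x v"
      "lap (\<lambda>y. (cmod (Q y))\<^sup>2) x v = 4 * (cmod (dder Q x v))\<^sup>2"
      using cmod_square_jet[OF that, of x v] by (auto simp: jet_def)
    show ?thesis
      using smooth_at_compose[OF j(1) H(1)[OF g]] lap_compose_real[OF j(1) H(1)[OF g] H(2)[OF g] H(3)[OF g], of v]
      unfolding j by (simp add: norm_mult power_mult_distrib algebra_simps)
  qed
  obtain \<psi> where \<psi>: "Good \<psi>" "\<And>x. x \<notin> W \<Longrightarrow> lap_pos \<psi> x"
  proof (rule exhaust_by_sum[of Good lap_pos "\<lambda>y. convex_ramp ((norm y)\<^sup>2 - R\<^sup>2)" R M W])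
    show "Good (\<lambda>x. f x + g x)" if "Good f" "Good g" for f g
      using that by (auto simp: Good_def lap_add)
    show "lap_pos (\<lambda>x. f x + g x) x" if "Good f" "Good g" "lap_pos f x" for f g x
      using that lap_pos_addI(1)[of f x g] by (auto simp: Good_def)
    show "lap_pos (\<lambda>x. f x + g x) x" if "Good f" "Good g" "lap_pos g x" for f g x
      using that lap_pos_addI(2)[of g x f] by (auto simp: Good_def)
    show "open {x. lap_pos f x}" if "Good f" for f
      using that open_lap_pos[OF open_UNIV, of f] by (simp add: Good_def)
    note ramp = convex_ramp_compose_psh[OF norm_square_minus(1,2)]
    show "Good (\<lambda>y. convex_ramp ((norm y)\<^sup>2 - R\<^sup>2))"
    proof -
      have "(norm x)\<^sup>2 - R\<^sup>2 \<le> 0" if "x \<in> M" for x using power_mono[OF R(2)[OF that], of 2] by simp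
      then show ?thesis
        unfolding Good_def using ramp(1,3) convex_ramp_compose(1)[OF norm_square_minus(1)] by blast
    qed
    show "lap_pos (\<lambda>y. convex_ramp ((norm y)\<^sup>2 - R\<^sup>2)) x" if "norm x > R" for x
    proof (rule ramp(2))
      show "0 < (norm x)\<^sup>2 - R\<^sup>2" using power_strict_mono[OF that, of 2] R(1) by simp
    qed
    fix x assume "x \<notin> M"
    then have "x \<notin> rational_hull M" using M(2) by (simp add: rationally_convex_def)
    then obtain P Q where PQ: "holomorphic_polynomial P" "holomorphic_polynomial Q" "\<And>y. y \<in> M \<Longrightarrow> Q y \<noteq> 0" "Q x \<noteq> 0"
      "cmod (P x / Q x) > (SUP y\<in>M. cmod (P y / Q y))"
      by (auto simp: rational_hull_def not_le)
    note hol = holomorphic_polynomial_hol_on[OF PQ(1)] holomorphic_polynomial_hol_on[OF PQ(2)]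
    have "bdd_above ((\<lambda>y. cmod (P y / Q y)) ` M)"
      using M(1) PQ(3) continuous_on_subset[OF hol_on_continuous[OF hol(1)]] continuous_on_subset[OF hol_on_continuous[OF hol(2)]]
      by (intro bounded_imp_bdd_above compact_imp_bounded compact_continuous_image continuous_intros) auto
    then have le: "cmod (P y / Q y) \<le> (SUP y\<in>M. cmod (P y / Q y))" if "y \<in> M" for y
      using that by (rule cSUP_upper[rotated])
    \<comment> \<open>A polynomial that vanishes at \<open>x\<close>. A zero on \<open>M\<close>
      would give \<open>P / Q\<close> the value \<open>P x / Q x\<close> there, against the
      supremum.\<close>
    define D where "D y = P y * Q x - P x * Q y" for y
    have D: "hol_on UNIV D" unfolding D_def by (intro hol_on_diff hol_on_mult hol hol_on_const)
    have Dx: "D x = 0" by (simp add: D_def)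
    have DM: "D y \<noteq> 0" if "y \<in> M" for y
    proof
      assume "D y = 0"
      then have "P y / Q y = P x / Q x" using PQ(3)[OF that] PQ(4) by (simp add: D_def field_simps)
      then show False using le[OF that] PQ(5) by simp
    qed
    obtain m where m: "m > 0" "\<And>y. y \<in> M \<Longrightarrow> cmod (D y) \<ge> m"
    proof (cases "M = {}")
      case True
      then show ?thesis using that[of 1] by simp
    next
      case False
      have "continuous_on M (\<lambda>y. cmod (D y))"
        by (intro continuous_intros continuous_on_subset[OF hol_on_continuous[OF D]]) auto
      then obtain y0 where "y0 \<in> M" "\<And>y. y \<in> M \<Longrightarrow> cmod (D y0) \<le> cmod (D y)"
        using continuous_attains_inf[OF M(1) False] by metis
      then show ?thesis using DM that[of "cmod (D y0)"] by simp
    qed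
    define B where "B = R + norm x"
    have B: "cmod (y $ j - x $ j) \<le> B" if "y \<in> M" for y j
      using Finite_Cartesian_Product.norm_nth_le[of "y - x" j] norm_triangle_ineq4[of y x] R(2)[OF that] by (simp add: B_def)
    have "B > 0" using R(1) by (simp add: B_def add_pos_nonneg)
    \<comment> \<open>The perturbations in \<open>E\<close> are then at most \<open>m / 2\<close> on
      \<open>M\<close>, so the perturbed hypersurfaces still miss \<open>M\<close>.\<close>
    define \<epsilon> where "\<epsilon> = m / (2 * B)"
    have \<epsilon>: "\<epsilon> > 0" "\<epsilon> * B = m / 2" using m(1) \<open>B > 0\<close> by (auto simp: \<epsilon>_def)
    \<comment> \<open>The differential of \<open>D\<close> at \<open>x\<close> has a kernel and may
      even vanish. Together with those of \<open>D\<close> plus a multiple of each coordinate, no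
      nonzero direction is killed by all of them; \<open>None\<close> stands for \<open>D\<close>
      itself.\<close>
    define E where "E i y = (case i of None \<Rightarrow> 0 | Some j \<Rightarrow> complex_of_real \<epsilon> * (y $ j - x $ j))" for i y
    \<comment> \<open>The factor \<open>4 / m\<close> makes \<open>|F| \<ge> 2\<close> on
      \<open>M\<close>, inside the region where \<open>H (|F|^2)\<close> is pluriharmonic. At
      \<open>x\<close>, where \<open>F = 0\<close>, its Laplacian is
      \<open>4 |dF|^2 * h1 0\<close>.\<close>
    define F where "F i y = complex_of_real (4 / m) * (D y + E i y)" for i y
    have E: "hol_on UNIV (E i)" for i
      unfolding E_def by (cases i) (auto intro!: hol_on_const hol_on_mult hol_on_diff hol_on_coord)
    have F: "hol_on UNIV (F i)" for i
      unfolding F_def by (intro hol_on_mult hol_on_const hol_on_add D E)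
    have Fx: "F i x = 0" for i by (simp add: F_def E_def Dx split: option.split)
    have FM: "(cmod (F i y))\<^sup>2 \<ge> 2" if "y \<in> M" for i y
    proof -
      have "cmod (E i y) \<le> m / 2"
        using mult_left_mono[OF B[OF that], of \<epsilon>] \<epsilon> m(1) by (auto simp: E_def norm_mult split: option.split)
      then have "cmod (D y + E i y) \<ge> m / 2"
        using m(2)[OF that] norm_diff_ineq[of "D y" "E i y"] by linarith
      then have "4 / m * (m / 2) \<le> 4 / m * cmod (D y + E i y)" using m(1) by (intro mult_left_mono) auto
      then have "cmod (F i y) \<ge> 2" using m(1) unfolding F_def norm_mult norm_of_real by simp
      from power_mono[OF this, of 2] show ?thesis by simp
    qed
    let ?f = "\<lambda>y. \<Sum>i\<in>UNIV. H ((cmod (F i y))\<^sup>2)"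
    have lf: "smooth_at ?f y \<and> lap ?f y v = (\<Sum>i\<in>UNIV. 4 * (cmod (dder (F i) y v))\<^sup>2 * ((cmod (F i y))\<^sup>2 * h2 ((cmod (F i y))\<^sup>2) + h1 ((cmod (F i y))\<^sup>2)))" for y v
      using comp[OF F] by (simp add: smooth_at_sum lap_sum)
    have "Good ?f"
      unfolding Good_def using lf h(1) h(2)[OF FM] by (auto intro!: sum_nonneg)
    moreover have "lap_pos ?f x"
      unfolding lap_pos_def
    proof (intro allI impI)
      fix v :: "complex ^ 'n" assume "v \<noteq> 0"
      have sE: "smooth_at D x" "smooth_at (E i) x" for i using hol_on_smooth_at[OF open_UNIV] D E by auto
      have dF: "dder (F i) x v = complex_of_real (4 / m) * (dder D x v + dder (E i) x v)" for i
        unfolding F_def[abs_def]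
        by (subst dder_bilinear[OF bounded_bilinear_mult smooth_at_const smooth_at_add[OF sE]]) (simp add: dder_add sE)
      have "dder (E (Some j)) x v = \<epsilon> * v $ j" for j
        unfolding E_def option.case
        by (rule dder_eq) (auto intro!: derivative_eq_intros bounded_linear_imp_has_derivative bounded_linear_vec_nth)
      moreover have "dder (E None) x v = 0" by (simp add: E_def[abs_def])
      moreover obtain j where "v $ j \<noteq> 0" using \<open>v \<noteq> 0\<close> by (auto simp: vec_eq_iff)
      ultimately have "\<exists>i. dder (F i) x v \<noteq> 0"
        using dF[of None] dF[of "Some j"] m(1) \<epsilon>(1) by (cases "dder D x v = 0") (force intro: exI[of _ None] exI[of _ "Some j"])+
      then obtain i where "dder (F i) x v \<noteq> 0" ..
      then have "(\<Sum>i\<in>UNIV. 4 * (cmod (dder (F i) x v))\<^sup>2 * h1 0) > 0"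
        using h(3) by (intro sum_pos2[of _ i]) auto
      then show "lap ?f x v > 0" using lf[of x v] by (simp add: Fx)
    qed
    ultimately show "\<exists>f. Good f \<and> lap_pos f x" by blast
  qed (use W that in \<open>blast+\<close>)
  show thesis by (rule that[of \<psi>]) (use \<psi> in \<open>auto simp: Good_def\<close>)
qed

text \<open>\<open>W\<close> and \<open>\<theta>\<close> are fixed before \<open>\<psi>\<close>,
  since \<open>\<psi>\<close> is built for the complement of \<open>W\<close>. On \<open>W\<close>
  the Levi form of \<open>\<rho>\<close> is present unchanged, off \<open>T\<close> only
  \<open>\<psi>\<close> remains, and on the compact set \<open>T - W\<close> a large
  \<open>C\<close> outweighs the derivatives of the cutoff.\<close>

lemma patch_defining_function:
  fixes M S U :: "(complex ^ 'n::finite) set"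
  assumes U: "compact M" "S \<subseteq> M" "finite S" "open U" "M \<subseteq> U" and \<rho>: "\<And>x. smooth_at \<rho> x" "\<And>x. \<rho> x \<ge> 0" "\<And>x. x \<in> U - S \<Longrightarrow> lap_pos \<rho> x"
  obtains W \<theta> where "open W" "M \<subseteq> W" "W \<subseteq> U" "\<And>x. smooth_at \<theta> x" "\<And>x. \<theta> x \<ge> (0::real)" "\<And>x. x \<in> W \<Longrightarrow> \<theta> x = 1"
    "\<And>\<psi>. (\<And>x. smooth_at \<psi> x) \<Longrightarrow> (\<And>x v. lap \<psi> x v \<ge> 0) \<Longrightarrow> (\<And>x. x \<notin> W \<Longrightarrow> lap_pos \<psi> x) \<Longrightarrow>
      \<exists>C>0. (\<forall>x. smooth_at (\<lambda>y. \<theta> y * \<rho> y + C * \<psi> y) x) \<and> (\<forall>x v. lap (\<lambda>y. \<theta> y * \<rho> y + C * \<psi> y) x v \<ge> 0)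
        \<and> (\<forall>x. x \<notin> S \<longrightarrow> lap_pos (\<lambda>y. \<theta> y * \<rho> y + C * \<psi> y) x)"
proof -
  obtain \<theta> :: "complex ^ 'n \<Rightarrow> real" and W T where th: "\<And>x. smooth_at \<theta> x" "\<And>x. 0 \<le> \<theta> x"
    and W: "open W" "M \<subseteq> W" "W \<subseteq> T" "\<And>x. x \<in> W \<Longrightarrow> \<theta> x = 1" and T: "compact T" "T \<subseteq> U" "\<And>x. x \<notin> T \<Longrightarrow> \<theta> x = 0"
    using exists_cutoff[OF U(1,4,5)] by metis
  show thesis
  proof (rule that[of W \<theta>])
    fix \<psi> assume \<psi>: "\<And>x. smooth_at \<psi> x" "\<And>x v. lap \<psi> x v \<ge> 0" "\<And>x. x \<notin> W \<Longrightarrow> lap_pos \<psi> x"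
    have s: "smooth_at (\<lambda>y. \<theta> y * \<rho> y) x" for x by (intro smooth_at_mult th \<rho>)
    obtain C where C: "C > 0" "\<And>x. x \<in> T - W \<Longrightarrow> lap_pos (\<lambda>y. \<theta> y * \<rho> y + C * \<psi> y) x"
      using lap_pos_dominates[OF compact_diff[OF T(1) W(1)] s \<psi>(1) \<psi>(3)] by auto
    let ?\<phi> = "\<lambda>y. \<theta> y * \<rho> y + C * \<psi> y"
    have s\<phi>: "smooth_at ?\<phi> x" for x by (intro smooth_at_add s smooth_at_mult smooth_at_const \<psi>)
    have lap\<phi>: "lap ?\<phi> x v = lap (\<lambda>y. \<theta> y * \<rho> y) x v + C * lap \<psi> x v" for x v
      by (simp add: lap_add s smooth_at_mult \<psi>(1) lap_cmult)
    have in_W: "lap (\<lambda>y. \<theta> y * \<rho> y) x v = lap \<rho> x v" if "x \<in> W" for x v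
      by (rule lap_cong_ev) (use W that in \<open>auto simp: eventually_nhds\<close>)
    have out_T: "lap (\<lambda>y. \<theta> y * \<rho> y) x v = 0" if "x \<notin> T" for x v
    proof -
      have "open (- T)" using T(1) by (simp add: compact_imp_closed open_Compl)
      then have "\<forall>\<^sub>F y in nhds x. \<theta> y * \<rho> y = 0"
        unfolding eventually_nhds using that T(3) by (intro exI[of _ "- T"]) auto
      from lap_cong_ev[OF this, of v] show ?thesis by simp
    qed
    have pos: "lap_pos ?\<phi> x" if "x \<notin> S" for x
    proof -
      consider "x \<in> W" | "x \<in> T - W" | "x \<notin> T" "x \<notin> W" using W(3) by blast
      then show ?thesis
      proof cases
        case 1
        then have "lap_pos \<rho> x" using \<rho>(3) that W(3) T(2) by blast
        then show ?thesis
          using C(1) \<psi>(2) by (auto simp: lap_pos_def lap\<phi> in_W[OF 1] intro!: add_pos_nonneg)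
      next
        case 2
        then show ?thesis by (rule C(2))
      next
        case 3
        then show ?thesis using \<psi>(3) C(1) by (auto simp: lap_pos_def lap\<phi> out_T)
      qed
    qed
    \<comment> \<open>At a point of \<open>S\<close> the value is a limit of values at nearby points
      outside the finite set \<open>S\<close>, where positivity is known.\<close>
    have nonneg: "lap ?\<phi> x v \<ge> 0" for x v
    proof -
      have "isCont (\<lambda>y. lap ?\<phi> y v) x"
        unfolding lap_def by (intro continuous_intros smooth_at_continuous smooth_at_dder2 s\<phi>)
      then have "((\<lambda>y. lap ?\<phi> y v) \<longlongrightarrow> lap ?\<phi> x v) (at x)" by (simp add: isCont_def)
      moreover have "\<forall>\<^sub>F y in at x. lap ?\<phi> y v \<ge> 0"
      proof -
        have "open (- (S - {x}))" using U(3) by (intro open_Compl finite_imp_closed) auto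
        then have "\<forall>\<^sub>F y in at x. y \<notin> S"
          unfolding eventually_at_topological by (intro exI[of _ "- (S - {x})"]) auto
        then show ?thesis
        proof eventually_elim
          case (elim y)
          then show ?case
            using pos[of y] lap_scale[OF s\<phi>, of y 0 v] by (cases "v = 0") (auto simp: lap_pos_def less_imp_le)
        qed
      qed
      ultimately show ?thesis by (intro tendsto_lowerbound) auto
    qed
    show "\<exists>C>0. (\<forall>x. smooth_at (\<lambda>y. \<theta> y * \<rho> y + C * \<psi> y) x) \<and> (\<forall>x v. lap (\<lambda>y. \<theta> y * \<rho> y + C * \<psi> y) x v \<ge> 0)
        \<and> (\<forall>x. x \<notin> S \<longrightarrow> lap_pos (\<lambda>y. \<theta> y * \<rho> y + C * \<psi> y) x)"
      using C(1) s\<phi> nonneg pos by blast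
  qed (use th W T in auto)
qed

section \<open>The form \<open>ddc\<close> on tangent vectors\<close>

lemma ddc_eq:
  fixes \<phi> :: "complex ^ 'n::finite \<Rightarrow> real"
  assumes "\<And>x. smooth_at \<phi> x"
  shows "ddc \<phi> x v w = complex_of_real (dder2 \<phi> x w (\<i> *s v) - dder2 \<phi> x v (\<i> *s w))"
proof -
  have dc: "dc \<phi> y u = complex_of_real (- dder \<phi> y (\<i> *s u))" for y u
    by (simp add: dc_def del_def delbar_def dder_of_real assms complex_eq_iff)
  have "dder (\<lambda>y. dc \<phi> y u) x u' = complex_of_real (- dder2 \<phi> x u' (\<i> *s u))" for u u'
    unfolding dc dder2_def
    by (subst dder_of_real) (auto intro!: smooth_at_uminus smooth_at_dder assms dder_eq has_derivative_minus smooth_at_has_derivative)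
  then show ?thesis by (simp add: ddc_def ext_deriv_def)
qed

text \<open>The differential of \<open>\<rho>\<close> vanishes at all points of \<open>M\<close>, so
  its derivative along a curve in \<open>M\<close> vanishes as well. Only \<open>v\<close> has to be
  tangent; \<open>u\<close> is arbitrary, which allows \<open>\<i> *s w\<close> in its
  place.\<close>

lemma dder2_tangent_zero:
  fixes \<rho> :: "complex ^ 'n::finite \<Rightarrow> real"
  assumes "\<And>x. smooth_at \<rho> x" "\<And>x. \<rho> x \<ge> 0" "\<And>x. x \<in> M \<Longrightarrow> \<rho> x = 0" "v \<in> tangent_space M x"
  shows "dder2 \<rho> x v u = 0"
proof -
  obtain \<gamma> :: "real \<Rightarrow> complex ^ 'n" and e where g: "e > 0" "\<gamma> ` {-e<..<e} \<subseteq> M" "\<gamma> 0 = x" "(\<gamma> has_vector_derivative v) (at 0)"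
    using assms(4) unfolding tangent_space_def by blast
  have z: "dder \<rho> (\<gamma> t) u = 0" if "t \<in> {-e<..<e}" for t
  proof (rule dder_at_zero_minimum[OF assms(1) open_UNIV UNIV_I assms(2)])
    show "\<rho> (\<gamma> t) = 0" using assms(3) g(2) that by blast
  qed
  have "((\<lambda>t. dder \<rho> (\<gamma> t) u) has_derivative (\<lambda>h. dder2 \<rho> (\<gamma> 0) (h *\<^sub>R v) u)) (at 0)"
    unfolding dder2_def
    by (rule has_derivative_compose[where g = "\<lambda>y. dder \<rho> y u", OF _ smooth_at_has_derivative[OF smooth_at_dder[OF assms(1)]]])
      (use g(4) in \<open>simp add: has_vector_derivative_def\<close>)
  moreover have "((\<lambda>t. dder \<rho> (\<gamma> t) u) has_derivative (\<lambda>h. 0)) (at 0)"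
    by (rule has_derivative_transform_within_open[OF has_derivative_const, of "{-e<..<e}" _ 0]) (use g(1) z in auto)
  ultimately have "(\<lambda>h. dder2 \<rho> (\<gamma> 0) (h *\<^sub>R v) u) = (\<lambda>h. 0)" by (rule has_derivative_unique)
  from fun_cong[OF this, of 1] show ?thesis by (simp add: g(3))
qed

text \<open>Polarization of the Levi form, using the symmetry of the Hessian.\<close>

lemma dder2_if_lap_zero:
  fixes \<psi> :: "complex ^ 'n::finite \<Rightarrow> real"
  assumes s: "smooth_at \<psi> x" and z: "\<And>v. lap \<psi> x v = 0"
  shows "dder2 \<psi> x w (\<i> *s v) = dder2 \<psi> x v (\<i> *s w)"
proof -
  let ?B = "dder2 \<psi> x"
  note l1 = linear_add[OF linear_dder2_1[OF s]] and l2 = linear_add[OF linear_dder2_2[OF s]]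
  have ii: "\<i> *s (\<i> *s w) = - w" by (simp add: vec_eq_iff)
  have "lap \<psi> x (v + \<i> *s w) = lap \<psi> x v + lap \<psi> x (\<i> *s w)
     + (?B v (\<i> *s w) + ?B (\<i> *s w) v) + (?B (\<i> *s v) (\<i> *s (\<i> *s w)) + ?B (\<i> *s (\<i> *s w)) (\<i> *s v))"
    unfolding lap_def vector_add_ldistrib l1 l2 by linarith
  then have "?B v (\<i> *s w) + ?B (\<i> *s v) (- w) = 0"
    unfolding ii using z dder2_sym[OF s, of "\<i> *s w" v] dder2_sym[OF s, of "- w" "\<i> *s v"] by simp
  moreover have "?B (\<i> *s v) (- w) = - ?B w (\<i> *s v)"
    using linear_neg[OF linear_dder2_2[OF s]] dder2_sym[OF s, of w "\<i> *s v"] by simp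
  ultimately show ?thesis by simp
qed

lemma strictly_plurisubharmonic_if_lap_pos:
  assumes "\<And>x. x \<in> U \<Longrightarrow> smooth_at \<phi> x" "\<And>x. x \<in> U \<Longrightarrow> lap_pos \<phi> x"
  shows "strictly_plurisubharmonic_on U \<phi>"
  using assms by (simp add: strictly_plurisubharmonic_on_def levi_form_eq_lap lap_pos_def)

theorem theorem1p4:
  fixes k :: nat and c :: "nat \<Rightarrow> 'n::finite" and M S :: "(complex ^ 'n) set"
  assumes "k > 1"
    and "bij_betw c {0..<3 * k - 1} (UNIV :: 'n set)"
    and "smooth_submanifold (2 * k) M" and "compact M" and "connected M"
    and "S \<subseteq> M" and "finite S"
    and "\<And>p. p \<in> M - S \<Longrightarrow> totally_real_at M p"
    and "\<And>p. p \<in> S \<Longrightarrow> generic_CR_singularity k c M p"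
  shows "(\<exists>U \<rho>. open U \<and> M \<subseteq> U \<and> smooth_on U \<rho> \<and> (\<forall>x\<in>U. \<rho> x \<ge> 0) \<and>
             M = {x \<in> U. \<rho> x = 0} \<and> strictly_plurisubharmonic_on (U - S) \<rho>)
    \<and> (rationally_convex M \<longrightarrow>
         (\<exists>\<phi>. smooth_on UNIV \<phi> \<and> plurisubharmonic_on UNIV \<phi> \<and>
             strictly_plurisubharmonic_on (UNIV - S) \<phi> \<and> isotropic (ddc \<phi>) M))
    \<and> (polynomially_convex M \<longrightarrow>
         (\<exists>\<rho>. smooth_on UNIV \<rho> \<and> (\<forall>x. \<rho> x \<ge> 0) \<and> M = {x. \<rho> x = 0} \<and>
             strictly_plurisubharmonic_on (UNIV - S) \<rho>))"
proof -
  obtain U \<rho> where U: "open U" "M \<subseteq> U" and \<rho>: "\<And>x. smooth_at \<rho> x" "\<And>x. \<rho> x \<ge> (0::real)"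
    and zero: "\<And>x. x \<in> U \<Longrightarrow> \<rho> x = 0 \<longleftrightarrow> x \<in> M" and pos: "\<And>x. x \<in> U - S \<Longrightarrow> lap_pos \<rho> x"
    using BC_defining_function[OF assms(1-4,6-9)] by metis
  obtain W \<theta> where W: "open W" "M \<subseteq> W" "W \<subseteq> U" and \<theta>: "\<And>x. smooth_at \<theta> x" "\<And>x. \<theta> x \<ge> (0::real)" "\<And>x. x \<in> W \<Longrightarrow> \<theta> x = 1"
    and patch: "\<And>\<psi>. (\<And>x. smooth_at \<psi> x) \<Longrightarrow> (\<And>x v. lap \<psi> x v \<ge> 0) \<Longrightarrow> (\<And>x. x \<notin> W \<Longrightarrow> lap_pos \<psi> x) \<Longrightarrow>
      \<exists>C>0. (\<forall>x. smooth_at (\<lambda>y. \<theta> y * \<rho> y + C * \<psi> y) x) \<and> (\<forall>x v. lap (\<lambda>y. \<theta> y * \<rho> y + C * \<psi> y) x v \<ge> 0)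
        \<and> (\<forall>x. x \<notin> S \<longrightarrow> lap_pos (\<lambda>y. \<theta> y * \<rho> y + C * \<psi> y) x)"
    by (rule patch_defining_function[OF assms(4,6,7) U \<rho> pos]) blast+
  show ?thesis
  proof (intro conjI impI)
    show "\<exists>U \<rho>. open U \<and> M \<subseteq> U \<and> smooth_on U \<rho> \<and> (\<forall>x\<in>U. \<rho> x \<ge> (0::real)) \<and>
             M = {x \<in> U. \<rho> x = 0} \<and> strictly_plurisubharmonic_on (U - S) \<rho>"
      using U \<rho> zero pos
      by (intro exI[of _ U] exI[of _ \<rho>])
        (auto simp: smooth_on_iff_smooth_at intro!: strictly_plurisubharmonic_if_lap_pos)
  next
    assume "rationally_convex M"
    then obtain \<psi> :: "complex ^ 'n \<Rightarrow> real" where \<psi>: "\<And>x. smooth_at \<psi> x" "\<And>x v. lap \<psi> x v \<ge> 0"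
      "\<And>x v. x \<in> M \<Longrightarrow> lap \<psi> x v = 0" "\<And>x. x \<notin> W \<Longrightarrow> lap_pos \<psi> x"
      using rationally_convex_exhaustion[OF assms(4) _ W(1,2)] by metis
    from patch[OF \<psi>(1,2,4)] obtain C where "C > 0 \<and> (\<forall>x. smooth_at (\<lambda>y. \<theta> y * \<rho> y + C * \<psi> y) x)
        \<and> (\<forall>x v. lap (\<lambda>y. \<theta> y * \<rho> y + C * \<psi> y) x v \<ge> 0)
        \<and> (\<forall>x. x \<notin> S \<longrightarrow> lap_pos (\<lambda>y. \<theta> y * \<rho> y + C * \<psi> y) x)" ..
    then have C: "C > 0" "\<And>x. smooth_at (\<lambda>y. \<theta> y * \<rho> y + C * \<psi> y) x"
      "\<And>x v. lap (\<lambda>y. \<theta> y * \<rho> y + C * \<psi> y) x v \<ge> 0" "\<And>x. x \<notin> S \<Longrightarrow> lap_pos (\<lambda>y. \<theta> y * \<rho> y + C * \<psi> y) x"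
      by blast+
    let ?\<phi> = "\<lambda>y. \<theta> y * \<rho> y + C * \<psi> y"
    have "isotropic (ddc ?\<phi>) M"
      unfolding isotropic_def
    proof (intro ballI)
      \<comment> \<open>Near \<open>M\<close> the cutoff is 1, so the Hessian is that of
        \<open>\<rho> + C \<psi>\<close>. The part of \<open>\<rho>\<close> vanishes on tangent
        vectors, and the part of \<open>\<psi>\<close> cancels in \<open>ddc\<close> by
        polarization.\<close>
      fix x v w assume x: "x \<in> M" and v: "v \<in> tangent_space M x" and w: "w \<in> tangent_space M x"
      have "\<forall>\<^sub>F y in nhds x. ?\<phi> y = \<rho> y + C * \<psi> y"
        using W x \<theta>(3) by (auto simp: eventually_nhds)
      from dder2_cong_ev[OF this] have "dder2 ?\<phi> x a b = dder2 \<rho> x a b + C * dder2 \<psi> x a b" for a b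
        by (simp add: dder2_add \<rho> \<psi> smooth_at_mult dder2_bilinear[OF bounded_bilinear_mult])
      moreover have "dder2 \<rho> x v u = 0" "dder2 \<rho> x w u = 0" for u
        using dder2_tangent_zero[OF \<rho> _ v] dder2_tangent_zero[OF \<rho> _ w] zero U(2) by blast+
      moreover have "dder2 \<psi> x w (\<i> *s v) = dder2 \<psi> x v (\<i> *s w)"
        by (rule dder2_if_lap_zero[OF \<psi>(1) \<psi>(3)[OF x]])
      ultimately show "ddc ?\<phi> x v w = 0" by (simp add: ddc_eq[OF C(2)])
    qed
    then show "\<exists>\<phi>. smooth_on UNIV \<phi> \<and> plurisubharmonic_on UNIV \<phi> \<and>
             strictly_plurisubharmonic_on (UNIV - S) \<phi> \<and> isotropic (ddc \<phi>) M"
      using C plurisubharmonic_if_lap_nonneg[OF C(2,3)]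
      by (intro exI[of _ ?\<phi>]) (auto simp: smooth_on_iff_smooth_at intro!: strictly_plurisubharmonic_if_lap_pos)
  next
    assume "polynomially_convex M"
    then obtain \<psi> :: "complex ^ 'n \<Rightarrow> real" where \<psi>: "\<And>x. smooth_at \<psi> x" "\<And>x v. lap \<psi> x v \<ge> 0" "\<And>x. \<psi> x \<ge> 0"
      "\<And>x. x \<in> M \<Longrightarrow> \<psi> x = 0" "\<And>x. x \<notin> W \<Longrightarrow> \<psi> x > 0 \<and> lap_pos \<psi> x"
      using polynomially_convex_exhaustion[OF assms(4) _ W(1,2)] by metis
    from patch[OF \<psi>(1,2) conjunct2[OF \<psi>(5)]] obtain C where "C > 0 \<and> (\<forall>x. smooth_at (\<lambda>y. \<theta> y * \<rho> y + C * \<psi> y) x)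
        \<and> (\<forall>x v. lap (\<lambda>y. \<theta> y * \<rho> y + C * \<psi> y) x v \<ge> 0)
        \<and> (\<forall>x. x \<notin> S \<longrightarrow> lap_pos (\<lambda>y. \<theta> y * \<rho> y + C * \<psi> y) x)" ..
    then have C: "C > 0" "\<And>x. smooth_at (\<lambda>y. \<theta> y * \<rho> y + C * \<psi> y) x"
      "\<And>x. x \<notin> S \<Longrightarrow> lap_pos (\<lambda>y. \<theta> y * \<rho> y + C * \<psi> y) x"
      by blast+
    let ?\<phi> = "\<lambda>y. \<theta> y * \<rho> y + C * \<psi> y"
    have nn: "\<theta> x * \<rho> x \<ge> 0" "C * \<psi> x \<ge> 0" for x using \<theta>(2) \<rho>(2) \<psi>(3) C(1) by simp_all
    have "?\<phi> x = 0 \<longleftrightarrow> x \<in> M" for x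
    proof
      assume "?\<phi> x = 0"
      then have "\<theta> x * \<rho> x = 0" "C * \<psi> x = 0" using nn[of x] by linarith+
      \<comment> \<open>Off \<open>W\<close> the summand \<open>C * \<psi>\<close> is positive;
        inside \<open>W\<close> the cutoff is 1 and the zeros are those of
        \<open>\<rho>\<close>.\<close>
      then have "x \<in> W" using \<psi>(5)[of x] C(1) by auto
      then show "x \<in> M" using \<open>\<theta> x * \<rho> x = 0\<close> \<theta>(3) zero W(3) by auto
    next
      assume "x \<in> M"
      then show "?\<phi> x = 0" using \<psi>(4) zero U(2) by auto
    qed
    then show "\<exists>\<rho>. smooth_on UNIV \<rho> \<and> (\<forall>x. \<rho> x \<ge> (0::real)) \<and> M = {x. \<rho> x = 0} \<and>
             strictly_plurisubharmonic_on (UNIV - S) \<rho>"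
      using C nn by (intro exI[of _ ?\<phi>])
        (auto simp: smooth_on_iff_smooth_at intro!: strictly_plurisubharmonic_if_lap_pos add_nonneg_nonneg)
  qed
qed

end
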